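(* Consider the $d$-dimensional Schrödinger equation $\frac{d|U(t)\rangle}{dt}=i{\bf H}_{BS}|U(t)\rangle$, where ${\bf H}_{BS}$ is the $d$-dimensional Black–Scholes Hamiltonian (uncorrelated case $\rho_{mn}=0$ for $m\ne n$) defined in the context. For a time increment $\tau>0$, the time evolution operator ${\bf U}_{BS}(\tau)=\exp(i{\bf H}_{BS}\tau)$ is approximated by the unitary operator ${\bf V}_{BS}(\tau)$ defined in the context, with error in the operator norm bounded by $$\|{\bf U}_{BS}(\tau)-{\bf V}_{BS}(\tau)\|\le\frac14\,\tau^2n_x\left(N_p\gamma_1^2+2\gamma_2^2+2N_p\gamma_1\gamma_2\right)\sum_{m=1}^dc_m^2,$$ where $d$ is the spatial dimension, $N_p=2^{n_p}$ and $N_x-1=2^{n_x}$ are the numbers of grid points for $p$ and for each $x$-variable, $\gamma_1=\frac1{h^2L_p}$, $\gamma_2=\frac1{2h}$, and $c_m=\max\left(r-\frac{\sigma_m^2}{2},\frac{\sigma_m^2\rho_{mm}}{2}\right)$.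
   Context: Parameters: risk-free rate $r>0$, volatilities $\sigma_1,\dots,\sigma_d>0$, correlation coefficients $\rho_{mn}\in[-1,1]$ of the assets ($\rho_{mm}$ being that of the $m$-th asset with itself), with $\rho_{mn}=0$ for $m\neq n$; mesh size $h>0$ in each log-price variable; auxiliary variable $p\in[-\pi L_p,\pi L_p]$ with $N_p=2^{n_p}$ grid points. Let $\sigma_{01}=|0\rangle\langle1|$, $\sigma_{10}=|1\rangle\langle0|$, $I$ the $2\times2$ identity. On $n_x$ qubits put, for $1\le j\le n_x$, $s_j^-=I^{\otimes(n_x-j)}\otimes\sigma_{01}\otimes\sigma_{10}^{\otimes(j-1)}$, $s_j^+=(s_j^-)^\dagger$, so that $\sum_js_j^-=\sum_{l=1}^{2^{n_x}-1}|l-1\rangle\langle l|$. Let $$H_1=\gamma_1\Big[\sum_{j=1}^{n_x}(s_j^-+s_j^+)-2I^{\otimes n_x}\Big],\qquad H_2=-i\gamma_2\sum_{j=1}^{n_x}(s_j^--s_j^+).$$ For an operator $G$ on $n_x$ qubits, $(G)_m=I^{\otimes(m-1)n_x}\otimes G\otimes I^{\otimes(d-m)n_x}$. On ($dn_x$ qubits) $\otimes$ ($n_p$ qubits), $${\bf H}_{BS}=\sum_{k=0}^{N_p-1}\left(k-\tfrac{N_p}2\right)\sum_{m=1}^d\tfrac{\sigma_m^2\rho_{mm}}{2}(H_1)_m\otimes|k\rangle\langle k|+\sum_{m=1}^d\left(r-\tfrac{\sigma_m^2}{2}\right)(H_2)_m\otimes I^{\otimes n_p}.$$ For real $\theta,\lambda$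 let $W_j(\theta,\lambda)$ be the $j$-qubit unitary with $I^{\otimes(n_x-j)}\otimes W_j(\theta,\lambda)=\exp\left(i\theta(e^{i\lambda}s_j^-+e^{-i\lambda}s_j^+)\right)$. Define $$V_1(\tau)=e^{-2i\gamma_1\tau}\prod_{j=1}^{n_x}I^{\otimes(n_x-j)}\otimes W_j(\gamma_1\tau,0),\qquad V_2(\tau)=\prod_{j=1}^{n_x}I^{\otimes(n_x-j)}\otimes W_j\left(\gamma_2\tau,-\tfrac\pi2\right),$$ $$\tilde{\bf V}_1(\tau)=\prod_{m=1}^dV_1\left(\tfrac{\sigma_m^2\rho_{mm}}{2}\tau\right)_m,\qquad\tilde{\bf V}_2(\tau)=\prod_{m=1}^dV_2\left(\left(r-\tfrac{\sigma_m^2}{2}\right)\tau\right)_m,$$ $${\bf V}_{BS}(\tau)=\left(\tilde{\bf V}_2(\tau)\otimes I^{\otimes n_p}\right)\sum_{k=0}^{N_p-1}\tilde{\bf V}_1(\tau)^{k-N_p/2}\otimes|k\rangle\langle k|.$$ *)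

theory Defs
  imports Complex_Main
    "Jordan_Normal_Form.Gauss_Jordan_Elimination"
    "Jordan_Normal_Form.Schur_Decomposition"
begin

section \<open>Matrix notions that the library lacks\<close>

definition vec_norm2 :: "complex vec \<Rightarrow> real" where
  "vec_norm2 v = sqrt (\<Sum>i<dim_vec v. (cmod (v $ i))\<^sup>2)"

definition op_norm :: "complex mat \<Rightarrow> real" where
  "op_norm A = Sup {vec_norm2 (A *\<^sub>v v) | v. v \<in> carrier_vec (dim_col A) \<and> vec_norm2 v \<le> 1}"

definition unitary_mat :: "complex mat \<Rightarrow> bool" where
  "unitary_mat A \<longleftrightarrow> square_mat A \<and>
     mat_adjoint A * A = 1\<^sub>m (dim_row A) \<and> A * mat_adjoint A = 1\<^sub>m (dim_row A)"

text \<open>The power series is summed entrywise; for a square matrix every entry converges absolutely.\<close>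

definition mat_exp :: "complex mat \<Rightarrow> complex mat" where
  "mat_exp A = mat (dim_row A) (dim_row A) (\<lambda>(i, j). \<Sum>k. (A ^\<^sub>m k) $$ (i, j) / fact k)"

text \<open>Integer powers; only meaningful for invertible matrices when the exponent is negative.\<close>

definition mat_powi :: "complex mat \<Rightarrow> int \<Rightarrow> complex mat" where
  "mat_powi A z = (if z \<ge> 0 then A ^\<^sub>m nat z else the (mat_inverse A) ^\<^sub>m nat (- z))"

text \<open>The type of matrices is not a monoid, so that sums and products over index sets need the
  dimension \<open>N\<close>. The factors of a product are multiplied from left to right in list order.\<close>

definition mat_sum :: "nat \<Rightarrow> (nat \<Rightarrow> complex mat) \<Rightarrow> nat set \<Rightarrow> complex mat" where
  "mat_sum N f S = mat N N (\<lambda>(i, j). \<Sum>k\<in>S. f k $$ (i, j))"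

definition mat_prod :: "nat \<Rightarrow> (nat \<Rightarrow> complex mat) \<Rightarrow> nat list \<Rightarrow> complex mat" where
  "mat_prod N f ks = foldr (\<lambda>k A. f k * A) ks (1\<^sub>m N)"

text \<open>Kronecker product; the left factor carries the most significant part of the index.\<close>

definition kron :: "complex mat \<Rightarrow> complex mat \<Rightarrow> complex mat" (infixr \<open>\<otimes>\<^sub>k\<close> 72) where
  "A \<otimes>\<^sub>k B = mat (dim_row A * dim_row B) (dim_col A * dim_col B)
     (\<lambda>(i, j). A $$ (i div dim_row B, j div dim_col B) * B $$ (i mod dim_row B, j mod dim_col B))"

fun kron_pow :: "complex mat \<Rightarrow> nat \<Rightarrow> complex mat" where
  "kron_pow A 0 = 1\<^sub>m 1"
| "kron_pow A (Suc n) = A \<otimes>\<^sub>k kron_pow A n"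

text \<open>\<open>ket_bra N a b\<close> is $|a\rangle\langle b|$ in dimension \<open>N\<close>.\<close>

definition ket_bra :: "nat \<Rightarrow> nat \<Rightarrow> nat \<Rightarrow> complex mat" where
  "ket_bra N a b = mat N N (\<lambda>(i, j). if i = a \<and> j = b then 1 else 0)"

section \<open>Operators on one register\<close>

definition idq :: "nat \<Rightarrow> complex mat" where
  "idq n = kron_pow (1\<^sub>m 2) n"

definition s_minus :: "nat \<Rightarrow> nat \<Rightarrow> complex mat" where
  "s_minus n j = idq (n - j) \<otimes>\<^sub>k ket_bra 2 0 1 \<otimes>\<^sub>k kron_pow (ket_bra 2 1 0) (j - 1)"

definition s_plus :: "nat \<Rightarrow> nat \<Rightarrow> complex mat" where
  "s_plus n j = mat_adjoint (s_minus n j)"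

definition H1 :: "nat \<Rightarrow> real \<Rightarrow> complex mat" where
  "H1 n \<gamma>1 = complex_of_real \<gamma>1 \<cdot>\<^sub>m
     (mat_sum (2 ^ n) (\<lambda>j. s_minus n j + s_plus n j) {1..n} - 2 \<cdot>\<^sub>m idq n)"

definition H2 :: "nat \<Rightarrow> real \<Rightarrow> complex mat" where
  "H2 n \<gamma>2 = (- \<i> * complex_of_real \<gamma>2) \<cdot>\<^sub>m
     mat_sum (2 ^ n) (\<lambda>j. s_minus n j - s_plus n j) {1..n}"

text \<open>The operator on the right-hand side acts trivially on the first \<open>n - j\<close> qubits, so
  that for \<open>1 \<le> j \<le> n\<close> the described matrix exists, and it is unique.\<close>

definition W_gate :: "nat \<Rightarrow> nat \<Rightarrow> real \<Rightarrow> real \<Rightarrow> complex mat" where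
  "W_gate n j \<theta> \<phi> = (THE W. W \<in> carrier_mat (2 ^ j) (2 ^ j) \<and> unitary_mat W \<and>
     idq (n - j) \<otimes>\<^sub>k W =
       mat_exp ((\<i> * complex_of_real \<theta>) \<cdot>\<^sub>m
         (exp (\<i> * complex_of_real \<phi>) \<cdot>\<^sub>m s_minus n j
          + exp (- \<i> * complex_of_real \<phi>) \<cdot>\<^sub>m s_plus n j)))"

definition V1 :: "nat \<Rightarrow> real \<Rightarrow> real \<Rightarrow> complex mat" where
  "V1 n \<gamma>1 \<tau> = exp (- 2 * \<i> * complex_of_real (\<gamma>1 * \<tau>)) \<cdot>\<^sub>m
     mat_prod (2 ^ n) (\<lambda>j. idq (n - j) \<otimes>\<^sub>k W_gate n j (\<gamma>1 * \<tau>) 0) [1..<Suc n]"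

definition V2 :: "nat \<Rightarrow> real \<Rightarrow> real \<Rightarrow> complex mat" where
  "V2 n \<gamma>2 \<tau> =
     mat_prod (2 ^ n) (\<lambda>j. idq (n - j) \<otimes>\<^sub>k W_gate n j (\<gamma>2 * \<tau>) (- pi / 2)) [1..<Suc n]"

section \<open>The Black--Scholes operators\<close>

definition on_register :: "nat \<Rightarrow> nat \<Rightarrow> complex mat \<Rightarrow> nat \<Rightarrow> complex mat" where
  "on_register d n G m = idq ((m - 1) * n) \<otimes>\<^sub>k G \<otimes>\<^sub>k idq ((d - m) * n)"

definition H_BS :: "nat \<Rightarrow> nat \<Rightarrow> nat \<Rightarrow> real \<Rightarrow> real \<Rightarrow> real \<Rightarrow> (nat \<Rightarrow> real)
    \<Rightarrow> (nat \<Rightarrow> nat \<Rightarrow> real) \<Rightarrow> complex mat" where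
  "H_BS d nx np \<gamma>1 \<gamma>2 r \<sigma> \<rho> =
     mat_sum (2 ^ (d * nx + np))
       (\<lambda>k. complex_of_real (real k - real (2 ^ np) / 2) \<cdot>\<^sub>m
          (mat_sum (2 ^ (d * nx))
             (\<lambda>m. complex_of_real ((\<sigma> m)\<^sup>2 * \<rho> m m / 2) \<cdot>\<^sub>m on_register d nx (H1 nx \<gamma>1) m) {1..d}
           \<otimes>\<^sub>k ket_bra (2 ^ np) k k)) {0..<2 ^ np}
     + mat_sum (2 ^ (d * nx + np))
       (\<lambda>m. complex_of_real (r - (\<sigma> m)\<^sup>2 / 2) \<cdot>\<^sub>m (on_register d nx (H2 nx \<gamma>2) m \<otimes>\<^sub>k idq np)) {1..d}"

definition U_BS :: "nat \<Rightarrow> nat \<Rightarrow> nat \<Rightarrow> real \<Rightarrow> real \<Rightarrow> real \<Rightarrow> (nat \<Rightarrow> real)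
    \<Rightarrow> (nat \<Rightarrow> nat \<Rightarrow> real) \<Rightarrow> real \<Rightarrow> complex mat" where
  "U_BS d nx np \<gamma>1 \<gamma>2 r \<sigma> \<rho> \<tau> = mat_exp ((\<i> * complex_of_real \<tau>) \<cdot>\<^sub>m H_BS d nx np \<gamma>1 \<gamma>2 r \<sigma> \<rho>)"

definition V1_tilde :: "nat \<Rightarrow> nat \<Rightarrow> real \<Rightarrow> (nat \<Rightarrow> real) \<Rightarrow> (nat \<Rightarrow> nat \<Rightarrow> real) \<Rightarrow> real
    \<Rightarrow> complex mat" where
  "V1_tilde d nx \<gamma>1 \<sigma> \<rho> \<tau> =
     mat_prod (2 ^ (d * nx))
       (\<lambda>m. on_register d nx (V1 nx \<gamma>1 ((\<sigma> m)\<^sup>2 * \<rho> m m / 2 * \<tau>)) m) [1..<Suc d]"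

definition V2_tilde :: "nat \<Rightarrow> nat \<Rightarrow> real \<Rightarrow> real \<Rightarrow> (nat \<Rightarrow> real) \<Rightarrow> real \<Rightarrow> complex mat" where
  "V2_tilde d nx \<gamma>2 r \<sigma> \<tau> =
     mat_prod (2 ^ (d * nx))
       (\<lambda>m. on_register d nx (V2 nx \<gamma>2 ((r - (\<sigma> m)\<^sup>2 / 2) * \<tau>)) m) [1..<Suc d]"

text \<open>The integer exponent equals $k - N_p/2$ as soon as \<open>np \<ge> 1\<close>.\<close>

definition V_BS :: "nat \<Rightarrow> nat \<Rightarrow> nat \<Rightarrow> real \<Rightarrow> real \<Rightarrow> real \<Rightarrow> (nat \<Rightarrow> real)
    \<Rightarrow> (nat \<Rightarrow> nat \<Rightarrow> real) \<Rightarrow> real \<Rightarrow> complex mat" where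
  "V_BS d nx np \<gamma>1 \<gamma>2 r \<sigma> \<rho> \<tau> =
     (V2_tilde d nx \<gamma>2 r \<sigma> \<tau> \<otimes>\<^sub>k idq np) *
     mat_sum (2 ^ (d * nx + np))
       (\<lambda>k. mat_powi (V1_tilde d nx \<gamma>1 \<sigma> \<rho> \<tau>) (int k - int (2 ^ np div 2)) \<otimes>\<^sub>k ket_bra (2 ^ np) k k)
       {0..<2 ^ np}"

end

theory Submission
  imports Defs "HOL-Analysis.L2_Norm"
begin

text \<open>
  In the basis of the auxiliary variable both evolutions are block diagonal, and the block of \<open>k\<close>
  compares $\exp(i\tau(Q + \kappa A))$ with $\tilde V_2 \tilde V_1^{\kappa}$, where
  $\kappa = k - N_p/2$, $|\kappa| \le N_p/2$, and \<open>A\<close>, \<open>Q\<close> are the sums of the register copies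
  of \<open>H1\<close> and \<open>H2\<close>. For skew-adjoint \<open>X\<close>, \<open>Y\<close> one has
  $\|e^{X+Y} - e^X e^Y\| \le \frac12 \|[X, Y]\|$. This is used twice. Different registers
  commute and $[H_2, H_1] = 2i\gamma_1\gamma_2(|N-1\rangle\langle N-1| - |0\rangle\langle 0|)$,
  which gives the mixed term. Inside one register, the terms
  $e^{i\lambda}s_j^- + e^{-i\lambda}s_j^+$ are weighted adjacency matrices of matchings of a path;
  those with $j \ge 2$ have disjoint supports and hence commute, so that the product of gates differs
  from the exponential of the sum by at most half the commutator of the \<open>j = 1\<close> term with
  the remaining sum. Both have norm at most one, and the commutator vanishes for one
  qubit, so its norm is at most $n_x$. Telescoping over registers and over the $|\kappa|$ factors of
  the power adds up these errors.
\<close>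

section \<open>Operator norm bounds and unitary matrices\<close>

text \<open>Power series estimates of the exponentials would bring the norms of the Hamiltonians,
  with their factors k - N_p/2, into the error to higher order. Differentiating products of unitary
  matrices avoids this: unitary factors drop out of every norm and the commutator alone remains,
  with the constant 1/2 that comes from integrating a linear bound. At commutator zero the same
  estimate yields exp(X + Y) = exp X exp Y, so that exact factorizations and error bounds have one
  source. The obstacle inside a register is to bound a sum of n_x hopping terms by a constant.
  Binary carries help: the edge between k - 1 and k belongs to the term fixed by the power of 2 in
  k, so all terms but the first together cover just the edges with even k. The factor 1/4 is the 1/2
  above times the 1/2 of N_p/2. The square of \<gamma>2 enters without N_p and with coefficient 2,
  because \<open>H2\<close> carries no factor k - N_p/2.\<close>

lemma vec_norm2_L2_set: "vec_norm2 v = L2_set (\<lambda>i. cmod (v $ i)) {..<dim_vec v}"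
  by (simp add: vec_norm2_def L2_set_def)

lemma vec_norm2_nonneg [simp]: "0 \<le> vec_norm2 v"
  by (simp add: vec_norm2_L2_set)

lemma vec_norm2_power2: "(vec_norm2 v)\<^sup>2 = (\<Sum>i<dim_vec v. (cmod (v $ i))\<^sup>2)"
  by (simp add: vec_norm2_def sum_nonneg)

lemma vec_norm2_triangle:
  assumes "dim_vec u = dim_vec v"
  shows "vec_norm2 (u + v) \<le> vec_norm2 u + vec_norm2 v"
proof -
  have "vec_norm2 (u + v) \<le> L2_set (\<lambda>i. cmod (u $ i) + cmod (v $ i)) {..<dim_vec v}"
    unfolding vec_norm2_L2_set by (auto intro!: L2_set_mono simp: norm_triangle_ineq)
  also have "\<dots> \<le> vec_norm2 u + vec_norm2 v"
    unfolding vec_norm2_L2_set assms by (rule L2_set_triangle_ineq)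
  finally show ?thesis .
qed

lemma vec_norm2_smult: "vec_norm2 (c \<cdot>\<^sub>v v) = cmod c * vec_norm2 v"
  by (auto simp: vec_norm2_L2_set L2_set_right_distrib norm_mult intro!: L2_set_cong)

lemma vec_norm2_zero_vec [simp]: "vec_norm2 (0\<^sub>v n) = 0"
  by (simp add: vec_norm2_def)

lemma cmod_index_le_vec_norm2:
  assumes "i < dim_vec v"
  shows "cmod (v $ i) \<le> vec_norm2 v"
  unfolding vec_norm2_L2_set using assms by (intro member_le_L2_set) auto

text \<open>Bounds are carried as a homogeneous inequality over all vectors instead of statements
  about the supremum in \<open>op_norm\<close>: sums, products and block matrices then reduce to
  inequalities between vectors. The constant may be any real number; where its sign matters, that is
  assumed separately.\<close>

definition op_bounded :: "complex mat \<Rightarrow> real \<Rightarrow> bool" where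
  "op_bounded M c \<longleftrightarrow> (\<forall>v\<in>carrier_vec (dim_col M). vec_norm2 (M *\<^sub>v v) \<le> c * vec_norm2 v)"

lemma op_boundedD:
  "op_bounded M c \<Longrightarrow> v \<in> carrier_vec (dim_col M) \<Longrightarrow> vec_norm2 (M *\<^sub>v v) \<le> c * vec_norm2 v"
  by (simp add: op_bounded_def)

lemma op_bounded_mono: "op_bounded M c \<Longrightarrow> c \<le> c' \<Longrightarrow> op_bounded M c'"
  unfolding op_bounded_def by (meson mult_right_mono order_trans vec_norm2_nonneg)

text \<open>The return to the supremum. The zero vector keeps the set nonempty, and
  \<open>0 \<le> c\<close> turns \<open>c * vec_norm2 v\<close> into \<open>c\<close> on the unit
  ball.\<close>

lemma op_norm_le:
  assumes "op_bounded M c" "0 \<le> c"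
  shows "op_norm M \<le> c"
  unfolding op_norm_def
proof (rule cSup_least)
  have "vec_norm2 (M *\<^sub>v 0\<^sub>v (dim_col M)) \<in>
      {vec_norm2 (M *\<^sub>v v) |v. v \<in> carrier_vec (dim_col M) \<and> vec_norm2 v \<le> 1}"
    by (intro CollectI exI [of _ "0\<^sub>v (dim_col M)"]) auto
  then show "{vec_norm2 (M *\<^sub>v v) |v. v \<in> carrier_vec (dim_col M) \<and> vec_norm2 v \<le> 1} \<noteq> {}"
    by blast
next
  fix x assume "x \<in> {vec_norm2 (M *\<^sub>v v) |v. v \<in> carrier_vec (dim_col M) \<and> vec_norm2 v \<le> 1}"
  then obtain v where v: "v \<in> carrier_vec (dim_col M)" "vec_norm2 v \<le> 1" and x: "x = vec_norm2 (M *\<^sub>v v)"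
    by blast
  have "x \<le> c * vec_norm2 v"
    using op_boundedD [OF assms(1) v(1)] x by simp
  also have "\<dots> \<le> c"
    using v(2) assms(2) mult_left_le by blast
  finally show "x \<le> c" .
qed

lemma op_bounded_zero [simp]: "op_bounded (0\<^sub>m n m) 0"
  by (auto simp: op_bounded_def vec_norm2_def)

lemma op_bounded_add:
  assumes "A \<in> carrier_mat n m" "B \<in> carrier_mat n m" "op_bounded A a" "op_bounded B b"
  shows "op_bounded (A + B) (a + b)"
  unfolding op_bounded_def
proof
  fix v :: "complex vec" assume v: "v \<in> carrier_vec (dim_col (A + B))"
  then have v': "v \<in> carrier_vec m" using assms by simp
  have "vec_norm2 ((A + B) *\<^sub>v v) \<le> vec_norm2 (A *\<^sub>v v) + vec_norm2 (B *\<^sub>v v)"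
    using assms v' vec_norm2_triangle [of "A *\<^sub>v v" "B *\<^sub>v v"]
    by (simp add: add_mult_distrib_mat_vec [of _ n m])
  also have "\<dots> \<le> a * vec_norm2 v + b * vec_norm2 v"
    using assms v' by (intro add_mono op_boundedD) auto
  finally show "vec_norm2 ((A + B) *\<^sub>v v) \<le> (a + b) * vec_norm2 v"
    by (simp add: algebra_simps)
qed

lemma op_bounded_smult:
  assumes "op_bounded A a"
  shows "op_bounded (c \<cdot>\<^sub>m A) (cmod c * a)"
  unfolding op_bounded_def
proof
  fix v :: "complex vec" assume v: "v \<in> carrier_vec (dim_col (c \<cdot>\<^sub>m A))"
  have eq: "(c \<cdot>\<^sub>m A) *\<^sub>v v = c \<cdot>\<^sub>v (A *\<^sub>v v)"
    using v by (intro eq_vecI) auto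
  show "vec_norm2 ((c \<cdot>\<^sub>m A) *\<^sub>v v) \<le> cmod c * a * vec_norm2 v"
    unfolding eq vec_norm2_smult mult.assoc
    using v by (intro mult_left_mono op_boundedD [OF assms]) auto
qed

lemma op_bounded_uminus:
  assumes "op_bounded A a"
  shows "op_bounded (- A) a"
proof -
  have "- A = (- 1) \<cdot>\<^sub>m A" by (intro eq_matI) auto
  with op_bounded_smult [OF assms, of "- 1"] show ?thesis by simp
qed

lemma op_bounded_diff:
  assumes "A \<in> carrier_mat n m" "B \<in> carrier_mat n m" "op_bounded A a" "op_bounded B b"
  shows "op_bounded (A - B) (a + b)"
  unfolding add_uminus_minus_mat [OF assms(1,2), symmetric]
  by (rule op_bounded_add) (use assms op_bounded_uminus in auto)

lemma op_bounded_diff_commute: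
  assumes "A \<in> carrier_mat n m" "B \<in> carrier_mat n m" "op_bounded (A - B) c"
  shows "op_bounded (B - A) c"
proof -
  have "B - A = - (A - B)" using assms by (intro eq_matI) auto
  with op_bounded_uminus [OF assms(3)] show ?thesis by simp
qed

lemma op_bounded_diff_trans:
  assumes "A \<in> carrier_mat n m" "B \<in> carrier_mat n m" "C \<in> carrier_mat n m"
    "op_bounded (A - B) a" "op_bounded (B - C) b"
  shows "op_bounded (A - C) (a + b)"
proof -
  have "A - C = (A - B) + (B - C)" using assms by (intro eq_matI) auto
  moreover have "op_bounded \<dots> (a + b)"
    by (rule op_bounded_add [of _ n m]) (use assms in auto)
  ultimately show ?thesis by simp
qed

lemma op_bounded_mult:
  assumes "A \<in> carrier_mat n m" "B \<in> carrier_mat m l" "op_bounded A a" "op_bounded B b" "0 \<le> a"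
  shows "op_bounded (A * B) (a * b)"
  unfolding op_bounded_def
proof
  fix v :: "complex vec" assume v: "v \<in> carrier_vec (dim_col (A * B))"
  then have v': "v \<in> carrier_vec l" using assms by simp
  have "vec_norm2 ((A * B) *\<^sub>v v) \<le> a * vec_norm2 (B *\<^sub>v v)"
    using assms v' op_boundedD [OF assms(3), of "B *\<^sub>v v"]
    by (simp add: assoc_mult_mat_vec [of _ n m _ l])
  also have "\<dots> \<le> a * (b * vec_norm2 v)"
    using assms v' by (intro mult_left_mono op_boundedD) auto
  finally show "vec_norm2 ((A * B) *\<^sub>v v) \<le> a * b * vec_norm2 v"
    by (simp add: algebra_simps)
qed

text \<open>Columns are images of unit vectors, so a zero bound kills all of them. In this way exact
  matrix identities follow from norm estimates with vanishing error.\<close>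

lemma op_bounded_0_imp_zero:
  assumes "M \<in> carrier_mat n m" "op_bounded M 0"
  shows "M = 0\<^sub>m n m"
proof (rule eq_matI)
  fix i j assume "i < dim_row (0\<^sub>m n m)" "j < dim_col (0\<^sub>m n m)"
  then have ij: "i < n" "j < m" by auto
  have "cmod ((M *\<^sub>v unit_vec m j) $ i) \<le> vec_norm2 (M *\<^sub>v unit_vec m j)"
    using assms(1) ij by (intro cmod_index_le_vec_norm2) auto
  also have "\<dots> \<le> 0"
    using op_boundedD [OF assms(2), of "unit_vec m j"] assms(1) by simp
  finally show "M $$ (i, j) = 0\<^sub>m n m $$ (i, j)"
    using assms(1) ij by simp
qed (use assms in auto)

lemma op_bounded_if_vec_norm2_le:
  assumes "\<And>v. v \<in> carrier_vec (dim_col M) \<Longrightarrow> (vec_norm2 (M *\<^sub>v v))\<^sup>2 \<le> (vec_norm2 v)\<^sup>2"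
  shows "op_bounded M 1"
  unfolding op_bounded_def using assms by (auto intro: power2_le_imp_le)

text \<open>Schur's test, by the arithmetic-geometric mean inequality.\<close>

lemma op_bounded_row_col_sums:
  assumes M: "M \<in> carrier_mat n n"
    and rows: "\<And>i. i < n \<Longrightarrow> (\<Sum>j<n. cmod (M $$ (i, j))) \<le> 1"
    and cols: "\<And>j. j < n \<Longrightarrow> (\<Sum>i<n. cmod (M $$ (i, j))) \<le> 1"
  shows "op_bounded M 1"
proof (rule op_bounded_if_vec_norm2_le)
  fix v :: "complex vec" assume "v \<in> carrier_vec (dim_col M)"
  then have v: "v \<in> carrier_vec n" using M by simp
  define w where "w = M *\<^sub>v v"
  have w: "dim_vec w = n" using M by (simp add: w_def)
  have wi: "w $ i = (\<Sum>j<n. M $$ (i, j) * v $ j)" if "i < n" for i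
    using that M v by (simp add: w_def scalar_prod_def lessThan_atLeast0)
  have amgm: "x * y \<le> (x\<^sup>2 + y\<^sup>2) / 2" for x y :: real
    using sum_squares_bound [of x y] by simp
  have "(vec_norm2 w)\<^sup>2 = (\<Sum>i<n. cmod (w $ i) * cmod (\<Sum>j<n. M $$ (i, j) * v $ j))"
    unfolding vec_norm2_power2 w by (intro sum.cong refl) (simp add: wi power2_eq_square)
  also have "\<dots> \<le> (\<Sum>i<n. cmod (w $ i) * (\<Sum>j<n. cmod (M $$ (i, j)) * cmod (v $ j)))"
    by (intro sum_mono mult_left_mono) (auto simp: norm_mult intro!: order_trans [OF norm_sum])
  also have "\<dots> = (\<Sum>i<n. \<Sum>j<n. cmod (M $$ (i, j)) * (cmod (w $ i) * cmod (v $ j)))"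
    by (simp add: sum_distrib_left algebra_simps)
  also have "\<dots> \<le> (\<Sum>i<n. \<Sum>j<n. cmod (M $$ (i, j)) * (((cmod (w $ i))\<^sup>2 + (cmod (v $ j))\<^sup>2) / 2))"
    by (intro sum_mono mult_left_mono amgm) auto
  also have "\<dots> = (\<Sum>i<n. (cmod (w $ i))\<^sup>2 / 2 * (\<Sum>j<n. cmod (M $$ (i, j))))
      + (\<Sum>i<n. \<Sum>j<n. (cmod (v $ j))\<^sup>2 / 2 * cmod (M $$ (i, j)))"
    unfolding sum_distrib_left sum.distrib [symmetric] by (intro sum.cong refl) (simp add: field_simps)
  also have "(\<Sum>i<n. \<Sum>j<n. (cmod (v $ j))\<^sup>2 / 2 * cmod (M $$ (i, j)))
      = (\<Sum>j<n. (cmod (v $ j))\<^sup>2 / 2 * (\<Sum>i<n. cmod (M $$ (i, j))))"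
    by (subst sum.swap) (simp add: sum_distrib_left)
  also have "(\<Sum>i<n. (cmod (w $ i))\<^sup>2 / 2 * (\<Sum>j<n. cmod (M $$ (i, j)))) \<le> (\<Sum>i<n. (cmod (w $ i))\<^sup>2 / 2 * 1)"
    using rows by (intro sum_mono mult_left_mono) auto
  also have "(\<Sum>j<n. (cmod (v $ j))\<^sup>2 / 2 * (\<Sum>i<n. cmod (M $$ (i, j)))) \<le> (\<Sum>j<n. (cmod (v $ j))\<^sup>2 / 2 * 1)"
    using cols by (intro sum_mono mult_left_mono) auto
  \<comment> \<open>Half of the left-hand side reappears on the right and is absorbed, so that no
    division by the norm of \<open>w\<close> occurs.\<close>
  finally have "(vec_norm2 w)\<^sup>2 \<le> (vec_norm2 w)\<^sup>2 / 2 + (vec_norm2 v)\<^sup>2 / 2"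
    using v w by (simp add: vec_norm2_power2 sum_divide_distrib)
  then show "(vec_norm2 (M *\<^sub>v v))\<^sup>2 \<le> (vec_norm2 v)\<^sup>2"
    unfolding w_def by linarith
qed

section \<open>Adjoints and unitary matrices\<close>

lemma mat_adjoint_dim [simp]:
  "dim_row (mat_adjoint A) = dim_col A" "dim_col (mat_adjoint A) = dim_row A"
  by (auto simp: mat_adjoint_def)

lemma mat_adjoint_carrier [simp]: "mat_adjoint A \<in> carrier_mat n m \<longleftrightarrow> A \<in> carrier_mat m n"
  unfolding carrier_mat_def by auto

lemma mat_adjoint_index [simp]:
  "i < dim_col A \<Longrightarrow> j < dim_row A \<Longrightarrow> mat_adjoint A $$ (i, j) = cnj (A $$ (j, i))"
  for A :: "complex mat"
  by (simp add: mat_adjoint_def mat_of_rows_index)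

lemma mat_adjoint_adjoint [simp]: "mat_adjoint (mat_adjoint A) = A" for A :: "complex mat"
  by (intro eq_matI) auto

lemma mat_adjoint_mult:
  fixes A B :: "complex mat"
  assumes "dim_col A = dim_row B"
  shows "mat_adjoint (A * B) = mat_adjoint B * mat_adjoint A"
  using assms by (intro eq_matI) (auto simp: scalar_prod_def algebra_simps)

lemma mat_adjoint_smult: "mat_adjoint (c \<cdot>\<^sub>m A) = cnj c \<cdot>\<^sub>m mat_adjoint A" for A :: "complex mat"
  by (intro eq_matI) auto

lemma mat_adjoint_one [simp]: "mat_adjoint (1\<^sub>m n) = (1\<^sub>m n :: complex mat)"
  by (intro eq_matI) auto

lemma mat_adjoint_add:
  fixes A B :: "complex mat"
  assumes "A \<in> carrier_mat n m" "B \<in> carrier_mat n m"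
  shows "mat_adjoint (A + B) = mat_adjoint A + mat_adjoint B"
  using assms by (intro eq_matI) auto

lemma unitary_matD:
  assumes "unitary_mat U" "U \<in> carrier_mat n n"
  shows "mat_adjoint U * U = 1\<^sub>m n" "U * mat_adjoint U = 1\<^sub>m n"
  using assms by (auto simp: unitary_mat_def)

lemma unitary_matI:
  assumes "U \<in> carrier_mat n n" "mat_adjoint U * U = 1\<^sub>m n" "U * mat_adjoint U = 1\<^sub>m n"
  shows "unitary_mat U"
  using assms by (auto simp: unitary_mat_def square_mat.simps)

lemma unitary_mat_one [simp]: "unitary_mat (1\<^sub>m n)"
  by (rule unitary_matI [of _ n]) auto

lemma unitary_mat_adjoint:
  assumes "unitary_mat U"
  shows "unitary_mat (mat_adjoint U)"
  using assms by (auto simp: unitary_mat_def square_mat.simps)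

lemma unitary_mat_mult:
  assumes U: "unitary_mat U" "U \<in> carrier_mat n n" and V: "unitary_mat V" "V \<in> carrier_mat n n"
  shows "unitary_mat (U * V)"
proof (rule unitary_matI [of _ n])
  let ?U = "mat_adjoint U" and ?V = "mat_adjoint V"
  have c: "?U \<in> carrier_mat n n" "?V \<in> carrier_mat n n" using assms by auto
  have adj: "mat_adjoint (U * V) = ?V * ?U" using assms by (intro mat_adjoint_mult) auto
  have "mat_adjoint (U * V) * (U * V) = ?V * ((?U * U) * V)"
    using c assms(2,4) by (simp add: adj assoc_mult_mat [of _ n n _ n _ n])
  then show "mat_adjoint (U * V) * (U * V) = 1\<^sub>m n"
    using unitary_matD [OF U] unitary_matD [OF V] assms(2,4) by simp
  have "(U * V) * mat_adjoint (U * V) = U * ((V * ?V) * ?U)"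
    using c assms(2,4) by (simp add: adj assoc_mult_mat [of _ n n _ n _ n])
  then show "(U * V) * mat_adjoint (U * V) = 1\<^sub>m n"
    using unitary_matD [OF U] unitary_matD [OF V] assms(2,4) c by simp
qed (use assms in auto)

lemma unitary_mat_smult:
  assumes U: "unitary_mat U" "U \<in> carrier_mat n n" and c: "cmod c = 1"
  shows "unitary_mat (c \<cdot>\<^sub>m U)"
proof (rule unitary_matI [of _ n])
  have cc: "cnj c * c = 1" "c * cnj c = 1"
    using c complex_norm_square [of c] by (auto simp: mult.commute)
  show "mat_adjoint (c \<cdot>\<^sub>m U) * (c \<cdot>\<^sub>m U) = 1\<^sub>m n"
    using unitary_matD [OF U] U(2) cc
    by (simp add: mat_adjoint_smult mult_smult_distrib [of _ n n] mult_smult_assoc_mat [of _ n n _ n])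
       (auto intro!: eq_matI)
  show "(c \<cdot>\<^sub>m U) * mat_adjoint (c \<cdot>\<^sub>m U) = 1\<^sub>m n"
    using unitary_matD [OF U] U(2) cc
    by (simp add: mat_adjoint_smult mult_smult_distrib [of _ n n] mult_smult_assoc_mat [of _ n n _ n])
       (auto intro!: eq_matI)
qed (use U in auto)

text \<open>The inner product of Uv with itself is written out in coordinates; swapping the sums
  moves \<open>U\<close> to the other argument as its adjoint, where it cancels.\<close>

lemma vec_norm2_unitary_mat:
  assumes U: "unitary_mat U" "U \<in> carrier_mat n n" and v: "v \<in> carrier_vec n"
  shows "vec_norm2 (U *\<^sub>v v) = vec_norm2 v"
proof -
  define w where "w = U *\<^sub>v v"
  have w: "w \<in> carrier_vec n" using U v by (simp add: w_def)
  have "complex_of_real ((vec_norm2 w)\<^sup>2) = (\<Sum>i<n. w $ i * cnj (w $ i))"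
    using w by (simp add: vec_norm2_power2 complex_norm_square del: of_real_power)
  also have "\<dots> = (\<Sum>i<n. (\<Sum>j<n. U $$ (i, j) * v $ j) * cnj (w $ i))"
    using U v by (intro sum.cong) (auto simp: w_def scalar_prod_def lessThan_atLeast0)
  also have "\<dots> = (\<Sum>i<n. \<Sum>j<n. v $ j * cnj (cnj (U $$ (i, j)) * w $ i))"
    by (simp add: sum_distrib_right sum_distrib_left algebra_simps)
  also have "\<dots> = (\<Sum>j<n. v $ j * cnj (\<Sum>i<n. cnj (U $$ (i, j)) * w $ i))"
    by (subst sum.swap) (simp add: sum_distrib_left)
  also have "\<dots> = (\<Sum>j<n. v $ j * cnj ((mat_adjoint U *\<^sub>v w) $ j))"
    using U w by (intro sum.cong) (auto simp: scalar_prod_def lessThan_atLeast0)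
  also have "mat_adjoint U *\<^sub>v w = (mat_adjoint U * U) *\<^sub>v v"
    unfolding w_def using U v by (intro assoc_mult_mat_vec [symmetric, of _ n n _ n]) auto
  also have "\<dots> = v"
    using unitary_matD [OF U] v by simp
  also have "(\<Sum>j<n. v $ j * cnj (v $ j)) = complex_of_real ((vec_norm2 v)\<^sup>2)"
    using v by (simp add: vec_norm2_power2 complex_norm_square del: of_real_power)
  finally show ?thesis
    unfolding w_def of_real_eq_iff by simp
qed

section \<open>The matrix exponential\<close>

lemma mat_mult_index:
  "A \<in> carrier_mat n m \<Longrightarrow> B \<in> carrier_mat m l \<Longrightarrow> i < n \<Longrightarrow> j < l \<Longrightarrow>
    (A * B) $$ (i, j) = (\<Sum>k<m. A $$ (i, k) * B $$ (k, j))"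
  by (simp add: scalar_prod_def lessThan_atLeast0)

text \<open>Derivatives are taken entry by entry and at every real parameter, so that the product
  rule and power series reduce to scalar facts. The carrier conditions are part of the notion
  because products of such functions need matching dimensions.\<close>

definition has_mat_derivative :: "nat \<Rightarrow> (real \<Rightarrow> complex mat) \<Rightarrow> (real \<Rightarrow> complex mat) \<Rightarrow> bool" where
  "has_mat_derivative n F F' \<longleftrightarrow> (\<forall>s. F s \<in> carrier_mat n n \<and> F' s \<in> carrier_mat n n \<and>
     (\<forall>i<n. \<forall>j<n. ((\<lambda>s. F s $$ (i, j)) has_vector_derivative F' s $$ (i, j)) (at s)))"

lemma has_mat_derivativeD:
  assumes "has_mat_derivative n F F'"
  shows "F s \<in> carrier_mat n n" "F' s \<in> carrier_mat n n"
    "i < n \<Longrightarrow> j < n \<Longrightarrow> ((\<lambda>s. F s $$ (i, j)) has_vector_derivative F' s $$ (i, j)) (at s)"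
  using assms by (auto simp: has_mat_derivative_def)

lemma has_mat_derivative_const:
  "A \<in> carrier_mat n n \<Longrightarrow> has_mat_derivative n (\<lambda>_. A) (\<lambda>_. 0\<^sub>m n n)"
  by (simp add: has_mat_derivative_def)

lemma has_mat_derivative_mult:
  assumes "has_mat_derivative n F F'" "has_mat_derivative n G G'"
  shows "has_mat_derivative n (\<lambda>s. F s * G s) (\<lambda>s. F' s * G s + F s * G' s)"
  unfolding has_mat_derivative_def
proof (intro allI conjI impI)
  note F = has_mat_derivativeD [OF assms(1)] and G = has_mat_derivativeD [OF assms(2)]
  fix s
  show "F s * G s \<in> carrier_mat n n" "F' s * G s + F s * G' s \<in> carrier_mat n n"
    using F(1,2) G(1,2) by (auto intro!: add_carrier_mat mult_carrier_mat)
  fix i j assume ij: "i < n" "j < n"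
  have eq: "(\<lambda>s. (F s * G s) $$ (i, j)) = (\<lambda>s. \<Sum>k<n. F s $$ (i, k) * G s $$ (k, j))"
    using F(1) G(1) ij by (intro ext mat_mult_index)
  have eq': "(F' s * G s + F s * G' s) $$ (i, j) =
      (\<Sum>k<n. F s $$ (i, k) * G' s $$ (k, j) + F' s $$ (i, k) * G s $$ (k, j))"
    using F(1,2)[of s] G(1,2)[of s] ij
    by (simp add: mat_mult_index [of _ n n _ n] sum.distrib del: index_mult_mat(1))
  show "((\<lambda>s. (F s * G s) $$ (i, j)) has_vector_derivative (F' s * G s + F s * G' s) $$ (i, j)) (at s)"
    unfolding eq eq' using ij
    by (intro has_vector_derivative_sum has_vector_derivative_mult F(3) G(3)) auto
qed

text \<open>The scalar function \<open>g s = Re \<langle>w, F s v\<rangle>\<close> with \<open>w = (F t - F 0) v\<close> reduces the claim to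
  the mean value theorem for real functions.\<close>

lemma has_mat_derivative_bound:
  assumes F: "has_mat_derivative n F F'" and t: "0 \<le> t"
    and \<phi>: "\<And>s. 0 \<le> s \<Longrightarrow> s \<le> t \<Longrightarrow> (\<phi> has_real_derivative \<phi>' s) (at s)"
    and bd: "\<And>s. 0 \<le> s \<Longrightarrow> s \<le> t \<Longrightarrow> op_bounded (F' s) (\<phi>' s)"
    and le: "\<phi> 0 \<le> \<phi> t"
  shows "op_bounded (F t - F 0) (\<phi> t - \<phi> 0)"
  unfolding op_bounded_def
proof
  note FD = has_mat_derivativeD [OF F]
  fix v :: "complex vec" assume "v \<in> carrier_vec (dim_col (F t - F 0))"
  then have v: "v \<in> carrier_vec n" using FD(1)[of 0] by simp
  define w where "w = (F t - F 0) *\<^sub>v v"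
  have w: "w \<in> carrier_vec n"
    unfolding w_def using FD(1)[of 0] FD(1)[of t] v
    by (intro mult_mat_vec_carrier [of _ n n]) (auto intro: minus_carrier_mat)
  define ip where "ip x = Re (\<Sum>i<n. cnj (w $ i) * x $ i)" for x :: "complex vec"
  have ip_le: "ip x \<le> vec_norm2 w * vec_norm2 x" if "x \<in> carrier_vec n" for x
  proof -
    have "ip x \<le> cmod (\<Sum>i<n. cnj (w $ i) * x $ i)" unfolding ip_def by (rule complex_Re_le_cmod)
    also have "\<dots> \<le> (\<Sum>i<n. \<bar>cmod (w $ i)\<bar> * \<bar>cmod (x $ i)\<bar>)"
      by (rule order_trans [OF norm_sum]) (simp add: norm_mult)
    also have "\<dots> \<le> L2_set (\<lambda>i. cmod (w $ i)) {..<n} * L2_set (\<lambda>i. cmod (x $ i)) {..<n}"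
      by (rule L2_set_mult_ineq)
    finally show ?thesis using w that by (simp add: vec_norm2_L2_set)
  qed
  have ip_mult: "ip (M *\<^sub>v v) = (\<Sum>i<n. \<Sum>j<n. Re (cnj (w $ i) * v $ j * M $$ (i, j)))"
    if "M \<in> carrier_mat n n" for M
  proof -
    have "ip (M *\<^sub>v v) = Re (\<Sum>i<n. \<Sum>j<n. cnj (w $ i) * v $ j * M $$ (i, j))"
      using that v unfolding ip_def
      by (intro arg_cong [where f = Re] sum.cong)
         (auto simp: scalar_prod_def lessThan_atLeast0 sum_distrib_left intro!: sum.cong)
    then show ?thesis by (simp only: Re_sum)
  qed
  have deriv: "((\<lambda>s. ip (F s *\<^sub>v v)) has_real_derivative ip (F' s *\<^sub>v v)) (at s)" for s
    unfolding ip_mult [OF FD(1)] ip_mult [OF FD(2)] has_real_derivative_iff_has_vector_derivative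
    by (intro has_vector_derivative_sum bounded_linear.has_vector_derivative
        [OF bounded_linear_compose [OF bounded_linear_Re bounded_linear_mult_right], unfolded o_def] FD(3)) auto
  \<comment> \<open>\<open>K\<close> scales the majorant so that
    \<open>ip (F s *\<^sub>v v) - K * \<phi> s\<close> has nonpositive derivative. Allowing a
    majorant that is not linear is what later gives an error quadratic in the parameter.\<close>
  define K where "K = vec_norm2 w * vec_norm2 v"
  have "ip (F t *\<^sub>v v) - K * \<phi> t \<le> ip (F 0 *\<^sub>v v) - K * \<phi> 0"
  proof (rule DERIV_nonpos_imp_nonincreasing [OF t])
    fix s assume s: "0 \<le> s" "s \<le> t"
    have "ip (F' s *\<^sub>v v) \<le> vec_norm2 w * vec_norm2 (F' s *\<^sub>v v)"
      using FD(2)[of s] v by (intro ip_le) auto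
    also have "\<dots> \<le> vec_norm2 w * (\<phi>' s * vec_norm2 v)"
      using FD(2)[of s] v by (intro mult_left_mono op_boundedD bd s) auto
    finally have "ip (F' s *\<^sub>v v) - K * \<phi>' s \<le> 0" by (simp add: K_def algebra_simps)
    moreover have "((\<lambda>s. ip (F s *\<^sub>v v) - K * \<phi> s) has_real_derivative ip (F' s *\<^sub>v v) - K * \<phi>' s) (at s)"
      by (intro derivative_intros deriv DERIV_cmult \<phi> s)
    ultimately show "\<exists>y. ((\<lambda>s. ip (F s *\<^sub>v v) - K * \<phi> s) has_real_derivative y) (at s) \<and> y \<le> 0"
      by blast
  qed
  moreover have "(vec_norm2 w)\<^sup>2 = ip (F t *\<^sub>v v) - ip (F 0 *\<^sub>v v)"
  proof -
    have "(vec_norm2 w)\<^sup>2 = ip w"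
      using w by (simp add: vec_norm2_power2 ip_def complex_norm_square [symmetric] mult.commute
          del: of_real_power)
    also have "ip w = ip (F t *\<^sub>v v - F 0 *\<^sub>v v)"
      unfolding w_def minus_mult_distrib_mat_vec [OF FD(1) FD(1) v] ..
    also have "\<dots> = ip (F t *\<^sub>v v) - ip (F 0 *\<^sub>v v)"
      using FD(1)[of 0] FD(1)[of t] v
      by (simp add: ip_def sum_subtractf right_diff_distrib del: Re_sum index_mult_mat_vec)
    finally show ?thesis .
  qed
  ultimately have "vec_norm2 w * vec_norm2 w \<le> vec_norm2 w * ((\<phi> t - \<phi> 0) * vec_norm2 v)"
    by (simp add: K_def power2_eq_square algebra_simps)
  \<comment> \<open>One factor \<open>vec_norm2 w\<close> is cancelled. When it vanishes, the claim
    says that the right-hand side is nonnegative, which is the content of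
    \<open>\<phi> 0 \<le> \<phi> t\<close>.\<close>
  then have "vec_norm2 w \<le> (\<phi> t - \<phi> 0) * vec_norm2 v"
    using le by (cases "vec_norm2 w = 0") (auto simp: mult_le_cancel_left less_le)
  then show "vec_norm2 ((F t - F 0) *\<^sub>v v) \<le> (\<phi> t - \<phi> 0) * vec_norm2 v"
    by (simp add: w_def)
qed

section \<open>The exponential series: convergence, commutation, differentiation\<close>

lemma pow_mat_smult:
  "A \<in> carrier_mat n n \<Longrightarrow> (c \<cdot>\<^sub>m A) ^\<^sub>m k = c ^ k \<cdot>\<^sub>m (A ^\<^sub>m k)" for A :: "complex mat"
proof (induction k)
  case (Suc k)
  then show ?case
    by (simp add: mult_smult_distrib [of _ n n _ n] mult_smult_assoc_mat [of _ n n _ n])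
       (auto intro!: eq_matI)
qed (auto intro!: eq_matI)

lemma pow_mat_Suc_left:
  "A \<in> carrier_mat n n \<Longrightarrow> A ^\<^sub>m Suc k = A * A ^\<^sub>m k" for A :: "complex mat"
  by (induction k) (auto simp: assoc_mult_mat [of _ n n _ n _ n])

lemma pow_mat_commute:
  fixes A X :: "complex mat"
  assumes "A \<in> carrier_mat n n" "X \<in> carrier_mat n n" "X * A = A * X"
  shows "X * A ^\<^sub>m k = A ^\<^sub>m k * X"
proof (induction k)
  case (Suc k)
  have "X * A ^\<^sub>m Suc k = (X * A ^\<^sub>m k) * A"
    using assms by (simp add: assoc_mult_mat [of _ n n _ n _ n])
  also have "\<dots> = A ^\<^sub>m k * (X * A)"
    unfolding Suc using assms by (simp add: assoc_mult_mat [of _ n n _ n _ n])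
  also have "\<dots> = A ^\<^sub>m Suc k * X"
    unfolding assms(3) using assms by (simp add: assoc_mult_mat [of _ n n _ n _ n])
  finally show ?case .
qed (use assms in auto)

text \<open>The constant is the sum of the moduli of all entries. In the induction each entry of the
  last factor is enlarged to its whole row sum, and the row sums add up to \<open>?c\<close>.
  Geometric growth lets the scalar exponential series dominate.\<close>

lemma pow_mat_index_bound:
  fixes A :: "complex mat"
  assumes A: "A \<in> carrier_mat n n"
  obtains c where "c \<ge> 0" "\<And>k i j. i < n \<Longrightarrow> j < n \<Longrightarrow> cmod ((A ^\<^sub>m k) $$ (i, j)) \<le> c ^ k"
proof
  let ?c = "\<Sum>i<n. \<Sum>j<n. cmod (A $$ (i, j))"
  show "?c \<ge> 0" by (intro sum_nonneg) auto
  fix k i j assume "i < n" "j < n"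
  then show "cmod ((A ^\<^sub>m k) $$ (i, j)) \<le> ?c ^ k"
  proof (induction k arbitrary: i j)
    case (Suc k)
    have "(A ^\<^sub>m Suc k) $$ (i, j) = (\<Sum>l<n. (A ^\<^sub>m k) $$ (i, l) * A $$ (l, j))"
      using A Suc.prems by (simp add: mat_mult_index [of _ n n _ n] del: index_mult_mat(1))
    also have "cmod \<dots> \<le> (\<Sum>l<n. cmod ((A ^\<^sub>m k) $$ (i, l)) * cmod (A $$ (l, j)))"
      by (rule order_trans [OF norm_sum]) (simp add: norm_mult)
    also have "\<dots> \<le> (\<Sum>l<n. ?c ^ k * (\<Sum>j<n. cmod (A $$ (l, j))))"
    proof (intro sum_mono mult_mono)
      fix l assume "l \<in> {..<n}"
      then show "cmod ((A ^\<^sub>m k) $$ (i, l)) \<le> ?c ^ k" using Suc by blast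
      show "cmod (A $$ (l, j)) \<le> (\<Sum>j<n. cmod (A $$ (l, j)))"
        using Suc.prems by (intro member_le_sum) auto
    qed (auto intro!: zero_le_power sum_nonneg)
    also have "\<dots> = ?c ^ Suc k" by (simp add: sum_distrib_left [symmetric])
    finally show ?case .
  qed (use A in auto)
qed

lemma mat_exp_summable:
  fixes A :: "complex mat"
  assumes A: "A \<in> carrier_mat n n" and "i < n" "j < n"
  shows "summable (\<lambda>k. (A ^\<^sub>m k) $$ (i, j) / fact k * z ^ k)"
proof -
  obtain c where c: "c \<ge> 0" "\<And>k i j. i < n \<Longrightarrow> j < n \<Longrightarrow> cmod ((A ^\<^sub>m k) $$ (i, j)) \<le> c ^ k"
    using pow_mat_index_bound [OF A] by blast
  show ?thesis
  proof (rule summable_comparison_test')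
    show "summable (\<lambda>k. (c * cmod z) ^ k / fact k)"
      using summable_exp [of "c * cmod z"] by (simp add: field_simps)
    fix k :: nat
    show "norm ((A ^\<^sub>m k) $$ (i, j) / fact k * z ^ k) \<le> (c * cmod z) ^ k / fact k"
      using c(2)[OF assms(2,3), of k]
      by (auto simp: norm_mult norm_divide norm_power power_mult_distrib divide_simps intro: mult_right_mono)
  qed
qed

lemma mat_exp_carrier [simp]: "mat_exp A \<in> carrier_mat n n \<longleftrightarrow> dim_row A = n"
  by (auto simp: mat_exp_def)

lemma mat_exp_dim [simp]: "dim_row (mat_exp A) = dim_row A" "dim_col (mat_exp A) = dim_row A"
  by (auto simp: mat_exp_def)

lemma mat_exp_sums:
  assumes "A \<in> carrier_mat n n" "i < n" "j < n"
  shows "(\<lambda>k. (A ^\<^sub>m k) $$ (i, j) / fact k) sums (mat_exp A $$ (i, j))"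
  using summable_sums [OF mat_exp_summable [OF assms, of 1]] assms by (simp add: mat_exp_def)

text \<open>Exponentials are identified through uniqueness of limits: it suffices that every entry
  series converges to the candidate.\<close>

lemma mat_exp_eqI:
  assumes A: "A \<in> carrier_mat n n" and B: "B \<in> carrier_mat n n"
    and "\<And>i j. i < n \<Longrightarrow> j < n \<Longrightarrow> (\<lambda>k. (A ^\<^sub>m k) $$ (i, j) / fact k) sums (B $$ (i, j))"
  shows "mat_exp A = B"
  using A B by (intro eq_matI) (auto intro: sums_unique2 [OF mat_exp_sums [OF A] assms(3)])

lemma mult_mat_exp_sums:
  assumes A: "A \<in> carrier_mat n n" and X: "X \<in> carrier_mat n n" and "i < n" "j < n"
  shows "(\<lambda>k. (X * A ^\<^sub>m k) $$ (i, j) / fact k) sums ((X * mat_exp A) $$ (i, j))"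
    and "(\<lambda>k. (A ^\<^sub>m k * X) $$ (i, j) / fact k) sums ((mat_exp A * X) $$ (i, j))"
proof -
  have "(\<lambda>k. \<Sum>l<n. X $$ (i, l) * ((A ^\<^sub>m k) $$ (l, j) / fact k)) sums (\<Sum>l<n. X $$ (i, l) * mat_exp A $$ (l, j))"
    using assms by (intro sums_sum sums_mult mat_exp_sums) auto
  then show "(\<lambda>k. (X * A ^\<^sub>m k) $$ (i, j) / fact k) sums ((X * mat_exp A) $$ (i, j))"
    using assms by (simp add: mat_mult_index [of _ n n _ n] sum_divide_distrib del: index_mult_mat(1))
  have "(\<lambda>k. \<Sum>l<n. (A ^\<^sub>m k) $$ (i, l) / fact k * X $$ (l, j)) sums (\<Sum>l<n. mat_exp A $$ (i, l) * X $$ (l, j))"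
    using assms by (intro sums_sum sums_mult2 mat_exp_sums) auto
  then show "(\<lambda>k. (A ^\<^sub>m k * X) $$ (i, j) / fact k) sums ((mat_exp A * X) $$ (i, j))"
    using assms by (simp add: mat_mult_index [of _ n n _ n] sum_divide_distrib del: index_mult_mat(1))
qed

text \<open>Multiplication by \<open>X\<close> acts on the entry series through finite sums, and the
  two resulting series agree term by term because \<open>X\<close> commutes with all powers.\<close>

lemma mat_exp_commute:
  assumes A: "A \<in> carrier_mat n n" and X: "X \<in> carrier_mat n n" and "X * A = A * X"
  shows "X * mat_exp A = mat_exp A * X"
proof (rule eq_matI)
  fix i j assume "i < dim_row (mat_exp A * X)" "j < dim_col (mat_exp A * X)"
  then have "i < n" "j < n" using A X by auto
  from mult_mat_exp_sums [OF A X this]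
  show "(X * mat_exp A) $$ (i, j) = (mat_exp A * X) $$ (i, j)"
    unfolding pow_mat_commute [OF assms] by (rule sums_unique2)
qed (use assms in auto)

lemma mat_exp_smult_one: "mat_exp (c \<cdot>\<^sub>m 1\<^sub>m n) = exp c \<cdot>\<^sub>m 1\<^sub>m n"
proof (rule mat_exp_eqI [of _ n])
  have one: "(1\<^sub>m n :: complex mat) ^\<^sub>m k = 1\<^sub>m n" for k by (induction k) auto
  fix i j assume "i < n" "j < n"
  then show "(\<lambda>k. ((c \<cdot>\<^sub>m 1\<^sub>m n) ^\<^sub>m k) $$ (i, j) / fact k) sums ((exp c \<cdot>\<^sub>m 1\<^sub>m n) $$ (i, j))"
    using exp_converges [of c] by (simp add: pow_mat_smult [of _ n] one scaleR_conv_of_real field_simps)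
qed auto

lemma mat_exp_zero [simp]: "mat_exp (0\<^sub>m n n) = 1\<^sub>m n"
proof -
  have "0\<^sub>m n n = 0 \<cdot>\<^sub>m (1\<^sub>m n :: complex mat)" by (intro eq_matI) auto
  moreover have "(exp 0 :: complex) \<cdot>\<^sub>m 1\<^sub>m n = 1\<^sub>m n" by (intro eq_matI) auto
  ultimately show ?thesis by (simp only: mat_exp_smult_one)
qed

lemma pow_mat_adjoint:
  "A \<in> carrier_mat n n \<Longrightarrow> mat_adjoint A ^\<^sub>m k = mat_adjoint (A ^\<^sub>m k)" for A :: "complex mat"
proof (induction k)
  case (Suc k)
  have "mat_adjoint A ^\<^sub>m Suc k = mat_adjoint A * mat_adjoint A ^\<^sub>m k"
    using Suc.prems by (intro pow_mat_Suc_left [of _ n]) auto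
  then show ?case using Suc by (simp add: mat_adjoint_mult)
qed auto

lemma mat_adjoint_exp:
  assumes A: "A \<in> carrier_mat n n"
  shows "mat_adjoint (mat_exp A) = mat_exp (mat_adjoint A)"
proof (rule mat_exp_eqI [of _ n, symmetric])
  fix i j assume ij: "i < n" "j < n"
  have "(\<lambda>k. cnj ((A ^\<^sub>m k) $$ (j, i) / fact k)) sums cnj (mat_exp A $$ (j, i))"
    unfolding sums_cnj using A ij by (intro mat_exp_sums)
  then show "(\<lambda>k. (mat_adjoint A ^\<^sub>m k) $$ (i, j) / fact k) sums (mat_adjoint (mat_exp A) $$ (i, j))"
    using A ij by (simp add: pow_mat_adjoint [of _ n])
qed (use A in auto)

text \<open>Each entry of the exponential of \<open>z \<cdot>\<^sub>m A\<close> is an everywhere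
  convergent complex power series in \<open>z\<close>. Differentiating it termwise shifts the
  coefficients, which amounts to multiplication by \<open>A\<close>; the complex derivative is then
  restricted to real parameters.\<close>

lemma has_mat_derivative_exp:
  assumes A: "A \<in> carrier_mat n n"
  shows "has_mat_derivative n (\<lambda>s. mat_exp (of_real s \<cdot>\<^sub>m A)) (\<lambda>s. A * mat_exp (of_real s \<cdot>\<^sub>m A))"
  unfolding has_mat_derivative_def
proof (intro allI conjI impI)
  fix s i j assume ij: "i < n" "j < n"
  define c where "c k = (A ^\<^sub>m k) $$ (i, j) / fact k" for k
  have sums: "(\<lambda>k. c k * z ^ k) sums (mat_exp (z \<cdot>\<^sub>m A) $$ (i, j))" for z
    using mat_exp_sums [of "z \<cdot>\<^sub>m A" n i j] A ij by (simp add: pow_mat_smult [of _ n] c_def field_simps)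
  have "((\<lambda>z. \<Sum>k. c k * z ^ k) has_field_derivative (\<Sum>k. diffs c k * z ^ k)) (at z)" for z
    by (rule termdiffs_strong_converges_everywhere) (use sums in \<open>auto simp: sums_iff\<close>)
  moreover have "(\<Sum>k. diffs c k * z ^ k) = (A * mat_exp (z \<cdot>\<^sub>m A)) $$ (i, j)" for z
  proof -
    have "diffs c k * z ^ k = (A * (z \<cdot>\<^sub>m A) ^\<^sub>m k) $$ (i, j) / fact k" for k
    proof -
      have "diffs c k * z ^ k = of_nat (Suc k) * ((A ^\<^sub>m Suc k) $$ (i, j) / fact (Suc k)) * z ^ k"
        by (simp only: diffs_def c_def)
      also have "\<dots> = (A ^\<^sub>m Suc k) $$ (i, j) * z ^ k / fact k"
        by (simp only: fact_Suc of_nat_mult) (simp del: of_nat_Suc pow_mat.simps)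
      also have "\<dots> = (A * (z \<cdot>\<^sub>m A) ^\<^sub>m k) $$ (i, j) / fact k"
        unfolding pow_mat_Suc_left [OF A] using A ij
        by (simp add: pow_mat_smult [of _ n] mult_smult_distrib [of _ n n _ n] del: index_mult_mat(1))
      finally show ?thesis .
    qed
    then show ?thesis
      using mult_mat_exp_sums(1)[of "z \<cdot>\<^sub>m A" n A, OF _ A ij] A by (simp add: sums_iff)
  qed
  moreover have "(\<lambda>z. \<Sum>k. c k * z ^ k) = (\<lambda>z. mat_exp (z \<cdot>\<^sub>m A) $$ (i, j))"
    using sums by (simp add: sums_iff)
  ultimately have "((\<lambda>z. mat_exp (z \<cdot>\<^sub>m A) $$ (i, j)) has_field_derivative
      (A * mat_exp (z \<cdot>\<^sub>m A)) $$ (i, j)) (at z)" for z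
    by simp
  then show "((\<lambda>s. mat_exp (of_real s \<cdot>\<^sub>m A) $$ (i, j)) has_vector_derivative
      (A * mat_exp (of_real s \<cdot>\<^sub>m A)) $$ (i, j)) (at s)"
    by (rule has_vector_derivative_real_field)
qed (use A in auto)

section \<open>First-order Trotter error\<close>

lemma smult_one_mat [simp]: "1 \<cdot>\<^sub>m A = (A :: complex mat)"
  by (intro eq_matI) auto

lemma diff_eq_zero_mat:
  fixes A B :: "complex mat"
  assumes "A \<in> carrier_mat n m" "B \<in> carrier_mat n m" "A - B = 0\<^sub>m n m"
  shows "A = B"
proof (rule eq_matI)
  fix i j assume ij: "i < dim_row B" "j < dim_col B"
  have "(A - B) $$ (i, j) = 0" unfolding assms(3) using ij assms by simp
  then show "A $$ (i, j) = B $$ (i, j)" using ij by simp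
qed (use assms in auto)

lemma of_real_smult_uminus: "of_real s \<cdot>\<^sub>m (- A) = - (of_real s \<cdot>\<^sub>m A)" for A :: "complex mat"
  by (intro eq_matI) auto

text \<open>The product of exp(-sA) and exp(sA) has derivative zero, since \<open>A\<close> commutes
  with exp(-sA). The mean value inequality with the zero majorant then forces it to keep its value
  at s = 0.\<close>

lemma mat_exp_uminus_mult:
  assumes A: "A \<in> carrier_mat n n"
  shows "mat_exp (- A) * mat_exp A = 1\<^sub>m n"
proof -
  let ?E = "\<lambda>A s. mat_exp (of_real s \<cdot>\<^sub>m A)"
  define F where "F s = ?E (- A) s * ?E A s" for s
  have mA: "- A \<in> carrier_mat n n" using A by simp
  have deriv: "has_mat_derivative n F (\<lambda>s. (- A * ?E (- A) s) * ?E A s + ?E (- A) s * (A * ?E A s))"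
    unfolding F_def by (intro has_mat_derivative_mult has_mat_derivative_exp A mA)
  have zero: "(- A * ?E (- A) s) * ?E A s + ?E (- A) s * (A * ?E A s) = 0\<^sub>m n n" for s
  proof -
    have comm: "A * ?E (- A) s = ?E (- A) s * A"
      using A by (intro mat_exp_commute [of _ n])
        (auto simp: of_real_smult_uminus mult_smult_distrib [of _ n n] mult_smult_assoc_mat [of _ n n])
    have "(- A * ?E (- A) s) * ?E A s = - ((A * ?E (- A) s) * ?E A s)"
      using A by simp
    also have "\<dots> = - (?E (- A) s * (A * ?E A s))"
      unfolding comm using A by (subst assoc_mult_mat [of _ n n _ n _ n]) auto
    finally have eq: "(- A * ?E (- A) s) * ?E A s = - (?E (- A) s * (A * ?E A s))" .
    show ?thesis
      unfolding eq using A by (intro uminus_l_inv_mat mult_carrier_mat [where n = n]) auto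
  qed
  have "op_bounded (F 1 - F 0) (0 - 0)"
    by (rule has_mat_derivative_bound [OF deriv, where \<phi>' = "\<lambda>_. 0" and \<phi> = "\<lambda>_. 0"]) (auto simp: zero)
  then have "F 1 - F 0 = 0\<^sub>m n n"
    using op_bounded_0_imp_zero [of "F 1 - F 0" n n] has_mat_derivativeD(1) [OF deriv]
    by (auto intro: minus_carrier_mat)
  moreover have "F 0 = 1\<^sub>m n"
  proof -
    have "of_real 0 \<cdot>\<^sub>m B = 0\<^sub>m n n" if "B \<in> carrier_mat n n" for B :: "complex mat"
      using that by (intro eq_matI) auto
    then show ?thesis using A by (simp add: F_def)
  qed
  moreover have "F 1 = mat_exp (- A) * mat_exp A"
    by (simp add: F_def)
  ultimately show ?thesis
    using diff_eq_zero_mat [OF has_mat_derivativeD(1) [OF deriv, of 1] has_mat_derivativeD(1) [OF deriv, of 0]]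
    by simp
qed

lemma smult_zero_scalar_mat: "A \<in> carrier_mat n m \<Longrightarrow> 0 \<cdot>\<^sub>m A = 0\<^sub>m n m" for A :: "complex mat"
  by (intro eq_matI) auto

lemma smult_smult_mat: "a \<cdot>\<^sub>m (b \<cdot>\<^sub>m A) = (a * b) \<cdot>\<^sub>m A" for A :: "complex mat"
  by (intro eq_matI) auto

text \<open>Skew-adjoint matrices generate unitary one-parameter groups. They are closed under sums,
  negatives and real multiples, so the splitting argument can run without carrying the factor i of a
  Hamiltonian.\<close>

definition skew_mat :: "complex mat \<Rightarrow> bool" where
  "skew_mat A \<longleftrightarrow> mat_adjoint A = - A"

lemma skew_mat_uminus: "skew_mat A \<Longrightarrow> skew_mat (- A)"
proof -
  have "mat_adjoint (- A) = - mat_adjoint A" by (intro eq_matI) auto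
  then show "skew_mat A \<Longrightarrow> skew_mat (- A)" by (simp add: skew_mat_def)
qed

lemma skew_mat_of_real: "skew_mat A \<Longrightarrow> skew_mat (of_real s \<cdot>\<^sub>m A)"
  by (simp add: skew_mat_def mat_adjoint_smult of_real_smult_uminus)

lemma skew_mat_add:
  assumes "A \<in> carrier_mat n n" "B \<in> carrier_mat n n" "skew_mat A" "skew_mat B"
  shows "skew_mat (A + B)"
proof -
  have "mat_adjoint (A + B) = - A + - B"
    using assms by (simp add: skew_mat_def mat_adjoint_add [of _ n n])
  also have "\<dots> = - (A + B)"
    using assms by (intro eq_matI) auto
  finally show ?thesis by (simp add: skew_mat_def)
qed

lemma skew_mat_i_hermitian:
  assumes "mat_adjoint H = H"
  shows "skew_mat ((\<i> * of_real t) \<cdot>\<^sub>m H)"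
  unfolding skew_mat_def mat_adjoint_smult assms by (intro eq_matI) auto

lemma unitary_mat_exp:
  assumes "A \<in> carrier_mat n n" "skew_mat A"
  shows "unitary_mat (mat_exp A)"
proof (rule unitary_matI [of _ n])
  have adj: "mat_adjoint (mat_exp A) = mat_exp (- A)"
    using assms by (simp add: mat_adjoint_exp skew_mat_def)
  show "mat_adjoint (mat_exp A) * mat_exp A = 1\<^sub>m n"
    unfolding adj by (rule mat_exp_uminus_mult [OF assms(1)])
  show "mat_exp A * mat_adjoint (mat_exp A) = 1\<^sub>m n"
    unfolding adj using mat_exp_uminus_mult [of "- A" n] assms by simp
qed (use assms in auto)

text \<open>The right factor preserves the norm of the input and the left one that of the output.
  The two are unrelated, so that multiplication from one side is covered by taking the identity as
  the other factor.\<close>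

lemma op_bounded_unitary_conj:
  assumes U: "unitary_mat U" "U \<in> carrier_mat n n" and V: "unitary_mat V" "V \<in> carrier_mat n n"
    and X: "X \<in> carrier_mat n n" "op_bounded X c"
  shows "op_bounded (U * X * V) c"
  unfolding op_bounded_def
proof
  fix v :: "complex vec" assume "v \<in> carrier_vec (dim_col (U * X * V))"
  then have v: "v \<in> carrier_vec n" "V *\<^sub>v v \<in> carrier_vec n"
    using V by auto
  have "vec_norm2 ((U * X * V) *\<^sub>v v) = vec_norm2 (U *\<^sub>v (X *\<^sub>v (V *\<^sub>v v)))"
    using U V X v by (simp add: assoc_mult_mat_vec [of _ n n _ n] mult_carrier_mat [where n = n])
  also have "\<dots> = vec_norm2 (X *\<^sub>v (V *\<^sub>v v))"
    using X v by (intro vec_norm2_unitary_mat [OF U]) auto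
  also have "\<dots> \<le> c * vec_norm2 (V *\<^sub>v v)"
    using X v by (intro op_boundedD) auto
  finally show "vec_norm2 ((U * X * V) *\<^sub>v v) \<le> c * vec_norm2 v"
    by (simp add: vec_norm2_unitary_mat [OF V v(1)])
qed

text \<open>First-order Trotter error. With \<open>f s = exp (- s (A + B)) exp (s A) exp (s B)\<close>, the derivative
  of \<open>f\<close> is a unitary conjugate of \<open>B - exp (- s A) B exp (s A)\<close>, which in turn is
  the integral of unitary conjugates of the commutator.\<close>

lemma trotter_bound:
  assumes A: "A \<in> carrier_mat n n" "skew_mat A" and B: "B \<in> carrier_mat n n" "skew_mat B"
    and C: "op_bounded (A * B - B * A) C" "0 \<le> C"
  shows "op_bounded (mat_exp (A + B) - mat_exp A * mat_exp B) (C / 2)"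
proof -
  let ?E = "\<lambda>A s. mat_exp (of_real s \<cdot>\<^sub>m A)"
  note sq = add_carrier_mat mult_carrier_mat [where n = n] minus_carrier_mat
  note R = assoc_mult_mat [of _ n n _ n _ n]
    add_mult_distrib_mat [of _ n n _ _ n] mult_add_distrib_mat [of _ n n _ n]
    minus_mult_distrib_mat [of _ n n _ _ n] mult_minus_distrib_mat [of _ n n _ n]
  have cE: "?E X s \<in> carrier_mat n n" if "X \<in> carrier_mat n n" for X s
    using that by simp
  have uE: "unitary_mat (?E X s)" if "X \<in> carrier_mat n n" "skew_mat X" for X s
    using that by (intro unitary_mat_exp [of _ n] skew_mat_of_real) auto
  have comm: "X * ?E X s = ?E X s * X" if "X \<in> carrier_mat n n" for X s
    using that by (intro mat_exp_commute [of _ n])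
      (auto simp: mult_smult_distrib [of _ n n] mult_smult_assoc_mat [of _ n n])
  have inv: "?E X s * ?E (- X) s = 1\<^sub>m n" if "X \<in> carrier_mat n n" for X s
    using mat_exp_uminus_mult [of "- (of_real s \<cdot>\<^sub>m X)" n] that by (simp add: of_real_smult_uminus)
  have E0: "?E X 0 = 1\<^sub>m n" if "X \<in> carrier_mat n n" for X
    using that by (simp add: smult_zero_scalar_mat)
  have mA: "- A \<in> carrier_mat n n" "skew_mat (- A)" using A skew_mat_uminus by auto
  have AB: "A + B \<in> carrier_mat n n" "skew_mat (A + B)" using A B skew_mat_add by auto
  then have mAB: "- (A + B) \<in> carrier_mat n n" "skew_mat (- (A + B))" using skew_mat_uminus by auto
  have K: "A * B - B * A \<in> carrier_mat n n" using A B by (intro sq) auto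

  have conj_bound: "op_bounded (?E (- A) s * B * ?E A s - B) (C * s)" if "0 \<le> s" for s
  proof -
    define F where "F s = ?E (- A) s * B * ?E A s" for s
    define F' where "F' s = ?E (- A) s * (- (A * B - B * A)) * ?E A s" for s
    have "has_mat_derivative n F (\<lambda>s. ((- A * ?E (- A) s) * B + ?E (- A) s * 0\<^sub>m n n) * ?E A s
        + (?E (- A) s * B) * (A * ?E A s))"
      unfolding F_def
      by (intro has_mat_derivative_mult has_mat_derivative_exp has_mat_derivative_const A mA B)
    \<comment> \<open>The product rule puts -A and A on the two sides of \<open>B\<close>. As
      \<open>A\<close> commutes with exp(-sA), both move next to \<open>B\<close> and form the
      negative commutator. The zero matrix is the derivative of the constant factor
      \<open>B\<close>.\<close>
    moreover have "((- A * ?E (- A) s) * B + ?E (- A) s * 0\<^sub>m n n) * ?E A s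
        + (?E (- A) s * B) * (A * ?E A s) = F' s" for s
    proof -
      let ?P = "?E (- A) s" and ?Q = "?E A s"
      have c: "?P \<in> carrier_mat n n" "?Q \<in> carrier_mat n n" using cE A mA by auto
      have "((- A * ?P) * B + ?P * 0\<^sub>m n n) * ?Q + (?P * B) * (A * ?Q)
          = (?P * (- A) * B) * ?Q + (?P * B) * (A * ?Q)"
        unfolding comm [OF mA(1)] using A B c by (simp add: sq)
      also have "\<dots> = - (?P * (A * (B * ?Q))) + ?P * (B * (A * ?Q))"
        using A B c by (simp add: R sq)
      also have "\<dots> = - (?P * (A * (B * ?Q)) - ?P * (B * (A * ?Q)))"
        by (intro eq_matI) (use A B c in \<open>auto simp del: index_mult_mat(1)\<close>)
      also have "?P * (A * (B * ?Q)) - ?P * (B * (A * ?Q)) = ?P * ((A * B - B * A) * ?Q)"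
        using A B c by (simp add: R sq)
      also have "- \<dots> = F' s"
        using A B c K by (simp add: F'_def R sq)
      finally show ?thesis .
    qed
    ultimately have deriv: "has_mat_derivative n F F'" by simp
    have "op_bounded (F s - F 0) (C * s - C * 0)"
    proof (rule has_mat_derivative_bound [OF deriv \<open>0 \<le> s\<close>, where \<phi>' = "\<lambda>_. C"])
      show "((\<lambda>a. C * a) has_real_derivative C) (at x)" for x
        by (auto intro!: derivative_eq_intros)
      show "op_bounded (F' x) C" for x
        unfolding F'_def using A mA K C(1)
        by (intro op_bounded_unitary_conj [of _ n] uE cE op_bounded_uminus) auto
    qed (use C \<open>0 \<le> s\<close> in auto)
    moreover have "F 0 = B"
      unfolding F_def E0 [OF A(1)] E0 [OF mA(1)] using B by simp
    ultimately show ?thesis by (simp add: F_def)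
  qed

  define f where "f s = ?E (- (A + B)) s * (?E A s * ?E B s)" for s
  define f' where "f' s = (?E (- (A + B)) s * ?E A s) * (B - ?E (- A) s * B * ?E A s) * ?E B s" for s
  have "has_mat_derivative n f (\<lambda>s. (- (A + B) * ?E (- (A + B)) s) * (?E A s * ?E B s)
      + ?E (- (A + B)) s * ((A * ?E A s) * ?E B s + ?E A s * (B * ?E B s)))"
    unfolding f_def by (intro has_mat_derivative_mult has_mat_derivative_exp A B mAB)
  moreover have "(- (A + B) * ?E (- (A + B)) s) * (?E A s * ?E B s)
      + ?E (- (A + B)) s * ((A * ?E A s) * ?E B s + ?E A s * (B * ?E B s)) = f' s" for s
  proof -
    let ?M = "?E (- (A + B)) s" and ?P = "?E (- A) s" and ?Q = "?E A s" and ?S = "?E B s"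
    have c: "?P \<in> carrier_mat n n" "?Q \<in> carrier_mat n n" "?M \<in> carrier_mat n n" "?S \<in> carrier_mat n n"
      using cE A mA B mAB by auto
    have "f' s = ?M * (?Q * (B * ?S)) - ?M * ((?Q * ?P) * (B * (?Q * ?S)))"
      unfolding f'_def using A B c by (simp add: R sq)
    \<comment> \<open>Cancelling exp(sA) against exp(-sA) leaves \<open>B\<close> directly behind
      exp(-s(A + B)), where the product rule produces it as well.\<close>
    also have "?Q * ?P = 1\<^sub>m n" by (rule inv [OF A(1)])
    finally have f': "f' s = ?M * (?Q * (B * ?S)) - ?M * (B * (?Q * ?S))"
      using B c by (simp add: R sq)
    have "(- (A + B) * ?M) * (?Q * ?S) + ?M * ((A * ?Q) * ?S + ?Q * (B * ?S))
        = (?M * (- (A + B))) * (?Q * ?S) + ?M * ((A * ?Q) * ?S + ?Q * (B * ?S))"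
      unfolding comm [OF mAB(1)] ..
    also have "\<dots> = - (?M * (A * (?Q * ?S)) + ?M * (B * (?Q * ?S)))
        + (?M * (A * (?Q * ?S)) + ?M * (?Q * (B * ?S)))"
      using A B c by (simp add: R sq)
    also have "\<dots> = f' s"
      unfolding f' by (intro eq_matI) (use A B c in \<open>auto simp del: index_mult_mat(1)\<close>)
    finally show ?thesis .
  qed
  ultimately have deriv: "has_mat_derivative n f f'" by simp
  \<comment> \<open>\<open>conj_bound\<close> grows linearly in \<open>s\<close>, so the majorant is
    C s^2 / 2: the origin of the factor 1/2.\<close>
  have "op_bounded (f 1 - f 0) (C * 1\<^sup>2 / 2 - C * 0\<^sup>2 / 2)"
  proof (rule has_mat_derivative_bound [OF deriv, where \<phi>' = "\<lambda>s. C * s"])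
    show "((\<lambda>a. C * a\<^sup>2 / 2) has_real_derivative C * x) (at x)" for x
      by (auto intro!: derivative_eq_intros)
    show "op_bounded (f' s) (C * s)" if "0 \<le> s" for s
    proof -
      have "op_bounded (B - ?E (- A) s * B * ?E A s) (C * s)"
        using A B mA cE by (intro op_bounded_diff_commute [OF _ _ conj_bound [OF that], of n n] sq) auto
      then show ?thesis
        unfolding f'_def using A mA B mAB cE uE
        by (intro op_bounded_unitary_conj [of _ n] unitary_mat_mult [of _ n] sq) auto
    qed
  qed (use C in auto)
  moreover have "f 0 = 1\<^sub>m n"
    unfolding f_def E0 [OF A(1)] E0 [OF B(1)] E0 [OF mAB(1)] by simp
  ultimately have f1: "op_bounded (f 1 - 1\<^sub>m n) (C / 2)" by simp
  have c: "mat_exp (A + B) \<in> carrier_mat n n" "mat_exp (- (A + B)) \<in> carrier_mat n n"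
    "mat_exp A \<in> carrier_mat n n" "mat_exp B \<in> carrier_mat n n"
    using A B by auto
  \<comment> \<open>Multiplying by the unitary exp(A + B) undoes the first factor of
    \<open>f\<close> and leaves the bound unchanged. The trailing identity in \<open>eq\<close>
    below serves as right factor in \<open>op_bounded_unitary_conj\<close>.\<close>
  have "mat_exp (A + B) * (f 1 - 1\<^sub>m n)
      = (mat_exp (A + B) * mat_exp (- (A + B))) * (mat_exp A * mat_exp B) - mat_exp (A + B)"
    unfolding f_def using c by (simp add: R sq)
  also have "\<dots> = mat_exp A * mat_exp B - mat_exp (A + B)"
    using inv [OF AB(1), of 1] c by simp
  finally have eq: "mat_exp (A + B) * (f 1 - 1\<^sub>m n) * 1\<^sub>m n = mat_exp A * mat_exp B - mat_exp (A + B)"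
    using c by (simp add: minus_carrier_mat)
  have "op_bounded (mat_exp A * mat_exp B - mat_exp (A + B)) (C / 2)"
    unfolding eq [symmetric] using c f1 has_mat_derivativeD(1) [OF deriv, of 1]
    by (intro op_bounded_unitary_conj [of _ n] unitary_mat_exp [OF AB] sq) auto
  from op_bounded_diff_commute [OF _ _ this, of n n] show ?thesis
    using c by (simp add: sq)
qed

text \<open>A vanishing commutator makes the Trotter error zero. The law comes from that estimate
  and not from multiplying two series, hence its form for skew-adjoint matrices.\<close>

lemma mat_exp_add_commuting:
  assumes A: "A \<in> carrier_mat n n" "skew_mat A" and B: "B \<in> carrier_mat n n" "skew_mat B"
    and "A * B = B * A"
  shows "mat_exp (A + B) = mat_exp A * mat_exp B"
proof -
  have "A * B - B * A = 0\<^sub>m n n"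
    unfolding assms(5) using A B by (intro minus_r_inv_mat mult_carrier_mat [where n = n]) auto
  then have "op_bounded (A * B - B * A) 0"
    by (simp only: op_bounded_zero)
  from trotter_bound [OF A B this] have "op_bounded (mat_exp (A + B) - mat_exp A * mat_exp B) 0"
    by simp
  then have "mat_exp (A + B) - mat_exp A * mat_exp B = 0\<^sub>m n n"
    using A B by (intro op_bounded_0_imp_zero) (auto intro: minus_carrier_mat mult_carrier_mat [where n = n])
  then show ?thesis
    using A B by (rule_tac diff_eq_zero_mat [of _ n n]) (auto intro: mult_carrier_mat [where n = n])
qed

section \<open>Sums, products and powers of unitary matrices\<close>

lemma op_bounded_diff_self:
  assumes "A \<in> carrier_mat n m"
  shows "op_bounded (A - A) 0"
proof -
  have "A - A = 0\<^sub>m n m" using assms by (intro eq_matI) auto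
  then show ?thesis by (simp only: op_bounded_zero)
qed

lemma mat_sum_carrier [simp]: "mat_sum n f S \<in> carrier_mat n n"
  by (simp add: mat_sum_def)

lemma mat_sum_dim [simp]: "dim_row (mat_sum n f S) = n" "dim_col (mat_sum n f S) = n"
  by (simp_all add: mat_sum_def)

lemma mat_sum_index [simp]: "i < n \<Longrightarrow> j < n \<Longrightarrow> mat_sum n f S $$ (i, j) = (\<Sum>k\<in>S. f k $$ (i, j))"
  by (simp add: mat_sum_def)

lemma mat_sum_empty [simp]: "mat_sum n f {} = 0\<^sub>m n n"
  by (intro eq_matI) auto

lemma mat_sum_insert:
  assumes "finite S" "k \<notin> S" "f k \<in> carrier_mat n n"
  shows "mat_sum n f (insert k S) = f k + mat_sum n f S"
  using assms by (intro eq_matI) auto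

lemma mat_sum_cong: "(\<And>k. k \<in> S \<Longrightarrow> f k = g k) \<Longrightarrow> mat_sum n f S = mat_sum n g S"
  by (auto simp: mat_sum_def intro!: cong_mat sum.cong)

lemma mat_sum_commute:
  assumes "finite S" "X \<in> carrier_mat n n"
    and "\<And>k. k \<in> S \<Longrightarrow> f k \<in> carrier_mat n n" "\<And>k. k \<in> S \<Longrightarrow> X * f k = f k * X"
  shows "X * mat_sum n f S = mat_sum n f S * X"
  using assms
proof (induction S)
  case (insert k S)
  then show ?case
    by (simp add: mat_sum_insert mult_add_distrib_mat [of _ n n _ n] add_mult_distrib_mat [of _ n n _ _ n])
qed (simp add: left_mult_zero_mat right_mult_zero_mat)

lemma skew_mat_sum:
  assumes "\<And>k. k \<in> S \<Longrightarrow> f k \<in> carrier_mat n n" "\<And>k. k \<in> S \<Longrightarrow> skew_mat (f k)"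
  shows "skew_mat (mat_sum n f S)"
  unfolding skew_mat_def
proof (rule eq_matI)
  fix i j assume "i < dim_row (- mat_sum n f S)" "j < dim_col (- mat_sum n f S)"
  then have ij: "i < n" "j < n" by auto
  have "cnj (f k $$ (j, i)) = - f k $$ (i, j)" if "k \<in> S" for k
    using arg_cong [OF assms(2) [OF that, unfolded skew_mat_def], of "\<lambda>M. M $$ (i, j)"] assms(1) [OF that] ij
    by simp
  then show "mat_adjoint (mat_sum n f S) $$ (i, j) = (- mat_sum n f S) $$ (i, j)"
    using ij by (simp add: sum_negf)
qed auto

lemma mat_prod_Nil [simp]: "mat_prod n f [] = 1\<^sub>m n"
  by (simp add: mat_prod_def)

lemma mat_prod_Cons [simp]: "mat_prod n f (k # ks) = f k * mat_prod n f ks"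
  by (simp add: mat_prod_def)

lemma mat_prod_carrier:
  "(\<And>k. k \<in> set ks \<Longrightarrow> f k \<in> carrier_mat n n) \<Longrightarrow> mat_prod n f ks \<in> carrier_mat n n"
  by (induction ks) (auto intro: mult_carrier_mat [where n = n])

lemma mat_prod_cong:
  "(\<And>k. k \<in> set ks \<Longrightarrow> f k = g k) \<Longrightarrow> mat_prod n f ks = mat_prod n g ks"
  by (induction ks) auto

lemma unitary_mat_prod:
  "(\<And>k. k \<in> set ks \<Longrightarrow> f k \<in> carrier_mat n n) \<Longrightarrow> (\<And>k. k \<in> set ks \<Longrightarrow> unitary_mat (f k)) \<Longrightarrow>
    unitary_mat (mat_prod n f ks)"
  by (induction ks) (auto intro!: unitary_mat_mult [of _ n] mat_prod_carrier)

text \<open>Split U V - U' V' into U (V - V') and (U - U') V'. The outer factors are unitary and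
  leave norms unchanged, so the two errors add without amplification.\<close>

lemma op_bounded_mult_diff:
  assumes U: "unitary_mat U" "U \<in> carrier_mat n n" and V: "V \<in> carrier_mat n n"
    and U': "U' \<in> carrier_mat n n" and V': "unitary_mat V'" "V' \<in> carrier_mat n n"
    and "op_bounded (U - U') e" "op_bounded (V - V') e'"
  shows "op_bounded (U * V - U' * V') (e + e')"
proof -
  note sq = add_carrier_mat mult_carrier_mat [where n = n] minus_carrier_mat
  have 1: "U * V - U * V' = U * (V - V') * 1\<^sub>m n"
    using U V V' by (simp add: mult_minus_distrib_mat [of _ n n _ n] sq)
  have 2: "U * V' - U' * V' = 1\<^sub>m n * (U - U') * V'"
    using U U' V' by (simp add: minus_mult_distrib_mat [of _ n n _ _ n] sq)
  have "op_bounded (U * V - U * V') e'"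
    unfolding 1 using assms by (intro op_bounded_unitary_conj [of _ n] sq) auto
  moreover have "op_bounded (U * V' - U' * V') e"
    unfolding 2 using assms by (intro op_bounded_unitary_conj [of _ n] sq) auto
  ultimately show ?thesis
    using op_bounded_diff_trans [of "U * V" n n "U * V'" "U' * V'" e' e] assms
    by (simp add: sq add.commute)
qed

lemma mat_prod_diff_bound:
  assumes "\<And>k. k \<in> set ks \<Longrightarrow> f k \<in> carrier_mat n n" "\<And>k. k \<in> set ks \<Longrightarrow> g k \<in> carrier_mat n n"
    "\<And>k. k \<in> set ks \<Longrightarrow> unitary_mat (f k)" "\<And>k. k \<in> set ks \<Longrightarrow> unitary_mat (g k)"
    "\<And>k. k \<in> set ks \<Longrightarrow> op_bounded (f k - g k) (e k)"
  shows "op_bounded (mat_prod n f ks - mat_prod n g ks) (\<Sum>k\<leftarrow>ks. e k)"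
  using assms
proof (induction ks)
  case (Cons k ks)
  then show ?case
    by (auto intro!: op_bounded_mult_diff [of _ n] mat_prod_carrier unitary_mat_prod)
next
  case Nil
  show ?case using op_bounded_diff_self [of "1\<^sub>m n" n n] by simp
qed

lemma mat_exp_mat_sum:
  assumes "distinct ks" "\<And>k. k \<in> set ks \<Longrightarrow> f k \<in> carrier_mat n n" "\<And>k. k \<in> set ks \<Longrightarrow> skew_mat (f k)"
    and "\<And>k l. k \<in> set ks \<Longrightarrow> l \<in> set ks \<Longrightarrow> k \<noteq> l \<Longrightarrow> f k * f l = f l * f k"
  shows "mat_exp (mat_sum n f (set ks)) = mat_prod n (\<lambda>k. mat_exp (f k)) ks"
  using assms
proof (induction ks)
  case (Cons k ks)
  have "mat_exp (f k + mat_sum n f (set ks)) = mat_exp (f k) * mat_exp (mat_sum n f (set ks))"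
    using Cons.prems
    by (intro mat_exp_add_commuting [of _ n] skew_mat_sum mat_sum_commute) auto
  then show ?case using Cons by (simp add: mat_sum_insert)
qed simp

section \<open>Integer powers of unitary matrices\<close>

lemma unitary_mat_pow: "unitary_mat U \<Longrightarrow> U \<in> carrier_mat n n \<Longrightarrow> unitary_mat (U ^\<^sub>m k)"
  by (induction k) (auto intro!: unitary_mat_mult [of _ n])

lemma pow_mat_diff_bound:
  assumes U: "unitary_mat U" "U \<in> carrier_mat n n" and V: "unitary_mat V" "V \<in> carrier_mat n n"
    and e: "op_bounded (U - V) e"
  shows "op_bounded (U ^\<^sub>m k - V ^\<^sub>m k) (real k * e)"
proof (induction k)
  case (Suc k)
  have "op_bounded (U ^\<^sub>m Suc k - V ^\<^sub>m Suc k) (real k * e + e)"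
    using assms Suc by (auto intro!: op_bounded_mult_diff [of _ n] unitary_mat_pow)
  then show ?case by (simp add: algebra_simps)
next
  case 0
  show ?case using U V op_bounded_diff_self [of "1\<^sub>m n" n n] by simp
qed

text \<open>The inverse behind negative powers is an option. A unitary matrix is a unit of the
  matrix ring, which excludes \<open>None\<close>, and uniqueness of inverses identifies the result
  with the adjoint.\<close>

lemma mat_inverse_unitary:
  assumes U: "unitary_mat U" "U \<in> carrier_mat n n"
  shows "mat_inverse U = Some (mat_adjoint U)"
proof (cases "mat_inverse U")
  case None
  have "U \<in> Units (ring_mat TYPE(complex) n ())"
    using unitary_matD [OF U] U by (auto simp: Units_def ring_mat_def intro!: bexI [of _ "mat_adjoint U"])
  with mat_inverse(1) [OF U(2) None, of "()"] show ?thesis by simp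
next
  case (Some B)
  note B = mat_inverse(2) [OF U(2) Some]
  have "B = B * (U * mat_adjoint U)"
    using unitary_matD [OF U] B by (auto simp: right_mult_one_mat)
  also have "\<dots> = (B * U) * mat_adjoint U"
    using U B by (intro assoc_mult_mat [symmetric, of _ n n _ n _ n]) auto
  also have "\<dots> = mat_adjoint U" using B U by simp
  finally show ?thesis using Some by simp
qed

lemma mat_powi_unitary:
  assumes "unitary_mat U" "U \<in> carrier_mat n n"
  shows "mat_powi U z = (if z \<ge> 0 then U ^\<^sub>m nat z else mat_adjoint U ^\<^sub>m nat (- z))"
  using mat_inverse_unitary [OF assms] by (simp add: mat_powi_def)

lemma unitary_mat_powi:
  assumes U: "unitary_mat U" "U \<in> carrier_mat n n"
  shows "unitary_mat (mat_powi U z)" "mat_powi U z \<in> carrier_mat n n"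
  using U unitary_mat_adjoint [OF U(1)] by (auto simp: mat_powi_unitary [OF U] intro!: unitary_mat_pow)

text \<open>The difference of the adjoints equals
  \<open>mat_adjoint U * (V - U) * mat_adjoint V\<close>, again with unitary outer factors. Negative
  powers thus cost no more than positive ones.\<close>

lemma op_bounded_adjoint_diff_unitary:
  assumes U: "unitary_mat U" "U \<in> carrier_mat n n" and V: "unitary_mat V" "V \<in> carrier_mat n n"
    and e: "op_bounded (U - V) e"
  shows "op_bounded (mat_adjoint U - mat_adjoint V) e"
proof -
  note sq = add_carrier_mat mult_carrier_mat [where n = n] minus_carrier_mat
  have "mat_adjoint U - mat_adjoint V = (mat_adjoint U * V) * mat_adjoint V - mat_adjoint U * (U * mat_adjoint V)"
  proof -
    have "(mat_adjoint U * V) * mat_adjoint V = mat_adjoint U"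
      using U V unitary_matD [OF V] by (subst assoc_mult_mat [of _ n n _ n _ n]) auto
    moreover have "mat_adjoint U * (U * mat_adjoint V) = mat_adjoint V"
      using U V unitary_matD [OF U] by (subst assoc_mult_mat [symmetric, of _ n n _ n _ n]) auto
    ultimately show ?thesis by simp
  qed
  also have "\<dots> = mat_adjoint U * (V - U) * mat_adjoint V"
    using U V by (simp add: sq assoc_mult_mat [of _ n n _ n _ n]
        mult_minus_distrib_mat [of _ n n _ n] minus_mult_distrib_mat [of _ n n _ _ n])
  finally have eq: "mat_adjoint U - mat_adjoint V = mat_adjoint U * (V - U) * mat_adjoint V" .
  have "op_bounded (V - U) e" by (rule op_bounded_diff_commute [OF U(2) V(2) e])
  then show ?thesis
    unfolding eq using U V by (intro op_bounded_unitary_conj [of _ n] unitary_mat_adjoint sq) auto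
qed

lemma mat_powi_diff_bound:
  assumes U: "unitary_mat U" "U \<in> carrier_mat n n" and V: "unitary_mat V" "V \<in> carrier_mat n n"
    and e: "op_bounded (U - V) e"
  shows "op_bounded (mat_powi U z - mat_powi V z) (\<bar>of_int z\<bar> * e)"
proof (cases "z \<ge> 0")
  case True
  then show ?thesis
    using pow_mat_diff_bound [OF U V e, of "nat z"] by (simp add: mat_powi_unitary [OF U] mat_powi_unitary [OF V])
next
  case False
  then show ?thesis
    using pow_mat_diff_bound [of "mat_adjoint U" n "mat_adjoint V" e "nat (- z)"] U V
      op_bounded_adjoint_diff_unitary [OF U V e]
    by (simp add: mat_powi_unitary [OF U] mat_powi_unitary [OF V] unitary_mat_adjoint)
qed

lemma mat_exp_pow:
  assumes A: "A \<in> carrier_mat n n" "skew_mat A"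
  shows "mat_exp A ^\<^sub>m k = mat_exp (of_nat k \<cdot>\<^sub>m A)"
proof (induction k)
  case 0
  then show ?case using A by (simp add: smult_zero_scalar_mat)
next
  case (Suc k)
  have kA: "of_nat k \<cdot>\<^sub>m A \<in> carrier_mat n n" "skew_mat (of_nat k \<cdot>\<^sub>m A)"
    using A skew_mat_of_real [of A "real k"] by auto
  have "mat_exp A ^\<^sub>m Suc k = mat_exp (of_nat k \<cdot>\<^sub>m A) * mat_exp A"
    using Suc by simp
  also have "\<dots> = mat_exp (of_nat k \<cdot>\<^sub>m A + A)"
    using A kA by (intro mat_exp_add_commuting [of _ n, symmetric])
      (auto simp: mult_smult_distrib [of _ n n] mult_smult_assoc_mat [of _ n n])
  also have "of_nat k \<cdot>\<^sub>m A + A = of_nat (Suc k) \<cdot>\<^sub>m A"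
    by (intro eq_matI) (auto simp: algebra_simps)
  finally show ?case .
qed

lemma mat_exp_powi:
  assumes A: "A \<in> carrier_mat n n" "skew_mat A"
  shows "mat_powi (mat_exp A) z = mat_exp (of_int z \<cdot>\<^sub>m A)"
proof -
  have adj: "mat_adjoint (mat_exp A) = mat_exp (- A)"
    using A by (simp add: mat_adjoint_exp skew_mat_def)
  have "of_nat (nat (- z)) \<cdot>\<^sub>m (- A) = of_int z \<cdot>\<^sub>m A" if "z < 0"
    using that by (intro eq_matI) auto
  then show ?thesis
    using A skew_mat_uminus [OF A(2)]
    by (auto simp: mat_powi_unitary [OF unitary_mat_exp [OF A], of n] adj mat_exp_pow [of _ n])
qed

section \<open>Block matrices and Kronecker products\<close>

text \<open>An index of the large matrix is encoded as a block label \<open>p i\<close> together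
  with a position \<open>q i\<close> inside the block. Blocks may be scattered over the index range,
  so that one development serves both the embedding of a middle tensor factor and the diagonal in
  the last factor.\<close>

locale block_index =
  fixes n M :: nat and p :: "nat \<Rightarrow> 'b" and q :: "nat \<Rightarrow> nat" and B :: "'b set"
  assumes bij: "bij_betw (\<lambda>i. (p i, q i)) {..<n} (B \<times> {..<M})"
    and fin: "finite B"
begin

definition block_mat :: "('b \<Rightarrow> complex mat) \<Rightarrow> complex mat" where
  "block_mat X = mat n n (\<lambda>(i, j). if p i = p j then X (p i) $$ (q i, q j) else 0)"

lemma p_in [simp]: "i < n \<Longrightarrow> p i \<in> B" and q_less [simp]: "i < n \<Longrightarrow> q i < M"
  using bij by (auto simp: bij_betw_def)

lemma pq_inj: "i < n \<Longrightarrow> j < n \<Longrightarrow> p i = p j \<and> q i = q j \<longleftrightarrow> i = j"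
  using bij by (auto simp: bij_betw_def inj_on_def)

lemma sum_blocks: "(\<Sum>i<n. f (p i) (q i)) = (\<Sum>b\<in>B. \<Sum>k<M. f b k)"
  using sum.reindex_bij_betw [OF bij, of "\<lambda>(b, k). f b k"] by (simp add: sum.cartesian_product)

lemma sum_block:
  assumes "b \<in> B"
  shows "(\<Sum>i<n. if p i = b then f (q i) else 0) = (\<Sum>k<M. f k)"
proof -
  have "(\<Sum>k<M. if b' = b then f k else 0) = (if b' = b then \<Sum>k<M. f k else 0)" for b'
    by simp
  with sum_blocks [of "\<lambda>b' k. if b' = b then f k else 0"] show ?thesis
    using assms fin by simp
qed

lemma block_mat_carrier [simp]: "block_mat X \<in> carrier_mat n n"
  by (simp add: block_mat_def)

lemma block_mat_dim [simp]: "dim_row (block_mat X) = n" "dim_col (block_mat X) = n"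
  by (simp_all add: block_mat_def)

lemma block_mat_index:
  "i < n \<Longrightarrow> j < n \<Longrightarrow> block_mat X $$ (i, j) = (if p i = p j then X (p i) $$ (q i, q j) else 0)"
  by (simp add: block_mat_def)

lemma block_mat_mult:
  assumes "\<And>b. b \<in> B \<Longrightarrow> X b \<in> carrier_mat M M" "\<And>b. b \<in> B \<Longrightarrow> Y b \<in> carrier_mat M M"
  shows "block_mat X * block_mat Y = block_mat (\<lambda>b. X b * Y b)"
proof (rule eq_matI)
  fix i j assume "i < dim_row (block_mat (\<lambda>b. X b * Y b))" "j < dim_col (block_mat (\<lambda>b. X b * Y b))"
  then have ij: "i < n" "j < n" by auto
  have "(block_mat X * block_mat Y) $$ (i, j) = (\<Sum>k<n. block_mat X $$ (i, k) * block_mat Y $$ (k, j))"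
    using ij by (intro mat_mult_index) auto
  also have "\<dots> = (\<Sum>k<n. if p k = p i then
      (if p i = p j then X (p i) $$ (q i, q k) * Y (p i) $$ (q k, q j) else 0) else 0)"
    using ij by (intro sum.cong) (auto simp: block_mat_index)
  also have "\<dots> = (\<Sum>k<M. if p i = p j then X (p i) $$ (q i, k) * Y (p i) $$ (k, q j) else 0)"
    using ij by (intro sum_block) auto
  also have "\<dots> = block_mat (\<lambda>b. X b * Y b) $$ (i, j)"
    using ij assms [of "p i"] by (auto simp: block_mat_index mat_mult_index [of _ M M _ M] simp del: index_mult_mat(1))
  finally show "(block_mat X * block_mat Y) $$ (i, j) = block_mat (\<lambda>b. X b * Y b) $$ (i, j)" .
qed auto

lemma block_mat_cong: "(\<And>b. b \<in> B \<Longrightarrow> X b = Y b) \<Longrightarrow> block_mat X = block_mat Y"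
  by (intro eq_matI) (auto simp: block_mat_index)

lemma block_mat_add:
  assumes "\<And>b. b \<in> B \<Longrightarrow> X b \<in> carrier_mat M M" "\<And>b. b \<in> B \<Longrightarrow> Y b \<in> carrier_mat M M"
  shows "block_mat X + block_mat Y = block_mat (\<lambda>b. X b + Y b)"
proof (rule eq_matI)
  fix i j assume "i < dim_row (block_mat (\<lambda>b. X b + Y b))" "j < dim_col (block_mat (\<lambda>b. X b + Y b))"
  then have ij: "i < n" "j < n" by auto
  then show "(block_mat X + block_mat Y) $$ (i, j) = block_mat (\<lambda>b. X b + Y b) $$ (i, j)"
    using assms [of "p i"] by (auto simp: block_mat_index)
qed auto

lemma block_mat_diff:
  assumes "\<And>b. b \<in> B \<Longrightarrow> X b \<in> carrier_mat M M" "\<And>b. b \<in> B \<Longrightarrow> Y b \<in> carrier_mat M M"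
  shows "block_mat X - block_mat Y = block_mat (\<lambda>b. X b - Y b)"
proof (rule eq_matI)
  fix i j assume "i < dim_row (block_mat (\<lambda>b. X b - Y b))" "j < dim_col (block_mat (\<lambda>b. X b - Y b))"
  then have ij: "i < n" "j < n" by auto
  then show "(block_mat X - block_mat Y) $$ (i, j) = block_mat (\<lambda>b. X b - Y b) $$ (i, j)"
    using assms [of "p i"] by (auto simp: block_mat_index)
qed auto

lemma block_mat_smult:
  assumes "\<And>b. b \<in> B \<Longrightarrow> X b \<in> carrier_mat M M"
  shows "c \<cdot>\<^sub>m block_mat X = block_mat (\<lambda>b. c \<cdot>\<^sub>m X b)"
proof (rule eq_matI)
  fix i j assume "i < dim_row (block_mat (\<lambda>b. c \<cdot>\<^sub>m X b))" "j < dim_col (block_mat (\<lambda>b. c \<cdot>\<^sub>m X b))"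
  then have ij: "i < n" "j < n" by auto
  then show "(c \<cdot>\<^sub>m block_mat X) $$ (i, j) = block_mat (\<lambda>b. c \<cdot>\<^sub>m X b) $$ (i, j)"
    using assms [of "p i"] by (auto simp: block_mat_index)
qed auto

lemma block_mat_one: "block_mat (\<lambda>_. 1\<^sub>m M) = 1\<^sub>m n"
  by (intro eq_matI) (auto simp: block_mat_index dest: pq_inj)

lemma block_mat_adjoint:
  assumes "\<And>b. b \<in> B \<Longrightarrow> X b \<in> carrier_mat M M"
  shows "mat_adjoint (block_mat X) = block_mat (\<lambda>b. mat_adjoint (X b))"
proof (rule eq_matI)
  fix i j assume "i < dim_row (block_mat (\<lambda>b. mat_adjoint (X b)))" "j < dim_col (block_mat (\<lambda>b. mat_adjoint (X b)))"
  then have ij: "i < n" "j < n" by auto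
  then show "mat_adjoint (block_mat X) $$ (i, j) = block_mat (\<lambda>b. mat_adjoint (X b)) $$ (i, j)"
    using assms [of "p i"] by (auto simp: block_mat_index)
qed auto

lemma block_mat_pow:
  assumes "\<And>b. b \<in> B \<Longrightarrow> X b \<in> carrier_mat M M"
  shows "block_mat X ^\<^sub>m k = block_mat (\<lambda>b. X b ^\<^sub>m k)"
proof (induction k)
  case 0
  have "block_mat (\<lambda>b. X b ^\<^sub>m 0) = block_mat (\<lambda>_. 1\<^sub>m M)"
    by (rule block_mat_cong) (use assms in auto)
  then show ?case by (simp add: block_mat_one)
next
  case (Suc k)
  then show ?case using assms by (simp add: block_mat_mult)
qed

text \<open>Entries between different blocks vanish in every power, and inside a block the series is
  that of the block.\<close>

lemma block_mat_exp:
  assumes "\<And>b. b \<in> B \<Longrightarrow> X b \<in> carrier_mat M M"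
  shows "mat_exp (block_mat X) = block_mat (\<lambda>b. mat_exp (X b))"
proof (rule mat_exp_eqI [of _ n])
  fix i j assume "i < n" "j < n"
  then show "(\<lambda>k. (block_mat X ^\<^sub>m k) $$ (i, j) / fact k) sums (block_mat (\<lambda>b. mat_exp (X b)) $$ (i, j))"
    using mat_exp_sums [OF assms [of "p i"], of "q i" "q j"]
    by (auto simp: block_mat_pow [OF assms] block_mat_index)
qed auto

lemma unitary_block_mat:
  assumes "\<And>b. b \<in> B \<Longrightarrow> X b \<in> carrier_mat M M" "\<And>b. b \<in> B \<Longrightarrow> unitary_mat (X b)"
  shows "unitary_mat (block_mat X)"
proof (rule unitary_matI [of _ n])
  have c: "mat_adjoint (X b) \<in> carrier_mat M M" if "b \<in> B" for b using assms(1) [OF that] by simp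
  have "block_mat (\<lambda>b. mat_adjoint (X b) * X b) = block_mat (\<lambda>_. 1\<^sub>m M)"
    using assms by (intro block_mat_cong) (auto simp: unitary_matD [of _ M])
  then show "mat_adjoint (block_mat X) * block_mat X = 1\<^sub>m n"
    by (simp add: block_mat_adjoint [OF assms(1)] block_mat_mult [OF c assms(1)] block_mat_one)
  have "block_mat (\<lambda>b. X b * mat_adjoint (X b)) = block_mat (\<lambda>_. 1\<^sub>m M)"
    using assms by (intro block_mat_cong) (auto simp: unitary_matD [of _ M])
  then show "block_mat X * mat_adjoint (block_mat X) = 1\<^sub>m n"
    by (simp add: block_mat_adjoint [OF assms(1)] block_mat_mult [OF assms(1) c] block_mat_one)
qed auto

text \<open>The vector is cut into one piece \<open>w b\<close> per label, with \<open>idx\<close>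
  inverting the pair encoding. Squared norms add over the pieces, before and after applying the
  matrix, so the bound holds piece by piece.\<close>

lemma op_bounded_block_mat:
  assumes X: "\<And>b. b \<in> B \<Longrightarrow> X b \<in> carrier_mat M M" "\<And>b. b \<in> B \<Longrightarrow> op_bounded (X b) c"
    and "0 \<le> c"
  shows "op_bounded (block_mat X) c"
  unfolding op_bounded_def
proof
  fix v :: "complex vec" assume "v \<in> carrier_vec (dim_col (block_mat X))"
  then have v: "v \<in> carrier_vec n" by simp
  define idx where "idx = inv_into {..<n} (\<lambda>i. (p i, q i))"
  have idx: "idx (p i, q i) = i" if "i < n" for i
    unfolding idx_def using bij that inv_into_f_f [of "\<lambda>i. (p i, q i)" "{..<n}" i]
    by (simp add: bij_betw_def)
  define w where "w b = vec M (\<lambda>k. v $ idx (b, k))" for b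
  have w: "w b \<in> carrier_vec M" for b by (simp add: w_def)
  have norm: "(vec_norm2 u)\<^sup>2 = (\<Sum>b\<in>B. (vec_norm2 (y b))\<^sup>2)"
    if "u \<in> carrier_vec n" "\<And>b. b \<in> B \<Longrightarrow> y b \<in> carrier_vec M" "\<And>i. i < n \<Longrightarrow> u $ i = y (p i) $ q i" for u y
  proof -
    have "(vec_norm2 u)\<^sup>2 = (\<Sum>i<n. (cmod (y (p i) $ q i))\<^sup>2)"
      using that by (simp add: vec_norm2_power2)
    also have "\<dots> = (\<Sum>b\<in>B. (vec_norm2 (y b))\<^sup>2)"
      unfolding sum_blocks [of "\<lambda>b k. (cmod (y b $ k))\<^sup>2"] vec_norm2_power2
      using carrier_vecD [OF that(2)] by (intro sum.cong) auto
    finally show ?thesis .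
  qed
  have "(block_mat X *\<^sub>v v) $ i = (X (p i) *\<^sub>v w (p i)) $ q i" if i: "i < n" for i
  proof -
    have "(block_mat X *\<^sub>v v) $ i = (\<Sum>j<n. block_mat X $$ (i, j) * v $ j)"
      using i v by (simp add: scalar_prod_def lessThan_atLeast0)
    also have "\<dots> = (\<Sum>j<n. if p j = p i then X (p i) $$ (q i, q j) * w (p i) $ q j else 0)"
    proof (intro sum.cong refl)
      fix j assume "j \<in> {..<n}"
      then show "block_mat X $$ (i, j) * v $ j = (if p j = p i then X (p i) $$ (q i, q j) * w (p i) $ q j else 0)"
        using i idx [of j] by (auto simp: block_mat_index w_def)
    qed
    also have "\<dots> = (\<Sum>k<M. X (p i) $$ (q i, k) * w (p i) $ k)"
      using i by (intro sum_block) auto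
    also have "\<dots> = (X (p i) *\<^sub>v w (p i)) $ q i"
      using X(1) [of "p i"] w i by (simp add: scalar_prod_def lessThan_atLeast0 carrier_vecD [OF w])
    finally show ?thesis .
  qed
  then have "(vec_norm2 (block_mat X *\<^sub>v v))\<^sup>2 = (\<Sum>b\<in>B. (vec_norm2 (X b *\<^sub>v w b))\<^sup>2)"
    using v w X(1)
    by (intro norm) (auto intro: mult_mat_vec_carrier [of _ n n] mult_mat_vec_carrier [of _ M M] simp del: index_mult_mat_vec)
  also have "\<dots> \<le> (\<Sum>b\<in>B. (c * vec_norm2 (w b))\<^sup>2)"
    using X w by (intro sum_mono power_mono op_boundedD) auto
  also have "\<dots> = (c * vec_norm2 v)\<^sup>2"
    using norm [of v w] v w by (simp add: power_mult_distrib sum_distrib_left [symmetric] w_def idx)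
  finally show "vec_norm2 (block_mat X *\<^sub>v v) \<le> c * vec_norm2 v"
    using \<open>0 \<le> c\<close> by (auto intro: power2_le_imp_le)
qed

end

section \<open>Kronecker products and mixed-radix indices\<close>

lemma kron_carrier:
  "A \<in> carrier_mat a b \<Longrightarrow> C \<in> carrier_mat c d \<Longrightarrow> A \<otimes>\<^sub>k C \<in> carrier_mat (a * c) (b * d)"
  by (auto simp: kron_def)

lemma kron_dim [simp]:
  "dim_row (A \<otimes>\<^sub>k C) = dim_row A * dim_row C" "dim_col (A \<otimes>\<^sub>k C) = dim_col A * dim_col C"
  by (simp_all add: kron_def)

lemma kron_index:
  "i < dim_row A * dim_row C \<Longrightarrow> j < dim_col A * dim_col C \<Longrightarrow>
    (A \<otimes>\<^sub>k C) $$ (i, j) = A $$ (i div dim_row C, j div dim_col C) * C $$ (i mod dim_row C, j mod dim_col C)"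
  by (simp add: kron_def)

lemma div_mod_less_mult:
  fixes i a b :: nat
  assumes "i < a * b"
  shows "i div b < a" "i mod b < b" "0 < b"
  using assms by (auto simp: less_mult_imp_div_less intro!: mod_less_divisor gr0I)

lemma mult_add_less_mult:
  fixes i j a b :: nat
  assumes "i < a" "j < b"
  shows "i * b + j < a * b"
proof -
  have "i * b + j < Suc i * b" using assms(2) by simp
  also have "\<dots> \<le> a * b" using assms(1) by (intro mult_le_mono1) simp
  finally show ?thesis .
qed

lemma sum_less_mult: "(\<Sum>k<a * b. f (k div b) (k mod b)) = (\<Sum>i<a. \<Sum>j<b. f i j)" for a b :: nat
proof -
  have "(\<Sum>k<a * b. f (k div b) (k mod b)) = (\<Sum>(i, j)\<in>{..<a} \<times> {..<b}. f i j)"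
    by (rule sum.reindex_bij_witness [of _ "\<lambda>(i, j). i * b + j" "\<lambda>k. (k div b, k mod b)"])
      (auto simp: div_mod_less_mult mult_add_less_mult)
  then show ?thesis by (simp add: sum.cartesian_product)
qed

text \<open>The mixed-product rule. The summation index splits into its two digits, and the double
  sum becomes a product of two sums.\<close>

lemma kron_mult:
  assumes "A \<in> carrier_mat a b" "A' \<in> carrier_mat b c" "C \<in> carrier_mat a' b'" "C' \<in> carrier_mat b' c'"
  shows "(A \<otimes>\<^sub>k C) * (A' \<otimes>\<^sub>k C') = (A * A') \<otimes>\<^sub>k (C * C')"
proof (rule eq_matI)
  fix i j assume "i < dim_row ((A * A') \<otimes>\<^sub>k (C * C'))" "j < dim_col ((A * A') \<otimes>\<^sub>k (C * C'))"
  then have ij: "i < a * a'" "j < c * c'" using assms by auto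
  note less = div_mod_less_mult [OF ij(1)] div_mod_less_mult [OF ij(2)]
  have "((A \<otimes>\<^sub>k C) * (A' \<otimes>\<^sub>k C')) $$ (i, j) = (\<Sum>k<b * b'. (A \<otimes>\<^sub>k C) $$ (i, k) * (A' \<otimes>\<^sub>k C') $$ (k, j))"
    using ij assms by (intro mat_mult_index) (auto intro!: carrier_matI)
  also have "\<dots> = (\<Sum>k<b * b'. A $$ (i div a', k div b') * C $$ (i mod a', k mod b')
      * (A' $$ (k div b', j div c') * C' $$ (k mod b', j mod c')))"
    using ij assms by (intro sum.cong) (auto simp: kron_index)
  also have "\<dots> = (\<Sum>k<b. \<Sum>l<b'. A $$ (i div a', k) * C $$ (i mod a', l)
      * (A' $$ (k, j div c') * C' $$ (l, j mod c')))"
    by (rule sum_less_mult)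
  also have "\<dots> = (\<Sum>k<b. A $$ (i div a', k) * A' $$ (k, j div c'))
      * (\<Sum>l<b'. C $$ (i mod a', l) * C' $$ (l, j mod c'))"
    by (simp add: sum_product algebra_simps)
  also have "\<dots> = (A * A') $$ (i div a', j div c') * (C * C') $$ (i mod a', j mod c')"
    using less assms by (simp add: mat_mult_index [of A a b A' c] mat_mult_index [of C a' b' C' c'] del: index_mult_mat(1))
  also have "\<dots> = ((A * A') \<otimes>\<^sub>k (C * C')) $$ (i, j)"
    using ij assms by (simp add: kron_index del: index_mult_mat(1))
  finally show "((A \<otimes>\<^sub>k C) * (A' \<otimes>\<^sub>k C')) $$ (i, j) = ((A * A') \<otimes>\<^sub>k (C * C')) $$ (i, j)" .
qed (use assms in auto)

lemma mod_mult_div: "i mod (a * b) div b = i div b mod a" for i a b :: nat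
  by (cases "b = 0") (simp_all add: mod_mult2_eq mult.commute [of a b])

text \<open>Both sides read off the same three mixed-radix digits of each index.\<close>

lemma kron_assoc: "(A \<otimes>\<^sub>k C) \<otimes>\<^sub>k D = A \<otimes>\<^sub>k (C \<otimes>\<^sub>k D)"
proof (rule eq_matI)
  fix i j assume "i < dim_row (A \<otimes>\<^sub>k (C \<otimes>\<^sub>k D))" "j < dim_col (A \<otimes>\<^sub>k (C \<otimes>\<^sub>k D))"
  then have i: "i < dim_row A * (dim_row C * dim_row D)" and j: "j < dim_col A * (dim_col C * dim_col D)"
    by auto
  then have "i < (dim_row A * dim_row C) * dim_row D" "j < (dim_col A * dim_col C) * dim_col D"
    by (simp_all add: mult.assoc)
  then show "((A \<otimes>\<^sub>k C) \<otimes>\<^sub>k D) $$ (i, j) = (A \<otimes>\<^sub>k (C \<otimes>\<^sub>k D)) $$ (i, j)"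
    using i j div_mod_less_mult(1,2) [OF i] div_mod_less_mult(1,2) [OF j]
      div_mod_less_mult(1) [of i "dim_row A * dim_row C" "dim_row D"]
      div_mod_less_mult(1) [of j "dim_col A * dim_col C" "dim_col D"]
    by (simp add: kron_index mod_mult_div div_mult2_eq [of _ "dim_row D" "dim_row C", folded mult.commute [of "dim_row C"]]
        div_mult2_eq [of _ "dim_col D" "dim_col C", folded mult.commute [of "dim_col C"]] mod_mod_cancel)
qed (auto simp: mult.assoc)

lemma one_kron_one: "1\<^sub>m a \<otimes>\<^sub>k 1\<^sub>m b = 1\<^sub>m (a * b)"
proof (rule eq_matI)
  fix i j assume "i < dim_row (1\<^sub>m (a * b) :: complex mat)" "j < dim_col (1\<^sub>m (a * b) :: complex mat)"
  then have ij: "i < a * b" "j < a * b" by auto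
  have "i = j" if "i div b = j div b" "i mod b = j mod b"
    using that by (metis div_mult_mod_eq)
  then show "(1\<^sub>m a \<otimes>\<^sub>k 1\<^sub>m b) $$ (i, j) = 1\<^sub>m (a * b) $$ (i, j)"
    using ij div_mod_less_mult [OF ij(1)] div_mod_less_mult [OF ij(2)] by (auto simp: kron_index)
qed auto

lemma idq_eq: "idq n = 1\<^sub>m (2 ^ n)"
  unfolding idq_def by (induction n) (simp_all add: one_kron_one)

lemma kron_one_1 [simp]: "A \<otimes>\<^sub>k 1\<^sub>m 1 = A"
  by (intro eq_matI) (auto simp: kron_index)

text \<open>The dimensions on the two sides are arbitrary. Powers of two give a register operator,
  and \<open>b = 1\<close> gives the padding of a \<open>j\<close>-qubit gate by identities.\<close>

definition embed_mat :: "nat \<Rightarrow> nat \<Rightarrow> complex mat \<Rightarrow> complex mat" where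
  "embed_mat a b G = 1\<^sub>m a \<otimes>\<^sub>k (G \<otimes>\<^sub>k 1\<^sub>m b)"

text \<open>An index has three mixed-radix digits. The outer two form the block label and the middle
  one is the position on which \<open>G\<close> acts, whence one identical block for each pair of
  outer digits.\<close>

lemma block_index_embed:
  "block_index (a * (N * b)) N (\<lambda>i. (i div (N * b), i mod b)) (\<lambda>i. i div b mod N) ({..<a} \<times> {..<b})"
proof
  show "bij_betw (\<lambda>i. ((i div (N * b), i mod b), i div b mod N)) {..<a * (N * b)} (({..<a} \<times> {..<b}) \<times> {..<N})"
  proof (rule bij_betw_byWitness [where f' = "\<lambda>((x, z), y). (x * N + y) * b + z"])
    show "\<forall>i\<in>{..<a * (N * b)}. (\<lambda>((x, z), y). (x * N + y) * b + z)
        ((i div (N * b), i mod b), i div b mod N) = i"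
      by (simp add: div_mult2_eq mult.commute [of N b])
    show "\<forall>x\<in>({..<a} \<times> {..<b}) \<times> {..<N}. (\<lambda>i. ((i div (N * b), i mod b), i div b mod N))
        ((\<lambda>((x, z), y). (x * N + y) * b + z) x) = x"
      by (auto simp: div_mult2_eq mult.commute [of N b])
    show "(\<lambda>i. ((i div (N * b), i mod b), i div b mod N)) ` {..<a * (N * b)} \<subseteq> ({..<a} \<times> {..<b}) \<times> {..<N}"
    proof clarsimp
      fix i assume "i < a * (N * b)"
      then have "i < a * (N * b)" "0 < N * b" by (auto intro: gr0I)
      then show "i div (N * b) < a \<and> i mod b < b \<and> i div b mod N < N"
        by (auto simp: less_mult_imp_div_less)
    qed
    show "(\<lambda>((x, z), y). (x * N + y) * b + z) ` (({..<a} \<times> {..<b}) \<times> {..<N}) \<subseteq> {..<a * (N * b)}"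
      by (auto simp: mult.assoc [symmetric] intro!: mult_add_less_mult)
  qed
qed auto

context
  fixes a b N :: nat
begin

interpretation block_index "a * (N * b)" N "\<lambda>i. (i div (N * b), i mod b)" "\<lambda>i. i div b mod N" "{..<a} \<times> {..<b}"
  by (rule block_index_embed)

lemma embed_mat_block_mat:
  assumes G: "G \<in> carrier_mat N N"
  shows "embed_mat a b G = block_mat (\<lambda>_. G)"
proof (rule eq_matI)
  fix i j assume "i < dim_row (block_mat (\<lambda>_. G))" "j < dim_col (block_mat (\<lambda>_. G))"
  then have i: "i < a * (N * b)" and j: "j < a * (N * b)" by auto
  have *: "i mod (N * b) mod b = i mod b" for i :: nat
    by (simp add: mod_mod_cancel)
  show "embed_mat a b G $$ (i, j) = block_mat (\<lambda>_. G) $$ (i, j)"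
    using i j G div_mod_less_mult [OF i] div_mod_less_mult [OF j]
    by (simp add: embed_mat_def kron_index block_mat_index mod_mult_div *)
qed (use G in \<open>auto simp: embed_mat_def\<close>)

lemma embed_mat_carrier: "G \<in> carrier_mat N N \<Longrightarrow> embed_mat a b G \<in> carrier_mat (a * (N * b)) (a * (N * b))"
  by (simp add: embed_mat_block_mat)

lemma embed_mat_mult:
  "G \<in> carrier_mat N N \<Longrightarrow> K \<in> carrier_mat N N \<Longrightarrow> embed_mat a b G * embed_mat a b K = embed_mat a b (G * K)"
  by (simp add: embed_mat_block_mat mult_carrier_mat [where n = N] block_mat_mult)

lemma embed_mat_diff:
  "G \<in> carrier_mat N N \<Longrightarrow> K \<in> carrier_mat N N \<Longrightarrow> embed_mat a b G - embed_mat a b K = embed_mat a b (G - K)"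
  by (simp add: embed_mat_block_mat minus_carrier_mat block_mat_diff)

lemma embed_mat_smult: "G \<in> carrier_mat N N \<Longrightarrow> c \<cdot>\<^sub>m embed_mat a b G = embed_mat a b (c \<cdot>\<^sub>m G)"
  by (simp add: embed_mat_block_mat block_mat_smult)

lemma embed_mat_adjoint: "G \<in> carrier_mat N N \<Longrightarrow> mat_adjoint (embed_mat a b G) = embed_mat a b (mat_adjoint G)"
  by (simp add: embed_mat_block_mat block_mat_adjoint)

lemma embed_mat_exp: "G \<in> carrier_mat N N \<Longrightarrow> mat_exp (embed_mat a b G) = embed_mat a b (mat_exp G)"
  by (simp add: embed_mat_block_mat block_mat_exp)

lemma unitary_embed_mat: "G \<in> carrier_mat N N \<Longrightarrow> unitary_mat G \<Longrightarrow> unitary_mat (embed_mat a b G)"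
  by (simp add: embed_mat_block_mat unitary_block_mat)

lemma op_bounded_embed_mat:
  "G \<in> carrier_mat N N \<Longrightarrow> op_bounded G c \<Longrightarrow> 0 \<le> c \<Longrightarrow> op_bounded (embed_mat a b G) c"
  by (simp add: embed_mat_block_mat op_bounded_block_mat)

end

section \<open>Operators acting on one of the registers\<close>

lemma on_register_embed_mat: "on_register d n G m = embed_mat (2 ^ ((m - 1) * n)) (2 ^ ((d - m) * n)) G"
  by (simp add: on_register_def embed_mat_def idq_eq)

lemma register_dim:
  assumes "m \<in> {1..d}"
  shows "(2::nat) ^ ((m - 1) * n) * (2 ^ n * 2 ^ ((d - m) * n)) = 2 ^ (d * n)"
proof -
  have "(m - 1) + (1 + (d - m)) = d" using assms by auto
  then have "(m - 1) * n + (n + (d - m) * n) = d * n"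
    by (metis add_mult_distrib mult_1)
  then show ?thesis by (simp add: power_add [symmetric])
qed

lemma on_register_carrier:
  assumes "m \<in> {1..d}" and "G \<in> carrier_mat (2 ^ n) (2 ^ n)"
  shows "on_register d n G m \<in> carrier_mat (2 ^ (d * n)) (2 ^ (d * n))"
  unfolding on_register_embed_mat register_dim [OF assms(1), symmetric]
  by (rule embed_mat_carrier [OF assms(2)])

context
  fixes d n m :: nat and G :: "complex mat"
  assumes G: "G \<in> carrier_mat (2 ^ n) (2 ^ n)"
begin

lemma on_register_mult:
  "K \<in> carrier_mat (2 ^ n) (2 ^ n) \<Longrightarrow>
    on_register d n G m * on_register d n K m = on_register d n (G * K) m"
  unfolding on_register_embed_mat by (rule embed_mat_mult [OF G])

lemma on_register_diff:
  "K \<in> carrier_mat (2 ^ n) (2 ^ n) \<Longrightarrow>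
    on_register d n G m - on_register d n K m = on_register d n (G - K) m"
  unfolding on_register_embed_mat by (rule embed_mat_diff [OF G])

lemma on_register_smult: "c \<cdot>\<^sub>m on_register d n G m = on_register d n (c \<cdot>\<^sub>m G) m"
  unfolding on_register_embed_mat by (rule embed_mat_smult [OF G])

lemma on_register_adjoint: "mat_adjoint (on_register d n G m) = on_register d n (mat_adjoint G) m"
  unfolding on_register_embed_mat by (rule embed_mat_adjoint [OF G])

lemma on_register_exp: "mat_exp (on_register d n G m) = on_register d n (mat_exp G) m"
  unfolding on_register_embed_mat by (rule embed_mat_exp [OF G])

lemma unitary_on_register: "unitary_mat G \<Longrightarrow> unitary_mat (on_register d n G m)"
  unfolding on_register_embed_mat by (rule unitary_embed_mat [OF G])

lemma op_bounded_on_register: "op_bounded G c \<Longrightarrow> 0 \<le> c \<Longrightarrow> op_bounded (on_register d n G m) c"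
  unfolding on_register_embed_mat by (rule op_bounded_embed_mat [OF G])

end

text \<open>Both operators are refined to five tensor factors: identity, register, identity,
  register, identity. \<open>G\<close> and \<open>K\<close> occupy different factors, where each
  meets only an identity. The case \<open>m < l\<close> suffices, since the equation is
  symmetric.\<close>

lemma on_register_commute:
  assumes ml: "m \<in> {1..d}" "l \<in> {1..d}" "m \<noteq> l"
    and G: "G \<in> carrier_mat (2 ^ n) (2 ^ n)" and K: "K \<in> carrier_mat (2 ^ n) (2 ^ n)"
  shows "on_register d n G m * on_register d n K l = on_register d n K l * on_register d n G m"
proof -
  have main: "on_register d n G m * on_register d n K l = on_register d n K l * on_register d n G m"
    if ml: "m \<in> {1..d}" "l \<in> {1..d}" "m < l"
      and G: "G \<in> carrier_mat (2 ^ n) (2 ^ n)" and K: "K \<in> carrier_mat (2 ^ n) (2 ^ n)" for m l G K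
  proof -
    define P Q S N where "P = (2::nat) ^ ((m - 1) * n)" and "Q = (2::nat) ^ ((l - m - 1) * n)"
      and "S = (2::nat) ^ ((d - l) * n)" and "N = (2::nat) ^ n"
    have "d - m = (l - m - 1) + (1 + (d - l))" "l - 1 = (m - 1) + (1 + (l - m - 1))"
      using ml by auto
    then have e: "(d - m) * n = (l - m - 1) * n + (n + (d - l) * n)" "(l - 1) * n = (m - 1) * n + (n + (l - m - 1) * n)"
      by (metis add_mult_distrib mult_1)+
    have dims: "(2::nat) ^ ((d - m) * n) = Q * (N * S)" "(2::nat) ^ ((l - 1) * n) = P * (N * Q)"
      unfolding e by (simp_all add: P_def Q_def S_def N_def power_add)
    have on: "on_register d n G m = 1\<^sub>m P \<otimes>\<^sub>k G \<otimes>\<^sub>k 1\<^sub>m Q \<otimes>\<^sub>k 1\<^sub>m N \<otimes>\<^sub>k 1\<^sub>m S"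
      "on_register d n K l = 1\<^sub>m P \<otimes>\<^sub>k 1\<^sub>m N \<otimes>\<^sub>k 1\<^sub>m Q \<otimes>\<^sub>k K \<otimes>\<^sub>k 1\<^sub>m S"
      unfolding on_register_def idq_eq dims P_def [symmetric] S_def [symmetric]
      by (simp_all add: one_kron_one [symmetric] kron_assoc)
    have c: "G \<in> carrier_mat N N" "K \<in> carrier_mat N N" using G K by (simp_all add: N_def)
    note kc = kron_carrier one_carrier_mat c
    have mult: "(1\<^sub>m P \<otimes>\<^sub>k A1 \<otimes>\<^sub>k 1\<^sub>m Q \<otimes>\<^sub>k A2 \<otimes>\<^sub>k 1\<^sub>m S) * (1\<^sub>m P \<otimes>\<^sub>k B1 \<otimes>\<^sub>k 1\<^sub>m Q \<otimes>\<^sub>k B2 \<otimes>\<^sub>k 1\<^sub>m S)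
        = 1\<^sub>m P \<otimes>\<^sub>k (A1 * B1) \<otimes>\<^sub>k 1\<^sub>m Q \<otimes>\<^sub>k (A2 * B2) \<otimes>\<^sub>k 1\<^sub>m S"
      if "A1 \<in> carrier_mat N N" "A2 \<in> carrier_mat N N" "B1 \<in> carrier_mat N N" "B2 \<in> carrier_mat N N" for A1 A2 B1 B2
    proof -
      have 1: "(A2 \<otimes>\<^sub>k 1\<^sub>m S) * (B2 \<otimes>\<^sub>k 1\<^sub>m S) = (A2 * B2) \<otimes>\<^sub>k 1\<^sub>m S"
        using that by (subst kron_mult [of _ N N _ N _ S S _ S]) auto
      have 2: "(1\<^sub>m Q \<otimes>\<^sub>k A2 \<otimes>\<^sub>k 1\<^sub>m S) * (1\<^sub>m Q \<otimes>\<^sub>k B2 \<otimes>\<^sub>k 1\<^sub>m S) = 1\<^sub>m Q \<otimes>\<^sub>k (A2 * B2) \<otimes>\<^sub>k 1\<^sub>m S"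
        using that by (subst kron_mult [of _ Q Q _ Q _ "N * S" "N * S" _ "N * S"]) (auto simp: 1 intro!: kron_carrier)
      have 3: "(A1 \<otimes>\<^sub>k 1\<^sub>m Q \<otimes>\<^sub>k A2 \<otimes>\<^sub>k 1\<^sub>m S) * (B1 \<otimes>\<^sub>k 1\<^sub>m Q \<otimes>\<^sub>k B2 \<otimes>\<^sub>k 1\<^sub>m S)
          = (A1 * B1) \<otimes>\<^sub>k 1\<^sub>m Q \<otimes>\<^sub>k (A2 * B2) \<otimes>\<^sub>k 1\<^sub>m S"
        using that by (subst kron_mult [of _ N N _ N _ "Q * (N * S)" "Q * (N * S)" _ "Q * (N * S)"])
          (auto simp: 2 intro!: kron_carrier)
      show ?thesis
        using that by (subst kron_mult [of _ P P _ P _ "N * (Q * (N * S))" "N * (Q * (N * S))" _ "N * (Q * (N * S))"])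
          (auto simp: 3 intro!: kron_carrier)
    qed
    show ?thesis unfolding on using c by (simp add: mult)
  qed
  show ?thesis
  proof (cases "m < l")
    case True
    show ?thesis by (rule main [OF ml(1,2) True G K])
  next
    case False
    then have "l < m" using ml by simp
    show ?thesis by (rule main [OF ml(2,1) \<open>l < m\<close> K G, symmetric])
  qed
qed

section \<open>The one-register hopping terms\<close>

lemma kron_ket_bra:
  assumes "x' < b" "y' < b"
  shows "ket_bra a x y \<otimes>\<^sub>k ket_bra b x' y' = ket_bra (a * b) (x * b + x') (y * b + y')"
proof (rule eq_matI)
  have iff: "i = x * b + x' \<longleftrightarrow> i div b = x \<and> i mod b = x'" if "x' < b" for i x x'
  proof
    show "i div b = x \<and> i mod b = x' \<Longrightarrow> i = x * b + x'" by (metis div_mult_mod_eq)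
  qed (use that in auto)
  fix i j assume "i < dim_row (ket_bra (a * b) (x * b + x') (y * b + y'))"
    "j < dim_col (ket_bra (a * b) (x * b + x') (y * b + y'))"
  then have ij: "i < a * b" "j < a * b" by (auto simp: ket_bra_def)
  then show "(ket_bra a x y \<otimes>\<^sub>k ket_bra b x' y') $$ (i, j) = ket_bra (a * b) (x * b + x') (y * b + y') $$ (i, j)"
    using div_mod_less_mult [OF ij(1)] div_mod_less_mult [OF ij(2)]
    by (simp add: ket_bra_def kron_index iff [OF assms(1)] iff [OF assms(2)])
qed (auto simp: ket_bra_def)

lemma kron_pow_ket_bra: "kron_pow (ket_bra 2 1 0) m = ket_bra (2 ^ m) (2 ^ m - 1) 0"
proof (induction m)
  case 0
  show ?case by (intro eq_matI) (auto simp: ket_bra_def)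
next
  case (Suc m)
  have "kron_pow (ket_bra 2 1 0) (Suc m) = ket_bra (2 * 2 ^ m) (1 * 2 ^ m + (2 ^ m - 1)) (0 * 2 ^ m + 0)"
    unfolding kron_pow.simps Suc by (rule kron_ket_bra) auto
  also have "(1 * 2 ^ m + (2 ^ m - 1) :: nat) = 2 ^ Suc m - 1"
    using one_le_power [of "2::nat" m] by simp
  finally show ?case by simp
qed

text \<open>In binary this is |01...1><10...0| on \<open>j\<close> qubits: subtracting one when the
  last \<open>j\<close> bits are 10...0, with the borrow running through the trailing zeros.\<close>

definition low_ket_bra :: "nat \<Rightarrow> complex mat" where
  "low_ket_bra j = ket_bra (2 ^ j) (2 ^ (j - 1) - 1) (2 ^ (j - 1))"

lemma s_minus_eq:
  assumes "1 \<le> j"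
  shows "s_minus n j = 1\<^sub>m (2 ^ (n - j)) \<otimes>\<^sub>k low_ket_bra j"
proof -
  have "ket_bra 2 0 1 \<otimes>\<^sub>k ket_bra (2 ^ (j - 1)) (2 ^ (j - 1) - 1) 0
      = ket_bra (2 * 2 ^ (j - 1)) (0 * 2 ^ (j - 1) + (2 ^ (j - 1) - 1)) (1 * 2 ^ (j - 1) + 0)"
    by (rule kron_ket_bra) auto
  also have "(2::nat) * 2 ^ (j - 1) = 2 ^ j"
    using assms by (simp flip: power_Suc)
  finally show ?thesis by (simp only: s_minus_def idq_eq kron_pow_ket_bra low_ket_bra_def mult_0 mult_1 add_0 add_0_right)
qed

lemma low_ket_bra_carrier [simp]: "low_ket_bra j \<in> carrier_mat (2 ^ j) (2 ^ j)"
  by (simp add: low_ket_bra_def ket_bra_def)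

lemma s_minus_carrier:
  assumes "1 \<le> j" "j \<le> n"
  shows "s_minus n j \<in> carrier_mat (2 ^ n) (2 ^ n)"
proof -
  have "(2::nat) ^ (n - j) * 2 ^ j = 2 ^ n" using assms by (simp flip: power_add)
  then show ?thesis
    using kron_carrier [OF one_carrier_mat [of "2 ^ (n - j)"] low_ket_bra_carrier [of j]] assms
    by (simp add: s_minus_eq)
qed

text \<open>The operator sends k to k - 1 exactly when the last \<open>j\<close> bits of k are
  10...0, that is, when k has 2-adic valuation \<open>j - 1\<close>. Each edge of the path 0, 1,
  ..., 2^n - 1 is therefore served by exactly one \<open>j\<close>.\<close>

lemma s_minus_index:
  assumes j: "1 \<le> j" "j \<le> n" and ik: "i < 2 ^ n" "k < 2 ^ n"
  shows "s_minus n j $$ (i, k) = (if k = Suc i \<and> k mod 2 ^ j = 2 ^ (j - 1) then 1 else 0)"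
proof -
  define b where "b = (2::nat) ^ j"
  define x where "x = (2::nat) ^ (j - 1)"
  have b: "b = 2 * x" "0 < x" using j by (auto simp: b_def x_def simp flip: power_Suc)
  have dim: "(2::nat) ^ (n - j) * b = 2 ^ n" using j by (simp add: b_def flip: power_add)
  have less: "i < 2 ^ (n - j) * b" "k < 2 ^ (n - j) * b" using ik dim by simp_all
  \<comment> \<open>Since \<open>x\<close> is the middle of a block of length \<open>b\<close>, the
    step from \<open>x - 1\<close> to \<open>x\<close> stays inside the block, so the right-hand
    side already forces equal quotients.\<close>
  have iff: "(i div b = k div b \<and> i mod b = x - 1 \<and> k mod b = x) = (k = Suc i \<and> k mod b = x)"
  proof
    assume *: "i div b = k div b \<and> i mod b = x - 1 \<and> k mod b = x"
    have "i = k div b * b + (x - 1)" "k = k div b * b + x"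
      using * by (metis div_mult_mod_eq)+
    then show "k = Suc i \<and> k mod b = x" using * b by linarith
  next
    assume *: "k = Suc i \<and> k mod b = x"
    then have "k = k div b * b + x" by (metis div_mult_mod_eq)
    then have i: "i = k div b * b + (x - 1)" using * b by linarith
    have "x - 1 < b" using b by simp
    then have "i div b = k div b" "i mod b = x - 1"
      by (subst i, simp)+
    then show "i div b = k div b \<and> i mod b = x - 1 \<and> k mod b = x" using * by blast
  qed
  have "s_minus n j $$ (i, k) = (if i div b = k div b \<and> i mod b = x - 1 \<and> k mod b = x then 1 else 0)"
    unfolding s_minus_eq [OF j(1)] low_ket_bra_def b_def [symmetric] x_def [symmetric]
    using less div_mod_less_mult [OF less(1)] div_mod_less_mult [OF less(2)]
    by (simp add: kron_index ket_bra_def)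
  then show ?thesis unfolding iff by (simp add: b_def x_def)
qed

definition hop :: "nat \<Rightarrow> nat \<Rightarrow> real \<Rightarrow> complex mat" where
  "hop n j \<phi> = exp (\<i> * of_real \<phi>) \<cdot>\<^sub>m s_minus n j + exp (- \<i> * of_real \<phi>) \<cdot>\<^sub>m s_plus n j"

lemma s_plus_carrier: "1 \<le> j \<Longrightarrow> j \<le> n \<Longrightarrow> s_plus n j \<in> carrier_mat (2 ^ n) (2 ^ n)"
  by (simp add: s_plus_def s_minus_carrier)

lemma hop_carrier: "1 \<le> j \<Longrightarrow> j \<le> n \<Longrightarrow> hop n j \<phi> \<in> carrier_mat (2 ^ n) (2 ^ n)"
  by (simp add: hop_def s_minus_carrier s_plus_carrier)

lemma s_plus_index:
  assumes "1 \<le> j" "j \<le> n" "i < 2 ^ n" "k < 2 ^ n"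
  shows "s_plus n j $$ (i, k) = (if i = Suc k \<and> i mod 2 ^ j = 2 ^ (j - 1) then 1 else 0)"
  using assms s_minus_index [of j n k i] carrier_matD [OF s_minus_carrier [of j n]]
  by (simp add: s_plus_def)

lemma hop_index:
  assumes "1 \<le> j" "j \<le> n" "i < 2 ^ n" "k < 2 ^ n"
  shows "hop n j \<phi> $$ (i, k) =
    exp (\<i> * of_real \<phi>) * (if k = Suc i \<and> k mod 2 ^ j = 2 ^ (j - 1) then 1 else 0) +
    exp (- \<i> * of_real \<phi>) * (if i = Suc k \<and> i mod 2 ^ j = 2 ^ (j - 1) then 1 else 0)"
  using assms carrier_matD [OF s_minus_carrier [of j n]] carrier_matD [OF s_plus_carrier [of j n]]
  by (simp add: hop_def s_minus_index s_plus_index)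

lemma cnj_exp_i: "cnj (exp (\<i> * of_real \<phi>)) = exp (- (\<i> * of_real \<phi>))"
  "cnj (exp (- (\<i> * of_real \<phi>))) = exp (\<i> * of_real \<phi>)"
proof -
  have "cnj (cis t) = cis (- t)" for t by (simp add: cis_cnj)
  from this [of \<phi>] this [of "- \<phi>"] show "cnj (exp (\<i> * of_real \<phi>)) = exp (- (\<i> * of_real \<phi>))"
    "cnj (exp (- (\<i> * of_real \<phi>))) = exp (\<i> * of_real \<phi>)"
    unfolding cis_conv_exp by simp_all
qed

lemma hop_hermitian:
  assumes "1 \<le> j" "j \<le> n"
  shows "mat_adjoint (hop n j \<phi>) = hop n j \<phi>"
proof -
  have "mat_adjoint (hop n j \<phi>) = exp (- \<i> * of_real \<phi>) \<cdot>\<^sub>m s_plus n j + exp (\<i> * of_real \<phi>) \<cdot>\<^sub>m s_minus n j"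
    unfolding hop_def using assms
    by (subst mat_adjoint_add [of _ "2 ^ n" "2 ^ n"])
      (auto simp: s_minus_carrier s_plus_carrier mat_adjoint_smult cnj_exp_i s_plus_def)
  also have "\<dots> = hop n j \<phi>"
    unfolding hop_def using assms
    by (intro comm_add_mat [of _ "2 ^ n" "2 ^ n"]) (auto simp: s_minus_carrier s_plus_carrier)
  finally show ?thesis .
qed

text \<open>Indices below \<open>b\<close> have left digit zero, so the upper left block of the
  product is the matrix itself. This is the uniqueness behind the definite description in
  \<open>W_gate\<close>.\<close>

lemma kron_one_left_inject:
  assumes "0 < a" "W \<in> carrier_mat b b" "W' \<in> carrier_mat b b" "1\<^sub>m a \<otimes>\<^sub>k W = 1\<^sub>m a \<otimes>\<^sub>k W'"
  shows "W = W'"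
proof (rule eq_matI)
  fix i j assume "i < dim_row W'" "j < dim_col W'"
  then have ij: "i < b" "j < b" using assms by auto
  have less: "i < a * b" "j < a * b"
    using ij \<open>0 < a\<close> mult_add_less_mult [of 0 a _ b] by auto
  have "W $$ (i, j) = (1\<^sub>m a \<otimes>\<^sub>k W) $$ (i, j)"
    using ij less assms(1,2) by (simp add: kron_index)
  also have "\<dots> = W' $$ (i, j)"
    unfolding assms(4) using ij less assms(1,3) by (simp add: kron_index)
  finally show "W $$ (i, j) = W' $$ (i, j)" .
qed (use assms in auto)

text \<open>The described gate is exhibited as the exponential of \<open>w\<close>, the same
  combination formed on \<open>j\<close> qubits only. Exponentiation commutes with padding by
  identities, and padding is injective.\<close>

lemma W_gate_eq:
  assumes j: "1 \<le> j" "j \<le> n"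
  shows "idq (n - j) \<otimes>\<^sub>k W_gate n j \<theta> \<phi> = mat_exp ((\<i> * of_real \<theta>) \<cdot>\<^sub>m hop n j \<phi>)"
proof -
  let ?L = "low_ket_bra j"
  define w where "w = exp (\<i> * of_real \<phi>) \<cdot>\<^sub>m ?L + exp (- \<i> * of_real \<phi>) \<cdot>\<^sub>m mat_adjoint ?L"
  have w: "w \<in> carrier_mat (2 ^ j) (2 ^ j)" by (simp add: w_def)
  have w_adj: "mat_adjoint w = w"
  proof -
    have "mat_adjoint w = exp (- \<i> * of_real \<phi>) \<cdot>\<^sub>m mat_adjoint ?L + exp (\<i> * of_real \<phi>) \<cdot>\<^sub>m ?L"
      unfolding w_def
      by (subst mat_adjoint_add [of _ "2 ^ j" "2 ^ j"]) (auto simp: mat_adjoint_smult cnj_exp_i)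
    also have "\<dots> = w" unfolding w_def by (intro comm_add_mat [of _ "2 ^ j" "2 ^ j"]) auto
    finally show ?thesis .
  qed
  let ?a = "2 ^ (n - j)"
  have emb: "embed_mat ?a 1 G = 1\<^sub>m ?a \<otimes>\<^sub>k G" for G
    by (simp only: embed_mat_def kron_one_1)
  have dim: "(2::nat) ^ (n - j) * 2 ^ j = 2 ^ n" using j by (simp flip: power_add)
  have hop: "1\<^sub>m ?a \<otimes>\<^sub>k w = hop n j \<phi>"
  proof (rule eq_matI)
    fix i k assume "i < dim_row (hop n j \<phi>)" "k < dim_col (hop n j \<phi>)"
    then have ik: "i < 2 ^ (n - j) * 2 ^ j" "k < 2 ^ (n - j) * 2 ^ j"
      using carrier_matD [OF hop_carrier [OF j, of \<phi>]] dim by auto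
    note less = div_mod_less_mult [OF ik(1)] div_mod_less_mult [OF ik(2)]
    have d: "dim_row ?L = 2 ^ j" "dim_col ?L = 2 ^ j" "dim_row w = 2 ^ j" "dim_col w = 2 ^ j"
      using carrier_matD [OF low_ket_bra_carrier] carrier_matD [OF w] by auto
    show "(1\<^sub>m ?a \<otimes>\<^sub>k w) $$ (i, k) = hop n j \<phi> $$ (i, k)"
      using ik less j d
      by (simp add: hop_def s_plus_def s_minus_eq kron_index) (auto simp: w_def d kron_index)
  qed (use carrier_matD [OF hop_carrier [OF j, of \<phi>]] carrier_matD [OF w] dim in auto)
  define W where "W = mat_exp ((\<i> * of_real \<theta>) \<cdot>\<^sub>m w)"
  have W: "W \<in> carrier_mat (2 ^ j) (2 ^ j)" using w by (simp add: W_def)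
  have uW: "unitary_mat W"
    unfolding W_def using w by (intro unitary_mat_exp [of _ "2 ^ j"] skew_mat_i_hermitian w_adj) auto
  have "mat_exp ((\<i> * of_real \<theta>) \<cdot>\<^sub>m hop n j \<phi>) = mat_exp (embed_mat ?a 1 ((\<i> * of_real \<theta>) \<cdot>\<^sub>m w))"
    using embed_mat_smult [OF w, of "\<i> * of_real \<theta>" ?a 1] by (simp only: emb hop)
  also have "\<dots> = idq (n - j) \<otimes>\<^sub>k W"
    using w by (subst embed_mat_exp [of _ "2 ^ j"]) (simp, simp only: emb W_def idq_eq)
  finally have eq: "idq (n - j) \<otimes>\<^sub>k W = mat_exp ((\<i> * of_real \<theta>) \<cdot>\<^sub>m hop n j \<phi>)" ..
  show ?thesis
    unfolding W_gate_def hop_def [symmetric]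
  proof (rule theI2 [where a = W])
    show "W \<in> carrier_mat (2 ^ j) (2 ^ j) \<and> unitary_mat W \<and>
        idq (n - j) \<otimes>\<^sub>k W = mat_exp ((\<i> * of_real \<theta>) \<cdot>\<^sub>m hop n j \<phi>)"
      using W uW eq by simp
    fix W' assume "W' \<in> carrier_mat (2 ^ j) (2 ^ j) \<and> unitary_mat W' \<and>
        idq (n - j) \<otimes>\<^sub>k W' = mat_exp ((\<i> * of_real \<theta>) \<cdot>\<^sub>m hop n j \<phi>)"
    then show "W' = W"
      using kron_one_left_inject [of ?a W' "2 ^ j" W] W eq by (simp add: idq_eq)
  qed simp
qed

section \<open>Two-adic valuations and matchings of the path\<close>

lemma mod_power_2_eq_half_iff:
  "(k::nat) mod 2 ^ Suc m = 2 ^ m \<longleftrightarrow> 2 ^ m dvd k \<and> \<not> 2 ^ Suc m dvd k"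
proof -
  have eq: "k mod 2 ^ Suc m = 2 ^ m * (k div 2 ^ m mod 2) + k mod 2 ^ m"
    by (simp add: mod_mult2_eq mult.commute [of 2])
  have r: "k mod 2 ^ m < 2 ^ m" by simp
  show ?thesis
  proof (cases "k div 2 ^ m mod 2 = 0")
    case True
    then have "k mod 2 ^ Suc m = k mod 2 ^ m" using eq by simp
    then show ?thesis using r by (metis dvd_eq_mod_eq_0 nat_neq_iff)
  next
    case False
    then have "k div 2 ^ m mod 2 = 1" by simp
    then have "k mod 2 ^ Suc m = 2 ^ m + k mod 2 ^ m" using eq by simp
    then show ?thesis by (simp add: dvd_eq_mod_eq_0)
  qed
qed

text \<open>The indicator of 2-adic valuation \<open>j - 1\<close> telescopes over \<open>j\<close>.\<close>

lemma sum_mod_power_2: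
  fixes a n k :: nat
  assumes "a \<le> n" "k < 2 ^ n"
  shows "(\<Sum>j\<in>{Suc a..n}. if k mod 2 ^ j = 2 ^ (j - 1) then 1 else 0 :: complex)
    = (if 2 ^ a dvd k \<and> 0 < k then 1 else 0)"
proof -
  define f where "f j = (if (2::nat) ^ j dvd k then 1 else 0 :: complex)" for j
  have "(\<Sum>j\<in>{Suc a..n}. if k mod 2 ^ j = 2 ^ (j - 1) then 1 else 0 :: complex)
      = (\<Sum>j\<in>{Suc a..n}. f (j - 1) - f j)"
  proof (intro sum.cong refl)
    fix j assume "j \<in> {Suc a..n}"
    then obtain m where "j = Suc m" by (cases j) auto
    then show "(if k mod 2 ^ j = 2 ^ (j - 1) then 1 else 0) = f (j - 1) - f j"
      using mod_power_2_eq_half_iff [of k m] dvd_trans [of "2 ^ m" "2 ^ Suc m" k] by (auto simp: f_def)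
  qed
  also have "\<dots> = f a - f n"
    using assms(1) by (induction rule: inc_induct) (simp_all add: sum.atLeast_Suc_atMost)
  \<comment> \<open>A positive number below \<open>2 ^ n\<close> is not divisible by
    \<open>2 ^ n\<close>, so the last term of the telescoping sum detects only zero.\<close>
  also have "f n = (if k = 0 then 1 else 0)"
    using assms(2) by (auto simp: f_def dest: nat_dvd_not_less)
  finally show ?thesis by (auto simp: f_def)
qed

text \<open>The edge between k - 1 and k is named by its upper end and is present when
  \<open>e k\<close>. The last hypothesis forbids two consecutive edges, so every vertex meets at
  most one, and all row and column sums of moduli are at most 1.\<close>

lemma op_bounded_matching:
  assumes M: "M \<in> carrier_mat N N"
    and le: "\<And>i k. i < N \<Longrightarrow> k < N \<Longrightarrow>
      cmod (M $$ (i, k)) \<le> (if k = Suc i \<and> e k then 1 else 0) + (if i = Suc k \<and> e i then 1 else 0)"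
    and e: "\<And>k. e k \<Longrightarrow> \<not> e (Suc k)"
  shows "op_bounded M 1"
proof -
  have *: "(\<Sum>k<N. (if k = Suc i \<and> e k then 1 else 0) + (if i = Suc k \<and> e i then 1 else 0)) \<le> (1::real)"
    for i
  proof -
    have "(\<Sum>k<N. if k = Suc i \<and> e k then 1 else 0) \<le> (if e (Suc i) then 1 else 0 :: real)"
      by (subst sum.cong [OF refl, where h = "\<lambda>k. if k = Suc i then if e (Suc i) then 1 else 0 else 0"]) auto
    \<comment> \<open>At \<open>i = 0\<close> the truncated \<open>i - 1\<close> would be a false
      neighbour, which the condition \<open>i \<noteq> 0\<close> removes.\<close>
    moreover have "(\<Sum>k<N. if i = Suc k \<and> e i then 1 else 0) \<le> (if e i then 1 else 0 :: real)"
      by (subst sum.cong [OF refl, where h = "\<lambda>k. if k = i - 1 then if e i \<and> i \<noteq> 0 then 1 else 0 else 0"]) auto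
    ultimately show ?thesis using e [of i] by (auto simp: sum.distrib split: if_splits)
  qed
  show ?thesis
  proof (rule op_bounded_row_col_sums [OF M])
    fix i assume "i < N"
    then have "(\<Sum>k<N. cmod (M $$ (i, k)))
        \<le> (\<Sum>k<N. (if k = Suc i \<and> e k then 1 else 0) + (if i = Suc k \<and> e i then 1 else 0))"
      by (intro sum_mono le) auto
    then show "(\<Sum>k<N. cmod (M $$ (i, k))) \<le> 1" using * [of i] by linarith
  next
    fix k assume "k < N"
    then have "(\<Sum>i<N. cmod (M $$ (i, k)))
        \<le> (\<Sum>i<N. (if i = Suc k \<and> e i then 1 else 0) + (if k = Suc i \<and> e k then 1 else 0))"
      by (intro sum_mono order_trans [OF le]) auto
    then show "(\<Sum>i<N. cmod (M $$ (i, k))) \<le> 1" using * [of k] by linarith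
  qed
qed

text \<open>The lower limit is kept general: \<open>a = 0\<close> describes the whole chain,
  \<open>a = 1\<close> what is left after removing the first term.\<close>

lemma mat_sum_hop_index:
  assumes "a \<le> n" "i < 2 ^ n" "k < 2 ^ n"
  shows "mat_sum (2 ^ n) (\<lambda>j. hop n j \<phi>) {Suc a..n} $$ (i, k) =
    exp (\<i> * of_real \<phi>) * (if k = Suc i \<and> 2 ^ a dvd k then 1 else 0) +
    exp (- \<i> * of_real \<phi>) * (if i = Suc k \<and> 2 ^ a dvd i then 1 else 0)"
proof -
  have "mat_sum (2 ^ n) (\<lambda>j. hop n j \<phi>) {Suc a..n} $$ (i, k) = (\<Sum>j\<in>{Suc a..n}.
      (exp (\<i> * of_real \<phi>) * (if k = Suc i then 1 else 0)) * (if k mod 2 ^ j = 2 ^ (j - 1) then 1 else 0) +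
      (exp (- \<i> * of_real \<phi>) * (if i = Suc k then 1 else 0)) * (if i mod 2 ^ j = 2 ^ (j - 1) then 1 else 0))"
    unfolding mat_sum_index [OF assms(2,3)] using assms by (intro sum.cong refl) (auto simp: hop_index)
  also have "\<dots> = (exp (\<i> * of_real \<phi>) * (if k = Suc i then 1 else 0)) * (if 2 ^ a dvd k \<and> 0 < k then 1 else 0) +
      (exp (- \<i> * of_real \<phi>) * (if i = Suc k then 1 else 0)) * (if 2 ^ a dvd i \<and> 0 < i then 1 else 0)"
    unfolding sum.distrib sum_distrib_left [symmetric] sum_mod_power_2 [OF assms(1,3)] sum_mod_power_2 [OF assms(1,2)] ..
  finally show ?thesis by auto
qed

text \<open>Together these terms carry the edges with even upper end, which form a matching.
  Bounding them jointly gives 1, whereas separate bounds would add up to n - 1.\<close>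

lemma op_bounded_mat_sum_hop:
  assumes "1 \<le> n"
  shows "op_bounded (mat_sum (2 ^ n) (\<lambda>j. hop n j \<phi>) {2..n}) 1"
proof (rule op_bounded_matching [of _ "2 ^ n" even])
  fix i k :: nat assume "i < 2 ^ n" "k < 2 ^ n"
  then show "cmod (mat_sum (2 ^ n) (\<lambda>j. hop n j \<phi>) {2..n} $$ (i, k))
      \<le> (if k = Suc i \<and> even k then 1 else 0) + (if i = Suc k \<and> even i then 1 else 0)"
    using mat_sum_hop_index [of 1 n i k \<phi>] assms
    by (auto simp: numeral_2_eq_2 norm_mult simp del: mat_sum_index)
qed auto

lemma op_bounded_hop_1:
  assumes "1 \<le> n"
  shows "op_bounded (hop n 1 \<phi>) 1"
proof (rule op_bounded_matching [of _ "2 ^ n" odd])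
  fix i k :: nat assume "i < 2 ^ n" "k < 2 ^ n"
  then show "cmod (hop n 1 \<phi> $$ (i, k)) \<le> (if k = Suc i \<and> odd k then 1 else 0) + (if i = Suc k \<and> odd i then 1 else 0)"
    using hop_index [of 1 n i k \<phi>] assms by (auto simp: mod2_eq_if split: if_splits)
qed (use assms in \<open>auto intro: hop_carrier\<close>)

text \<open>A nonzero entry needs a vertex \<open>m\<close> meeting an edge of each term. Both edges
  have upper end \<open>m\<close> or \<open>m + 1\<close>, and both upper ends are even since the
  indices are at least 2. They would be the same edge, with two different valuations.\<close>

lemma hop_mult_hop:
  assumes "2 \<le> j" "j \<le> n" "2 \<le> l" "l \<le> n" "j \<noteq> l"
  shows "hop n j \<phi> * hop n l \<phi> = 0\<^sub>m (2 ^ n) (2 ^ n)"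
proof (rule eq_matI)
  have excl: False if "x mod 2 ^ a = 2 ^ (a - 1)" "x mod 2 ^ b = 2 ^ (b - 1)" "a \<noteq> b" "1 \<le> a" "1 \<le> b"
    for x a b :: nat
  proof -
    have *: False if "x mod 2 ^ Suc a = 2 ^ a" "x mod 2 ^ Suc b = 2 ^ b" "a < b" for a b
    proof -
      have "2 ^ Suc a dvd (2::nat) ^ b" using that(3) by (intro le_imp_power_dvd) simp
      then show False using that(1,2) unfolding mod_power_2_eq_half_iff by (meson dvd_trans)
    qed
    obtain a' b' where "a = Suc a'" "b = Suc b'" using \<open>1 \<le> a\<close> \<open>1 \<le> b\<close> by (cases a; cases b) auto
    then show False using * [of a' b'] * [of b' a'] that(1-3) by (cases "a' < b'") auto
  qed
  have ev: "even x" if "x mod 2 ^ a = 2 ^ (a - 1)" "2 \<le> a" for x a :: nat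
  proof -
    obtain a' where a: "a = Suc (Suc a')" using \<open>2 \<le> a\<close> by (metis add_2_eq_Suc le_Suc_ex)
    have "2 ^ Suc a' dvd x" using that(1) mod_power_2_eq_half_iff [of x "Suc a'"] by (simp add: a)
    then show "even x" by (metis dvd_mult_left power_Suc)
  qed
  have touch: "(m mod 2 ^ a = 2 ^ (a - 1)) \<or> (Suc m mod 2 ^ a = 2 ^ (a - 1))"
    if "hop n a \<phi> $$ (i, m) \<noteq> 0 \<or> hop n a \<phi> $$ (m, i) \<noteq> 0" "1 \<le> a" "a \<le> n" "i < 2 ^ n" "m < 2 ^ n" for a i m
    using that by (auto simp: hop_index split: if_splits)
  fix i k assume "i < dim_row (0\<^sub>m (2 ^ n) (2 ^ n) :: complex mat)" "k < dim_col (0\<^sub>m (2 ^ n) (2 ^ n) :: complex mat)"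
  then have ik: "i < 2 ^ n" "k < 2 ^ n" by auto
  have c: "hop n j \<phi> \<in> carrier_mat (2 ^ n) (2 ^ n)" "hop n l \<phi> \<in> carrier_mat (2 ^ n) (2 ^ n)"
    using assms by (auto intro: hop_carrier)
  have zero: "hop n j \<phi> $$ (i, m) * hop n l \<phi> $$ (m, k) = 0" if m: "m < 2 ^ n" for m
  proof (rule ccontr)
    assume "hop n j \<phi> $$ (i, m) * hop n l \<phi> $$ (m, k) \<noteq> 0"
    then have "m mod 2 ^ j = 2 ^ (j - 1) \<or> Suc m mod 2 ^ j = 2 ^ (j - 1)"
      "m mod 2 ^ l = 2 ^ (l - 1) \<or> Suc m mod 2 ^ l = 2 ^ (l - 1)"
      using touch [of j i m] touch [of l k m] assms ik m by auto
    moreover have "even m \<noteq> even (Suc m)" by simp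
    ultimately show False
      using ev [of m j] ev [of "Suc m" j] ev [of m l] ev [of "Suc m" l] excl [of m j l] excl [of "Suc m" j l] assms
      by (metis One_nat_def Suc_1 Suc_leD)
  qed
  show "(hop n j \<phi> * hop n l \<phi>) $$ (i, k) = 0\<^sub>m (2 ^ n) (2 ^ n) $$ (i, k)"
    using c ik zero
    by (auto simp: mat_mult_index [of _ "2 ^ n" "2 ^ n" _ "2 ^ n"] simp del: index_mult_mat(1) intro!: sum.neutral)
qed (use assms hop_carrier [of j n \<phi>] hop_carrier [of l n \<phi>] in auto)

lemma smult_mat_sum:
  assumes "\<And>k. k \<in> S \<Longrightarrow> f k \<in> carrier_mat n n"
  shows "c \<cdot>\<^sub>m mat_sum n f S = mat_sum n (\<lambda>k. c \<cdot>\<^sub>m f k) S"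
  using carrier_matD [OF assms] by (intro eq_matI) (auto simp: sum_distrib_left intro!: sum.cong)

definition hop_chain :: "nat \<Rightarrow> real \<Rightarrow> complex mat" where
  "hop_chain n \<phi> = mat_sum (2 ^ n) (\<lambda>j. hop n j \<phi>) {1..n}"

lemma hop_chain_carrier [simp]: "hop_chain n \<phi> \<in> carrier_mat (2 ^ n) (2 ^ n)"
  by (simp add: hop_chain_def)

lemma mat_sum_hermitian:
  assumes "\<And>k. k \<in> S \<Longrightarrow> f k \<in> carrier_mat n n" "\<And>k. k \<in> S \<Longrightarrow> mat_adjoint (f k) = f k"
  shows "mat_adjoint (mat_sum n f S) = mat_sum n f S"
proof (rule eq_matI)
  fix i j assume "i < dim_row (mat_sum n f S)" "j < dim_col (mat_sum n f S)"
  then have ij: "i < n" "j < n" by auto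
  have "cnj (f k $$ (j, i)) = f k $$ (i, j)" if "k \<in> S" for k
    using arg_cong [OF assms(2) [OF that], of "\<lambda>M. M $$ (i, j)"] carrier_matD [OF assms(1) [OF that]] ij
    by simp
  then show "mat_adjoint (mat_sum n f S) $$ (i, j) = mat_sum n f S $$ (i, j)"
    using ij by simp
qed auto

lemma hop_chain_hermitian: "mat_adjoint (hop_chain n \<phi>) = hop_chain n \<phi>"
  unfolding hop_chain_def by (rule mat_sum_hermitian) (auto intro: hop_carrier hop_hermitian)

text \<open>For \<open>j, l \<ge> 2\<close> the terms have disjoint supports, so that only the commutator of the first
  term with the sum of the others contributes.\<close>

lemma hop_chain_trotter:
  assumes n: "1 \<le> n"
  shows "op_bounded (mat_exp ((\<i> * of_real \<theta>) \<cdot>\<^sub>m hop_chain n \<phi>)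
    - mat_prod (2 ^ n) (\<lambda>j. mat_exp ((\<i> * of_real \<theta>) \<cdot>\<^sub>m hop n j \<phi>)) [1..<Suc n]) (real n * \<theta>\<^sup>2 / 2)"
proof -
  let ?z = "\<i> * of_real \<theta>" and ?N = "2 ^ n" and ?h = "hop n 1 \<phi>"
  define R where "R = mat_sum ?N (\<lambda>j. hop n j \<phi>) {2..n}"
  note sq = mult_carrier_mat [where n = ?N] minus_carrier_mat
  have h: "?h \<in> carrier_mat ?N ?N" and R: "R \<in> carrier_mat ?N ?N"
    using n by (auto simp: R_def intro: hop_carrier)
  have "{1..n} = insert 1 {2..n}" using n by auto
  then have chain: "hop_chain n \<phi> = ?h + R"
    unfolding hop_chain_def R_def using h by (simp add: mat_sum_insert)
  have sk: "skew_mat (?z \<cdot>\<^sub>m ?h)" "skew_mat (?z \<cdot>\<^sub>m R)"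
    using n by (auto intro!: skew_mat_i_hermitian hop_hermitian mat_sum_hermitian hop_carrier simp: R_def)
  have "op_bounded (?h * R - R * ?h) (real n)"
  proof (cases "n = 1")
    case True
    then have "R = 0\<^sub>m ?N ?N" by (simp add: R_def)
    then have "?h * R - R * ?h = 0\<^sub>m ?N ?N"
      using h by (simp add: right_mult_zero_mat left_mult_zero_mat)
    then show ?thesis using op_bounded_mono [OF op_bounded_zero] by simp
  next
    case False
    have "op_bounded (?h * R - R * ?h) (1 * 1 + 1 * 1)"
      using h R n op_bounded_hop_1 [OF n] op_bounded_mat_sum_hop [OF n]
      by (intro op_bounded_diff [of _ ?N ?N] op_bounded_mult [of _ ?N ?N _ ?N] sq) (auto simp: R_def)
    then show ?thesis by (rule op_bounded_mono) (use n False in auto)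
  qed
  then have "op_bounded ((?z * ?z) \<cdot>\<^sub>m (?h * R - R * ?h)) (cmod (?z * ?z) * real n)"
    by (rule op_bounded_smult)
  also have "cmod (?z * ?z) * real n = real n * \<theta>\<^sup>2"
    by (simp add: norm_mult power2_eq_square)
  also have "(?z * ?z) \<cdot>\<^sub>m (?h * R - R * ?h) = (?z \<cdot>\<^sub>m ?h) * (?z \<cdot>\<^sub>m R) - (?z \<cdot>\<^sub>m R) * (?z \<cdot>\<^sub>m ?h)"
    using h R
    by (intro eq_matI)
      (auto simp: mult_smult_distrib [of _ ?N ?N _ ?N] mult_smult_assoc_mat [of _ ?N ?N _ ?N] algebra_simps
        simp del: index_mult_mat(1))
  finally have "op_bounded (mat_exp (?z \<cdot>\<^sub>m ?h + ?z \<cdot>\<^sub>m R) - mat_exp (?z \<cdot>\<^sub>m ?h) * mat_exp (?z \<cdot>\<^sub>m R))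
      (real n * \<theta>\<^sup>2 / 2)"
    using h R sk by (intro trotter_bound [of _ ?N]) auto
  also have "?z \<cdot>\<^sub>m ?h + ?z \<cdot>\<^sub>m R = ?z \<cdot>\<^sub>m hop_chain n \<phi>"
    unfolding chain by (rule add_smult_distrib_left_mat [OF h R, symmetric])
  also have "mat_exp (?z \<cdot>\<^sub>m R) = mat_prod ?N (\<lambda>j. mat_exp (?z \<cdot>\<^sub>m hop n j \<phi>)) [2..<Suc n]"
  proof -
    have set: "set [2..<Suc n] = {2..n}" by auto
    have "?z \<cdot>\<^sub>m R = mat_sum ?N (\<lambda>j. ?z \<cdot>\<^sub>m hop n j \<phi>) (set [2..<Suc n])"
      unfolding R_def set by (rule smult_mat_sum) (auto intro: hop_carrier)
    moreover have "(?z \<cdot>\<^sub>m hop n j \<phi>) * (?z \<cdot>\<^sub>m hop n l \<phi>) = 0\<^sub>m ?N ?N"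
      if "2 \<le> j" "j \<le> n" "2 \<le> l" "l \<le> n" "j \<noteq> l" for j l
      using that hop_mult_hop [OF that] hop_carrier [of j n \<phi>] hop_carrier [of l n \<phi>]
      by (simp add: mult_smult_distrib [of _ ?N ?N _ ?N] mult_smult_assoc_mat [of _ ?N ?N _ ?N])
    ultimately show ?thesis
      by (simp only:) (rule mat_exp_mat_sum,
        auto intro!: skew_mat_i_hermitian hop_hermitian simp: hop_carrier simp del: upt_Suc)
  qed
  also have "mat_exp (?z \<cdot>\<^sub>m ?h) * \<dots> = mat_prod ?N (\<lambda>j. mat_exp (?z \<cdot>\<^sub>m hop n j \<phi>)) [1..<Suc n]"
    using n by (subst (2) upt_conv_Cons) (auto simp: numeral_2_eq_2)
  finally show ?thesis .
qed

section \<open>Gates and one-register Hamiltonians as exponentials\<close>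

lemma hop_exp:
  assumes "1 \<le> j" "j \<le> n"
  shows "mat_exp ((\<i> * of_real \<theta>) \<cdot>\<^sub>m hop n j \<phi>) \<in> carrier_mat (2 ^ n) (2 ^ n)"
    "unitary_mat (mat_exp ((\<i> * of_real \<theta>) \<cdot>\<^sub>m hop n j \<phi>))"
  using carrier_matD [OF hop_carrier [OF assms, of \<phi>]] hop_carrier [OF assms, of \<phi>]
  by (auto intro!: unitary_mat_exp [of _ "2 ^ n"] skew_mat_i_hermitian hop_hermitian assms)

lemma unitary_hop_prod:
  "unitary_mat (mat_prod (2 ^ n) (\<lambda>j. mat_exp ((\<i> * of_real \<theta>) \<cdot>\<^sub>m hop n j \<phi>)) [1..<Suc n])"
  by (rule unitary_mat_prod) (use hop_exp in auto)

lemma hop_prod_carrier: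
  "mat_prod (2 ^ n) (\<lambda>j. mat_exp ((\<i> * of_real \<theta>) \<cdot>\<^sub>m hop n j \<phi>)) [1..<Suc n] \<in> carrier_mat (2 ^ n) (2 ^ n)"
  by (rule mat_prod_carrier) (use hop_exp in auto)

lemma gate_prod_eq:
  "mat_prod (2 ^ n) (\<lambda>j. idq (n - j) \<otimes>\<^sub>k W_gate n j \<theta> \<phi>) [1..<Suc n]
    = mat_prod (2 ^ n) (\<lambda>j. mat_exp ((\<i> * of_real \<theta>) \<cdot>\<^sub>m hop n j \<phi>)) [1..<Suc n]"
  by (rule mat_prod_cong) (auto intro!: W_gate_eq)

lemma hop_0: "1 \<le> j \<Longrightarrow> j \<le> n \<Longrightarrow> hop n j 0 = s_minus n j + s_plus n j"
  by (simp add: hop_def)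

lemma H1_eq: "H1 n \<gamma> = of_real \<gamma> \<cdot>\<^sub>m (hop_chain n 0 - 2 \<cdot>\<^sub>m 1\<^sub>m (2 ^ n))"
proof -
  have "mat_sum (2 ^ n) (\<lambda>j. s_minus n j + s_plus n j) {1..n} = hop_chain n 0"
    unfolding hop_chain_def by (rule mat_sum_cong) (simp add: hop_0)
  then show ?thesis by (simp add: H1_def idq_eq)
qed

text \<open>At the phase -pi/2 of the gates in \<open>V2\<close>, the hopping term becomes -i times
  \<open>s_minus\<close> minus \<open>s_plus\<close>, which is the form of
  \<open>H2\<close>.\<close>

lemma exp_i_half_pi: "exp (\<i> * of_real (- pi / 2)) = - \<i>" "exp (- \<i> * of_real (- pi / 2)) = \<i>"
proof -
  have "cis (- (pi / 2)) = - \<i>" "cis (pi / 2) = \<i>"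
    by (simp_all add: cis.ctr complex_eq_iff)
  then show "exp (\<i> * of_real (- pi / 2)) = - \<i>" "exp (- \<i> * of_real (- pi / 2)) = \<i>"
    unfolding cis_conv_exp by simp_all
qed

lemma H2_eq: "H2 n \<gamma> = of_real \<gamma> \<cdot>\<^sub>m hop_chain n (- pi / 2)"
proof -
  have hop: "hop n j (- pi / 2) = (- \<i>) \<cdot>\<^sub>m (s_minus n j - s_plus n j)" if "j \<in> {1..n}" for j
  proof -
    have "s_minus n j \<in> carrier_mat (2 ^ n) (2 ^ n)" "s_plus n j \<in> carrier_mat (2 ^ n) (2 ^ n)"
      using that by (auto intro: s_minus_carrier s_plus_carrier)
    then show ?thesis
      unfolding hop_def exp_i_half_pi by (intro eq_matI) (auto simp: algebra_simps)
  qed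
  have "hop_chain n (- pi / 2) = mat_sum (2 ^ n) (\<lambda>j. (- \<i>) \<cdot>\<^sub>m (s_minus n j - s_plus n j)) {1..n}"
    unfolding hop_chain_def by (rule mat_sum_cong) (rule hop)
  also have "\<dots> = (- \<i>) \<cdot>\<^sub>m mat_sum (2 ^ n) (\<lambda>j. s_minus n j - s_plus n j) {1..n}"
    by (rule smult_mat_sum [symmetric]) (auto intro!: minus_carrier_mat s_plus_carrier)
  finally show ?thesis by (simp add: H2_def smult_smult_mat mult.commute)
qed

lemma H1_carrier [simp]: "H1 n \<gamma> \<in> carrier_mat (2 ^ n) (2 ^ n)"
  by (simp add: H1_eq minus_carrier_mat)

lemma H2_carrier [simp]: "H2 n \<gamma> \<in> carrier_mat (2 ^ n) (2 ^ n)"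
  by (simp add: H2_eq)

lemma H2_hermitian: "mat_adjoint (H2 n \<gamma>) = H2 n \<gamma>"
  by (simp add: H2_eq mat_adjoint_smult hop_chain_hermitian)

lemma H1_hermitian: "mat_adjoint (H1 n \<gamma>) = H1 n \<gamma>"
proof -
  have "mat_adjoint (hop_chain n 0 - 2 \<cdot>\<^sub>m 1\<^sub>m (2 ^ n)) = mat_adjoint (hop_chain n 0) - 2 \<cdot>\<^sub>m 1\<^sub>m (2 ^ n)"
    by (intro eq_matI) (auto simp: carrier_matD [OF hop_chain_carrier])
  then show ?thesis by (simp add: H1_eq mat_adjoint_smult hop_chain_hermitian)
qed

lemma V2_approx:
  assumes "1 \<le> n"
  shows "op_bounded (mat_exp ((\<i> * of_real \<tau>) \<cdot>\<^sub>m H2 n \<gamma>) - V2 n \<gamma> \<tau>) (real n * (\<gamma> * \<tau>)\<^sup>2 / 2)"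
    and "unitary_mat (V2 n \<gamma> \<tau>)" and "V2 n \<gamma> \<tau> \<in> carrier_mat (2 ^ n) (2 ^ n)"
proof -
  have eq: "(\<i> * of_real \<tau>) \<cdot>\<^sub>m H2 n \<gamma> = (\<i> * of_real (\<gamma> * \<tau>)) \<cdot>\<^sub>m hop_chain n (- pi / 2)"
    by (simp add: H2_eq smult_smult_mat algebra_simps)
  show "op_bounded (mat_exp ((\<i> * of_real \<tau>) \<cdot>\<^sub>m H2 n \<gamma>) - V2 n \<gamma> \<tau>) (real n * (\<gamma> * \<tau>)\<^sup>2 / 2)"
    unfolding V2_def gate_prod_eq eq by (rule hop_chain_trotter [OF assms])
  show "unitary_mat (V2 n \<gamma> \<tau>)" "V2 n \<gamma> \<tau> \<in> carrier_mat (2 ^ n) (2 ^ n)"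
    unfolding V2_def gate_prod_eq by (rule unitary_hop_prod hop_prod_carrier)+
qed

text \<open>The term -2I of \<open>H1\<close> is a multiple of the identity; it separates exactly
  and gives the prefactor of \<open>V1\<close>, of modulus 1. The error is that of the hopping
  part.\<close>

lemma V1_approx:
  assumes "1 \<le> n"
  shows "op_bounded (mat_exp ((\<i> * of_real \<tau>) \<cdot>\<^sub>m H1 n \<gamma>) - V1 n \<gamma> \<tau>) (real n * (\<gamma> * \<tau>)\<^sup>2 / 2)"
    and "unitary_mat (V1 n \<gamma> \<tau>)" and "V1 n \<gamma> \<tau> \<in> carrier_mat (2 ^ n) (2 ^ n)"
proof -
  let ?N = "(2::nat) ^ n" and ?\<theta> = "\<gamma> * \<tau>"
  define c where "c = exp (- 2 * \<i> * complex_of_real ?\<theta>)"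
  define E where "E = mat_exp ((\<i> * of_real ?\<theta>) \<cdot>\<^sub>m hop_chain n 0)"
  define W where "W = mat_prod ?N (\<lambda>j. mat_exp ((\<i> * of_real ?\<theta>) \<cdot>\<^sub>m hop n j 0)) [1..<Suc n]"
  have E: "E \<in> carrier_mat ?N ?N" and W: "W \<in> carrier_mat ?N ?N"
    unfolding E_def W_def by (simp add: carrier_matD [OF hop_chain_carrier], rule hop_prod_carrier)
  have c1: "cmod c = 1"
    by (simp add: c_def)
  have V1: "V1 n \<gamma> \<tau> = c \<cdot>\<^sub>m W"
    unfolding V1_def gate_prod_eq c_def W_def ..
  show "unitary_mat (V1 n \<gamma> \<tau>)" "V1 n \<gamma> \<tau> \<in> carrier_mat ?N ?N"
    unfolding V1 using W c1 unitary_hop_prod [of n ?\<theta> 0] by (auto intro!: unitary_mat_smult simp: W_def)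
  have split: "(\<i> * of_real \<tau>) \<cdot>\<^sub>m H1 n \<gamma>
      = (\<i> * of_real ?\<theta>) \<cdot>\<^sub>m hop_chain n 0 + (\<i> * of_real (- 2 * ?\<theta>)) \<cdot>\<^sub>m 1\<^sub>m ?N"
    unfolding H1_eq by (intro eq_matI) (auto simp: algebra_simps carrier_matD [OF hop_chain_carrier])
  have "mat_exp ((\<i> * of_real \<tau>) \<cdot>\<^sub>m H1 n \<gamma>) = E * mat_exp ((\<i> * of_real (- 2 * ?\<theta>)) \<cdot>\<^sub>m 1\<^sub>m ?N)"
    unfolding split E_def
    by (intro mat_exp_add_commuting [of _ ?N] skew_mat_i_hermitian hop_chain_hermitian)
      (auto simp: mult_smult_distrib [of _ ?N ?N _ ?N] mult_smult_assoc_mat [of _ ?N ?N _ ?N]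
        right_mult_one_mat [of _ ?N ?N] left_mult_one_mat [of _ ?N ?N])
  also have "\<dots> = c \<cdot>\<^sub>m E"
    using E unfolding mat_exp_smult_one
    by (simp add: mult_smult_distrib [of _ ?N ?N _ ?N] right_mult_one_mat [of _ ?N ?N] c_def algebra_simps)
  also have "c \<cdot>\<^sub>m E - V1 n \<gamma> \<tau> = c \<cdot>\<^sub>m (E - W)"
    unfolding V1 using E W by (intro eq_matI) (auto simp: algebra_simps)
  finally have eq: "mat_exp ((\<i> * of_real \<tau>) \<cdot>\<^sub>m H1 n \<gamma>) - V1 n \<gamma> \<tau> = c \<cdot>\<^sub>m (E - W)" .
  show "op_bounded (mat_exp ((\<i> * of_real \<tau>) \<cdot>\<^sub>m H1 n \<gamma>) - V1 n \<gamma> \<tau>) (real n * ?\<theta>\<^sup>2 / 2)"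
    unfolding eq using op_bounded_smult [OF hop_chain_trotter [OF assms, of ?\<theta> 0], of c] c1
    by (simp add: E_def W_def)
qed

text \<open>With the shift \<open>S\<close> and its transpose \<open>T\<close> the two chains are
  -i(S - T) and S + T, so the commutator is -2i(ST - TS). A step forth and back fails only at an end
  of the path, whence ST - TS is diagonal and supported on the end points.\<close>

lemma hop_chain_commutator:
  "op_bounded (hop_chain n (- pi / 2) * hop_chain n 0 - hop_chain n 0 * hop_chain n (- pi / 2)) 2"
proof -
  let ?N = "(2::nat) ^ n"
  define S T where "S = mat ?N ?N (\<lambda>(i, k). if k = Suc i then 1 else 0 :: complex)"
    and "T = mat ?N ?N (\<lambda>(i, k). if i = Suc k then 1 else 0 :: complex)"
  have ST [simp]: "S \<in> carrier_mat ?N ?N" "T \<in> carrier_mat ?N ?N" by (simp_all add: S_def T_def)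
  have chain: "hop_chain n \<phi> = exp (\<i> * of_real \<phi>) \<cdot>\<^sub>m S + exp (- \<i> * of_real \<phi>) \<cdot>\<^sub>m T" for \<phi>
    using mat_sum_hop_index [of 0 n _ _ \<phi>]
    by (intro eq_matI) (auto simp: hop_chain_def S_def T_def simp del: mat_sum_index)
  have chain0: "hop_chain n 0 = S + T" by (simp add: chain)
  have chain2: "hop_chain n (- pi / 2) = (- \<i>) \<cdot>\<^sub>m S + \<i> \<cdot>\<^sub>m T"
    unfolding chain exp_i_half_pi ..
  note sq = add_carrier_mat mult_carrier_mat [where n = ?N]
  have eq: "hop_chain n (- pi / 2) * hop_chain n 0 - hop_chain n 0 * hop_chain n (- pi / 2)
      = (- 2 * \<i>) \<cdot>\<^sub>m (S * T - T * S)"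
  proof -
    have "hop_chain n (- pi / 2) * hop_chain n 0 = (- \<i>) \<cdot>\<^sub>m (S * S) + \<i> \<cdot>\<^sub>m (T * S) + ((- \<i>) \<cdot>\<^sub>m (S * T) + \<i> \<cdot>\<^sub>m (T * T))"
      unfolding chain0 chain2
      by (simp add: add_mult_distrib_mat [of _ ?N ?N _ _ ?N] mult_add_distrib_mat [of _ ?N ?N _ ?N] sq
          mult_smult_assoc_mat [of _ ?N ?N _ ?N] del: assoc_add_mat)
    moreover have "hop_chain n 0 * hop_chain n (- pi / 2) = (- \<i>) \<cdot>\<^sub>m (S * S) + (- \<i>) \<cdot>\<^sub>m (T * S) + (\<i> \<cdot>\<^sub>m (S * T) + \<i> \<cdot>\<^sub>m (T * T))"
      unfolding chain0 chain2
      by (simp add: add_mult_distrib_mat [of _ ?N ?N _ _ ?N] mult_add_distrib_mat [of _ ?N ?N _ ?N] sq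
          mult_smult_distrib [of _ ?N ?N _ ?N] add_smult_distrib_left_mat [of _ ?N ?N] del: assoc_add_mat)
    ultimately show ?thesis
      by (simp only:) (intro eq_matI, auto simp: carrier_matD [OF ST(1)] carrier_matD [OF ST(2)] algebra_simps
          simp del: index_mult_mat(1))
  qed
  have ST_index: "(S * T - T * S) $$ (i, k) =
      (if k = i then (if Suc i < ?N then 1 else 0) - (if i = 0 then 0 else 1) else 0)"
    if ik: "i < ?N" "k < ?N" for i k
  proof -
    \<comment> \<open>From row \<open>i\<close>, \<open>S\<close> leads to \<open>i + 1\<close> and
      \<open>T\<close> to \<open>i - 1\<close>; each sum has at most one nonzero term, absent when
      that neighbour falls off the path.\<close>
    have "(S * T) $$ (i, k) = (\<Sum>m<?N. if m = Suc i then (if k = i then 1 else 0) else 0)"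
      unfolding mat_mult_index [OF ST ik] using ik by (intro sum.cong refl) (auto simp: S_def T_def)
    moreover have "(T * S) $$ (i, k) = (\<Sum>m<?N. if m = i - 1 then (if i = 0 \<or> k \<noteq> i then 0 else 1) else 0)"
      unfolding mat_mult_index [OF ST(2,1) ik] using ik by (intro sum.cong refl) (auto simp: S_def T_def)
    ultimately show ?thesis
      using ik carrier_matD [OF ST(1)] carrier_matD [OF ST(2)]
      by (auto simp del: index_mult_mat(1))
  qed
  have "op_bounded (S * T - T * S) 1"
  proof (rule op_bounded_row_col_sums [of _ ?N])
    have *: "(\<Sum>k<2 ^ n. if k = i then d else 0) \<le> 1" if "d \<le> 1" for d :: real and i :: nat
      using that by simp
    fix i :: nat assume i: "i < ?N"
    have "(\<Sum>k<?N. cmod ((S * T - T * S) $$ (i, k)))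
        = (\<Sum>k<?N. if k = i then cmod ((if Suc i < ?N then 1 else 0) - (if i = 0 then 0 else 1)) else 0)"
      using i by (intro sum.cong) (simp_all add: ST_index del: index_mult_mat(1) index_minus_mat(1))
    also have "\<dots> \<le> 1" by (rule *) auto
    finally show "(\<Sum>k<?N. cmod ((S * T - T * S) $$ (i, k))) \<le> 1" .
    have "(\<Sum>k<?N. cmod ((S * T - T * S) $$ (k, i)))
        = (\<Sum>k<?N. if k = i then cmod ((if Suc i < ?N then 1 else 0) - (if i = 0 then 0 else 1)) else 0)"
      using i by (intro sum.cong) (auto simp add: ST_index simp del: index_mult_mat(1) index_minus_mat(1))
    also have "\<dots> \<le> 1" by (rule *) auto
    finally show "(\<Sum>k<?N. cmod ((S * T - T * S) $$ (k, i))) \<le> 1" .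
  qed (simp add: minus_carrier_mat sq)
  from op_bounded_smult [OF this, of "- 2 * \<i>"] show ?thesis
    unfolding eq by (simp add: norm_mult)
qed

text \<open>The identity part of \<open>H1\<close> commutes with \<open>H2\<close> and drops out,
  leaving the commutator of the chains scaled by both coefficients.\<close>

lemma H2_H1_commutator:
  assumes "0 \<le> \<gamma>1" "0 \<le> \<gamma>2"
  shows "op_bounded (H2 n \<gamma>2 * H1 n \<gamma>1 - H1 n \<gamma>1 * H2 n \<gamma>2) (2 * \<gamma>1 * \<gamma>2)"
proof -
  let ?N = "(2::nat) ^ n" and ?A = "hop_chain n (- pi / 2)" and ?B = "hop_chain n 0"
  note sq = add_carrier_mat mult_carrier_mat [where n = ?N] minus_carrier_mat
  have A: "?A \<in> carrier_mat ?N ?N" and B: "?B \<in> carrier_mat ?N ?N" by auto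
  have smult_diff: "c \<cdot>\<^sub>m (X - Z) - c \<cdot>\<^sub>m (Y - Z) = c \<cdot>\<^sub>m (X - Y)"
    if "X \<in> carrier_mat ?N ?N" "Y \<in> carrier_mat ?N ?N" "Z \<in> carrier_mat ?N ?N" for c :: complex and X Y Z
    using that by (intro eq_matI) (auto simp: algebra_simps)
  have "?A * (?B - 2 \<cdot>\<^sub>m 1\<^sub>m ?N) = ?A * ?B - 2 \<cdot>\<^sub>m ?A"
    using A B by (simp add: mult_minus_distrib_mat [of _ ?N ?N _ ?N] mult_smult_distrib [of _ ?N ?N _ ?N]
        right_mult_one_mat [of _ ?N ?N])
  moreover have "(?B - 2 \<cdot>\<^sub>m 1\<^sub>m ?N) * ?A = ?B * ?A - 2 \<cdot>\<^sub>m ?A"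
    using A B by (simp add: minus_mult_distrib_mat [of _ ?N ?N _ _ ?N] mult_smult_assoc_mat [of _ ?N ?N _ ?N]
        left_mult_one_mat [of _ ?N ?N])
  ultimately have "H2 n \<gamma>2 * H1 n \<gamma>1 - H1 n \<gamma>1 * H2 n \<gamma>2
      = of_real (\<gamma>1 * \<gamma>2) \<cdot>\<^sub>m (?A * ?B - 2 \<cdot>\<^sub>m ?A) - of_real (\<gamma>1 * \<gamma>2) \<cdot>\<^sub>m (?B * ?A - 2 \<cdot>\<^sub>m ?A)"
    unfolding H1_eq H2_eq
    by (simp add: mult_smult_distrib [of _ ?N ?N _ ?N] mult_smult_assoc_mat [of _ ?N ?N _ ?N] sq smult_smult_mat
        mult.commute)
  also have "\<dots> = of_real (\<gamma>1 * \<gamma>2) \<cdot>\<^sub>m (?A * ?B - ?B * ?A)"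
    by (rule smult_diff) (use A B in \<open>auto intro: sq\<close>)
  finally show ?thesis
    using op_bounded_smult [OF hop_chain_commutator, of "of_real (\<gamma>1 * \<gamma>2)" n] assms
    by (simp add: norm_mult algebra_simps)
qed

section \<open>Registers and the auxiliary variable\<close>

text \<open>The coefficient \<open>a m\<close> is absorbed into the evolution time of register
  \<open>m\<close>. As the copies of \<open>H\<close> commute, the exponential factors exactly over
  the registers, and only the one-register errors remain.\<close>

lemma registers_exp_approx:
  assumes H: "H \<in> carrier_mat (2 ^ n) (2 ^ n)" "mat_adjoint H = H"
    and V: "\<And>m. m \<in> {1..d} \<Longrightarrow> V m \<in> carrier_mat (2 ^ n) (2 ^ n)" "\<And>m. m \<in> {1..d} \<Longrightarrow> unitary_mat (V m)"
    and e: "\<And>m. m \<in> {1..d} \<Longrightarrow> op_bounded (mat_exp ((\<i> * of_real (a m * \<tau>)) \<cdot>\<^sub>m H) - V m) (e m)"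
      "\<And>m. m \<in> {1..d} \<Longrightarrow> 0 \<le> e m"
  shows "op_bounded (mat_exp ((\<i> * of_real \<tau>) \<cdot>\<^sub>m
        mat_sum (2 ^ (d * n)) (\<lambda>m. of_real (a m) \<cdot>\<^sub>m on_register d n H m) {1..d})
      - mat_prod (2 ^ (d * n)) (\<lambda>m. on_register d n (V m) m) [1..<Suc d]) (\<Sum>m\<in>{1..d}. e m)"
proof -
  let ?D = "(2::nat) ^ (d * n)" and ?N = "(2::nat) ^ n"
  define E where "E m = mat_exp ((\<i> * of_real (a m * \<tau>)) \<cdot>\<^sub>m H)" for m
  have set: "set [1..<Suc d] = {1..d}" by auto
  have E: "E m \<in> carrier_mat ?N ?N" "unitary_mat (E m)" for m
    unfolding E_def using H(1)
    by (simp, intro unitary_mat_exp [of _ ?N] skew_mat_i_hermitian [OF H(2)]) simp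
  have onH: "on_register d n H m \<in> carrier_mat ?D ?D" if "m \<in> {1..d}" for m
    using on_register_carrier [OF that H(1)] .
  have zH: "z \<cdot>\<^sub>m H \<in> carrier_mat ?N ?N" for z using H(1) by simp
  have "(\<i> * of_real \<tau>) \<cdot>\<^sub>m mat_sum ?D (\<lambda>m. of_real (a m) \<cdot>\<^sub>m on_register d n H m) {1..d}
      = mat_sum ?D (\<lambda>m. (\<i> * of_real \<tau>) \<cdot>\<^sub>m (of_real (a m) \<cdot>\<^sub>m on_register d n H m)) {1..d}"
    using onH by (intro smult_mat_sum) auto
  also have "\<dots> = mat_sum ?D (\<lambda>m. on_register d n ((\<i> * of_real (a m * \<tau>)) \<cdot>\<^sub>m H) m) (set [1..<Suc d])"
    unfolding set
    by (rule mat_sum_cong)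
      (simp add: smult_smult_mat on_register_smult [OF H(1)] on_register_smult [OF zH] algebra_simps)
  finally have "mat_exp ((\<i> * of_real \<tau>) \<cdot>\<^sub>m mat_sum ?D (\<lambda>m. of_real (a m) \<cdot>\<^sub>m on_register d n H m) {1..d})
      = mat_exp (mat_sum ?D (\<lambda>m. on_register d n ((\<i> * of_real (a m * \<tau>)) \<cdot>\<^sub>m H) m) (set [1..<Suc d]))"
    by simp
  also have "\<dots> = mat_prod ?D (\<lambda>m. mat_exp (on_register d n ((\<i> * of_real (a m * \<tau>)) \<cdot>\<^sub>m H) m)) [1..<Suc d]"
  proof (rule mat_exp_mat_sum)
    fix m assume "m \<in> set [1..<Suc d]"
    then have m: "m \<in> {1..d}" by auto
    show "on_register d n ((\<i> * of_real (a m * \<tau>)) \<cdot>\<^sub>m H) m \<in> carrier_mat ?D ?D"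
      by (rule on_register_carrier [OF m zH])
    have "skew_mat ((\<i> * of_real (a m * \<tau>)) \<cdot>\<^sub>m on_register d n H m)"
      using on_register_adjoint [OF H(1)] H(2) by (intro skew_mat_i_hermitian) simp
    then show "skew_mat (on_register d n ((\<i> * of_real (a m * \<tau>)) \<cdot>\<^sub>m H) m)"
      by (simp only: on_register_smult [OF H(1)])
  next
    fix m l assume "m \<in> set [1..<Suc d]" "l \<in> set [1..<Suc d]" "m \<noteq> l"
    then show "on_register d n ((\<i> * of_real (a m * \<tau>)) \<cdot>\<^sub>m H) m * on_register d n ((\<i> * of_real (a l * \<tau>)) \<cdot>\<^sub>m H) l
        = on_register d n ((\<i> * of_real (a l * \<tau>)) \<cdot>\<^sub>m H) l * on_register d n ((\<i> * of_real (a m * \<tau>)) \<cdot>\<^sub>m H) m"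
      by (intro on_register_commute zH) auto
  qed simp
  also have "\<dots> = mat_prod ?D (\<lambda>m. on_register d n (E m) m) [1..<Suc d]"
    unfolding E_def by (rule mat_prod_cong) (auto intro!: on_register_exp zH)
  finally have eq: "mat_exp ((\<i> * of_real \<tau>) \<cdot>\<^sub>m mat_sum ?D (\<lambda>m. of_real (a m) \<cdot>\<^sub>m on_register d n H m) {1..d})
      = mat_prod ?D (\<lambda>m. on_register d n (E m) m) [1..<Suc d]" .
  have "op_bounded (mat_prod ?D (\<lambda>m. on_register d n (E m) m) [1..<Suc d]
      - mat_prod ?D (\<lambda>m. on_register d n (V m) m) [1..<Suc d]) (\<Sum>m\<leftarrow>[1..<Suc d]. e m)"
  proof (rule mat_prod_diff_bound)
    fix m assume "m \<in> set [1..<Suc d]"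
    then have m: "m \<in> {1..d}" by auto
    note Vm = V(1) [OF m]
    show "on_register d n (E m) m \<in> carrier_mat ?D ?D" "on_register d n (V m) m \<in> carrier_mat ?D ?D"
      by (rule on_register_carrier [OF m] E(1) Vm)+
    show "unitary_mat (on_register d n (E m) m)" "unitary_mat (on_register d n (V m) m)"
      by (rule unitary_on_register [OF E] unitary_on_register [OF Vm V(2) [OF m]])+
    show "op_bounded (on_register d n (E m) m - on_register d n (V m) m) (e m)"
      unfolding on_register_diff [OF E(1) Vm]
      using e [OF m] E(1) Vm by (intro op_bounded_on_register) (auto simp: E_def minus_carrier_mat)
  qed
  also have "(\<Sum>m\<leftarrow>[1..<Suc d]. e m) = (\<Sum>m\<in>{1..d}. e m)"
    by (subst sum_list_distinct_conv_sum_set) (simp_all only: distinct_upt set)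
  finally show ?thesis unfolding eq .
qed

text \<open>The mixed terms cancel, so the double sum of commutators collapses to its diagonal: the
  bound is a sum over registers, not over pairs of them.\<close>

lemma op_bounded_commutator_mat_sum:
  assumes "finite S" and f: "\<And>k. k \<in> S \<Longrightarrow> f k \<in> carrier_mat n n" and g: "\<And>k. k \<in> S \<Longrightarrow> g k \<in> carrier_mat n n"
    and comm: "\<And>k l. k \<in> S \<Longrightarrow> l \<in> S \<Longrightarrow> k \<noteq> l \<Longrightarrow> f k * g l = g l * f k"
    and e: "\<And>k. k \<in> S \<Longrightarrow> op_bounded (f k * g k - g k * f k) (e k)"
  shows "op_bounded (mat_sum n f S * mat_sum n g S - mat_sum n g S * mat_sum n f S) (\<Sum>k\<in>S. e k)"
  using assms
proof (induction S)
  case empty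
  have "0\<^sub>m n n * 0\<^sub>m n n - 0\<^sub>m n n * 0\<^sub>m n n = (0\<^sub>m n n :: complex mat)"
    by (intro eq_matI) auto
  then show ?case by (simp only: mat_sum_empty sum.empty op_bounded_zero)
next
  case (insert k S)
  let ?F = "mat_sum n f S" and ?G = "mat_sum n g S"
  note sq = add_carrier_mat mult_carrier_mat [where n = n] minus_carrier_mat
  have c: "f k \<in> carrier_mat n n" "g k \<in> carrier_mat n n" "?F \<in> carrier_mat n n" "?G \<in> carrier_mat n n"
    using insert.prems by auto
  have 1: "f k * ?G = ?G * f k"
    using insert by (intro mat_sum_commute) auto
  have 2: "g k * ?F = ?F * g k"
    using insert by (intro mat_sum_commute) (auto, metis)
  have "mat_sum n f (insert k S) * mat_sum n g (insert k S) - mat_sum n g (insert k S) * mat_sum n f (insert k S)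
      = (f k * g k + ?F * g k + (f k * ?G + ?F * ?G)) - (g k * f k + ?G * f k + (g k * ?F + ?G * ?F))"
    using c insert.hyps
    by (simp add: mat_sum_insert add_mult_distrib_mat [of _ n n _ _ n] mult_add_distrib_mat [of _ n n _ n] sq
        del: assoc_add_mat)
  also have "\<dots> = (f k * g k - g k * f k) + (?F * ?G - ?G * ?F)"
    unfolding 1 2 using c by (intro eq_matI) (auto simp del: index_mult_mat(1))
  finally have eq: "mat_sum n f (insert k S) * mat_sum n g (insert k S) - mat_sum n g (insert k S) * mat_sum n f (insert k S)
      = (f k * g k - g k * f k) + (?F * ?G - ?G * ?F)" .
  have "op_bounded (?F * ?G - ?G * ?F) (\<Sum>k\<in>S. e k)"
    using insert by blast
  then show ?case
    unfolding eq sum.insert [OF insert.hyps] using c insert.prems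
    by (intro op_bounded_add [of _ n n] sq) auto
qed

text \<open>The auxiliary variable is the last tensor factor. Its value is the low digit
  \<open>i mod P\<close>, which labels the blocks; the position inside a block is the high
  digit.\<close>

lemma block_index_mod: "block_index (N * P) N (\<lambda>i. i mod P) (\<lambda>i. i div P) {..<P}"
proof
  show "bij_betw (\<lambda>i. (i mod P, i div P)) {..<N * P} ({..<P} \<times> {..<N})"
    by (rule bij_betw_byWitness [where f' = "\<lambda>(x, y). y * P + x"])
      (auto simp: div_mod_less_mult mult_add_less_mult)
qed simp

context
  fixes N P :: nat
begin

interpretation block_index "N * P" N "\<lambda>i. i mod P" "\<lambda>i. i div P" "{..<P}"
  by (rule block_index_mod)

text \<open>Free coefficients and matrices cover two uses: the Hamiltonian, with constant
  \<open>X\<close>, and the integer powers of \<open>V\<close>, with all coefficients 1.\<close>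

lemma mat_sum_kron_ket_bra:
  assumes X: "\<And>k. k < P \<Longrightarrow> X k \<in> carrier_mat N N"
  shows "mat_sum (N * P) (\<lambda>k. c k \<cdot>\<^sub>m (X k \<otimes>\<^sub>k ket_bra P k k)) {0..<P} = block_mat (\<lambda>k. c k \<cdot>\<^sub>m X k)"
proof (rule eq_matI)
  fix i j assume "i < dim_row (block_mat (\<lambda>k. c k \<cdot>\<^sub>m X k))" "j < dim_col (block_mat (\<lambda>k. c k \<cdot>\<^sub>m X k))"
  then have i: "i < N * P" and j: "j < N * P" by auto
  note less = div_mod_less_mult [OF i] div_mod_less_mult [OF j]
  have "mat_sum (N * P) (\<lambda>k. c k \<cdot>\<^sub>m (X k \<otimes>\<^sub>k ket_bra P k k)) {0..<P} $$ (i, j)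
      = (\<Sum>k\<in>{0..<P}. if k = i mod P then (if i mod P = j mod P then c k * X k $$ (i div P, j div P) else 0) else 0)"
    unfolding mat_sum_index [OF i j]
  proof (intro sum.cong refl)
    fix k assume "k \<in> {0..<P}"
    then have k: "k < P" by simp
    have "dim_row (ket_bra P k k) = P" "dim_col (ket_bra P k k) = P" by (simp_all add: ket_bra_def)
    then show "(c k \<cdot>\<^sub>m (X k \<otimes>\<^sub>k ket_bra P k k)) $$ (i, j)
        = (if k = i mod P then (if i mod P = j mod P then c k * X k $$ (i div P, j div P) else 0) else 0)"
      using i j less carrier_matD [OF X [OF k]] by (auto simp: kron_index ket_bra_def)
  qed
  also have "\<dots> = block_mat (\<lambda>k. c k \<cdot>\<^sub>m X k) $$ (i, j)"
    using i j less carrier_matD [OF X [OF less(5)]] by (simp add: block_mat_index)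
  finally show "mat_sum (N * P) (\<lambda>k. c k \<cdot>\<^sub>m (X k \<otimes>\<^sub>k ket_bra P k k)) {0..<P} $$ (i, j)
      = block_mat (\<lambda>k. c k \<cdot>\<^sub>m X k) $$ (i, j)" .
qed auto

lemma kron_one_block_mat:
  assumes "X \<in> carrier_mat N N"
  shows "X \<otimes>\<^sub>k 1\<^sub>m P = block_mat (\<lambda>_. X)"
proof (rule eq_matI)
  fix i j assume "i < dim_row (block_mat (\<lambda>_. X))" "j < dim_col (block_mat (\<lambda>_. X))"
  then have i: "i < N * P" and j: "j < N * P" by auto
  then show "(X \<otimes>\<^sub>k 1\<^sub>m P) $$ (i, j) = block_mat (\<lambda>_. X) $$ (i, j)"
    using assms div_mod_less_mult [OF i] div_mod_less_mult [OF j] by (simp add: kron_index block_mat_index)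
qed (use assms in auto)

lemma mat_sum_kron_one:
  assumes f: "\<And>m. m \<in> S \<Longrightarrow> f m \<in> carrier_mat N N"
  shows "mat_sum (N * P) (\<lambda>m. c m \<cdot>\<^sub>m (f m \<otimes>\<^sub>k 1\<^sub>m P)) S = block_mat (\<lambda>_. mat_sum N (\<lambda>m. c m \<cdot>\<^sub>m f m) S)"
proof (rule eq_matI)
  fix i j assume "i < dim_row (block_mat (\<lambda>_. mat_sum N (\<lambda>m. c m \<cdot>\<^sub>m f m) S))"
    "j < dim_col (block_mat (\<lambda>_. mat_sum N (\<lambda>m. c m \<cdot>\<^sub>m f m) S))"
  then have ij: "i < N * P" "j < N * P" by auto
  note less = div_mod_less_mult [OF ij(1)] div_mod_less_mult [OF ij(2)]
  have "mat_sum (N * P) (\<lambda>m. c m \<cdot>\<^sub>m (f m \<otimes>\<^sub>k 1\<^sub>m P)) S $$ (i, j)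
      = (\<Sum>m\<in>S. if i mod P = j mod P then (c m \<cdot>\<^sub>m f m) $$ (i div P, j div P) else 0)"
    unfolding mat_sum_index [OF ij] using ij less carrier_matD [OF f]
    by (intro sum.cong refl) (simp add: kron_index)
  then show "mat_sum (N * P) (\<lambda>m. c m \<cdot>\<^sub>m (f m \<otimes>\<^sub>k 1\<^sub>m P)) S $$ (i, j)
      = block_mat (\<lambda>_. mat_sum N (\<lambda>m. c m \<cdot>\<^sub>m f m) S) $$ (i, j)"
    using ij less by (simp add: block_mat_index)
qed auto

text \<open>The evolution and its splitting are block diagonal in the auxiliary variable, so that the
  operator norm of the error is the largest error on a block.\<close>

lemma block_trotter_bound:
  assumes A: "A \<in> carrier_mat N N" "mat_adjoint A = A" and Q: "Q \<in> carrier_mat N N" "mat_adjoint Q = Q"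
    and V: "V \<in> carrier_mat N N" "unitary_mat V" and W: "W \<in> carrier_mat N N" "unitary_mat W"
    and eV: "op_bounded (mat_exp ((\<i> * of_real \<tau>) \<cdot>\<^sub>m A) - V) e\<^sub>V"
    and eW: "op_bounded (mat_exp ((\<i> * of_real \<tau>) \<cdot>\<^sub>m Q) - W) e\<^sub>W"
    and C: "op_bounded (Q * A - A * Q) C" "0 \<le> C" and "0 \<le> e\<^sub>V" "0 \<le> e\<^sub>W"
    and z: "\<And>k. k < P \<Longrightarrow> \<bar>of_int (z k)\<bar> \<le> K" "0 \<le> K"
  shows "unitary_mat ((W \<otimes>\<^sub>k 1\<^sub>m P) * mat_sum (N * P) (\<lambda>k. mat_powi V (z k) \<otimes>\<^sub>k ket_bra P k k) {0..<P})"
    and "op_bounded (mat_exp ((\<i> * of_real \<tau>) \<cdot>\<^sub>m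
          (mat_sum (N * P) (\<lambda>k. of_int (z k) \<cdot>\<^sub>m (A \<otimes>\<^sub>k ket_bra P k k)) {0..<P} + Q \<otimes>\<^sub>k 1\<^sub>m P))
        - (W \<otimes>\<^sub>k 1\<^sub>m P) * mat_sum (N * P) (\<lambda>k. mat_powi V (z k) \<otimes>\<^sub>k ket_bra P k k) {0..<P})
      (\<tau>\<^sup>2 * K * C / 2 + e\<^sub>W + K * e\<^sub>V)"
proof -
  note sq = add_carrier_mat mult_carrier_mat [where n = N] minus_carrier_mat
  define Vp where "Vp k = mat_powi V (z k)" for k
  have Vp: "Vp k \<in> carrier_mat N N" "unitary_mat (Vp k)" for k
    unfolding Vp_def by (rule unitary_mat_powi [OF V(2,1)])+
  have sumV: "mat_sum (N * P) (\<lambda>k. mat_powi V (z k) \<otimes>\<^sub>k ket_bra P k k) {0..<P} = block_mat Vp"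
    using mat_sum_kron_ket_bra [of Vp "\<lambda>_. 1"] Vp by (simp add: Vp_def [abs_def])
  have VBS: "(W \<otimes>\<^sub>k 1\<^sub>m P) * mat_sum (N * P) (\<lambda>k. mat_powi V (z k) \<otimes>\<^sub>k ket_bra P k k) {0..<P}
      = block_mat (\<lambda>k. W * Vp k)"
    unfolding sumV kron_one_block_mat [OF W(1)] using W Vp by (intro block_mat_mult) auto
  have WV: "W * Vp k \<in> carrier_mat N N" "unitary_mat (W * Vp k)" for k
    using W Vp by (auto intro!: sq unitary_mat_mult [of _ N])
  show "unitary_mat ((W \<otimes>\<^sub>k 1\<^sub>m P) * mat_sum (N * P) (\<lambda>k. mat_powi V (z k) \<otimes>\<^sub>k ket_bra P k k) {0..<P})"
    unfolding VBS using WV by (intro unitary_block_mat) auto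
  let ?A = "(\<i> * of_real \<tau>) \<cdot>\<^sub>m A" and ?Q = "(\<i> * of_real \<tau>) \<cdot>\<^sub>m Q"
  have skew: "skew_mat ?A" "skew_mat ?Q" "?A \<in> carrier_mat N N" "?Q \<in> carrier_mat N N"
    using A Q by (auto intro: skew_mat_i_hermitian)
  define E where "E k = mat_exp (?Q + of_int (z k) \<cdot>\<^sub>m ?A)" for k
  have E: "E k \<in> carrier_mat N N" for k using A Q by (simp add: E_def)
  have zA: "of_int (z k) \<cdot>\<^sub>m A \<in> carrier_mat N N" for k using A by simp
  have "mat_exp ((\<i> * of_real \<tau>) \<cdot>\<^sub>m
      (mat_sum (N * P) (\<lambda>k. of_int (z k) \<cdot>\<^sub>m (A \<otimes>\<^sub>k ket_bra P k k)) {0..<P} + Q \<otimes>\<^sub>k 1\<^sub>m P))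
      = mat_exp ((\<i> * of_real \<tau>) \<cdot>\<^sub>m block_mat (\<lambda>k. of_int (z k) \<cdot>\<^sub>m A + Q))"
    using A Q by (simp add: mat_sum_kron_ket_bra kron_one_block_mat block_mat_add)
  also have "\<dots> = block_mat (\<lambda>k. mat_exp ((\<i> * of_real \<tau>) \<cdot>\<^sub>m (of_int (z k) \<cdot>\<^sub>m A + Q)))"
    using A Q by (simp add: block_mat_smult block_mat_exp)
  also have "\<dots> = block_mat E"
  proof (rule block_mat_cong)
    fix k
    \<comment> \<open>The summands are exchanged so that the split exponentials come in the order of
      \<open>W\<close> and the power of \<open>V\<close>.\<close>
    have "(\<i> * of_real \<tau>) \<cdot>\<^sub>m (of_int (z k) \<cdot>\<^sub>m A + Q) = ?Q + of_int (z k) \<cdot>\<^sub>m ?A"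
      using A Q by (intro eq_matI) (auto simp: algebra_simps)
    then show "mat_exp ((\<i> * of_real \<tau>) \<cdot>\<^sub>m (of_int (z k) \<cdot>\<^sub>m A + Q)) = E k" by (simp add: E_def)
  qed
  finally have UBS: "mat_exp ((\<i> * of_real \<tau>) \<cdot>\<^sub>m
      (mat_sum (N * P) (\<lambda>k. of_int (z k) \<cdot>\<^sub>m (A \<otimes>\<^sub>k ket_bra P k k)) {0..<P} + Q \<otimes>\<^sub>k 1\<^sub>m P)) = block_mat E" .
  have "op_bounded (E k - W * Vp k) (\<tau>\<^sup>2 * K * C / 2 + e\<^sub>W + K * e\<^sub>V)" if k: "k < P" for k
  proof -
    have zk: "\<bar>of_int (z k)\<bar> \<le> K" by (rule z(1) [OF k])
    let ?zA = "of_int (z k) \<cdot>\<^sub>m ?A"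
    have skz: "skew_mat ?zA" "?zA \<in> carrier_mat N N"
      using skew_mat_of_real [OF skew(1), of "of_int (z k)"] skew(3) by simp_all
    \<comment> \<open>Both exponents bring a factor i \<tau>, and one of them also the integer
      \<open>z k\<close>.\<close>
    have comm: "?Q * ?zA - ?zA * ?Q = (- (of_real \<tau>)\<^sup>2 * of_int (z k)) \<cdot>\<^sub>m (Q * A - A * Q)"
      using A Q by (intro eq_matI)
        (auto simp: mult_smult_distrib [of _ N N _ N] mult_smult_assoc_mat [of _ N N _ N] algebra_simps
          power2_eq_square simp del: index_mult_mat(1))
    have le: "cmod (- (of_real \<tau>)\<^sup>2 * of_int (z k)) * C \<le> \<tau>\<^sup>2 * K * C"
    proof -
      have "cmod (- (of_real \<tau>)\<^sup>2 * of_int (z k)) = \<tau>\<^sup>2 * \<bar>of_int (z k)\<bar>"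
        by (simp add: norm_mult norm_power)
      then show ?thesis using zk C(2) by (simp add: mult_left_mono mult_right_mono)
    qed
    have "op_bounded (?Q * ?zA - ?zA * ?Q) (\<tau>\<^sup>2 * K * C)"
      unfolding comm by (rule op_bounded_mono [OF op_bounded_smult [OF C(1)] le])
    then have 1: "op_bounded (E k - mat_exp ?Q * mat_exp ?zA) (\<tau>\<^sup>2 * K * C / 2)"
      unfolding E_def using skew skz C(2) z(2) by (intro trotter_bound [of _ N]) auto
    \<comment> \<open>The exact factor is itself an integer power of one exponential, so the power
      of \<open>V\<close> deviates from it by at most |z k| single errors.\<close>
    have "op_bounded (mat_powi (mat_exp ?A) (z k) - Vp k) (\<bar>of_int (z k)\<bar> * e\<^sub>V)"
      unfolding Vp_def using skew V eV by (intro mat_powi_diff_bound [of _ N] unitary_mat_exp [of _ N]) auto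
    moreover have "\<bar>of_int (z k)\<bar> * e\<^sub>V \<le> K * e\<^sub>V"
      using zk \<open>0 \<le> e\<^sub>V\<close> by (rule mult_right_mono)
    ultimately have 2: "op_bounded (mat_exp ?zA - Vp k) (K * e\<^sub>V)"
      unfolding mat_exp_powi [OF skew(3,1)] by (rule op_bounded_mono)
    have "op_bounded (mat_exp ?Q * mat_exp ?zA - W * Vp k) (e\<^sub>W + K * e\<^sub>V)"
      using skew skz W Vp eW 2 by (intro op_bounded_mult_diff [of _ N] unitary_mat_exp [of _ N]) auto
    moreover have "mat_exp ?Q * mat_exp ?zA \<in> carrier_mat N N"
      using skew skz by (intro sq) auto
    ultimately have "op_bounded (E k - W * Vp k) (\<tau>\<^sup>2 * K * C / 2 + (e\<^sub>W + K * e\<^sub>V))"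
      using op_bounded_diff_trans [OF E _ WV(1) 1] by blast
    then show ?thesis by (simp add: add.assoc)
  qed
  then show "op_bounded (mat_exp ((\<i> * of_real \<tau>) \<cdot>\<^sub>m
          (mat_sum (N * P) (\<lambda>k. of_int (z k) \<cdot>\<^sub>m (A \<otimes>\<^sub>k ket_bra P k k)) {0..<P} + Q \<otimes>\<^sub>k 1\<^sub>m P))
        - (W \<otimes>\<^sub>k 1\<^sub>m P) * mat_sum (N * P) (\<lambda>k. mat_powi V (z k) \<otimes>\<^sub>k ket_bra P k k) {0..<P})
      (\<tau>\<^sup>2 * K * C / 2 + e\<^sub>W + K * e\<^sub>V)"
    unfolding UBS VBS block_mat_diff [OF E WV(1)]
    using assms(11-) by (intro op_bounded_block_mat) (auto intro: minus_carrier_mat WV)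
qed

end

theorem lemma5p4:
  fixes d nx np :: nat
    and r h Lp \<tau> \<gamma>1 \<gamma>2 :: real
    and \<sigma> c :: "nat \<Rightarrow> real"
    and \<rho> :: "nat \<Rightarrow> nat \<Rightarrow> real"
  assumes "d \<ge> 1" and "nx \<ge> 1" and "np \<ge> 1"
    and "r > 0" and "h > 0" and "Lp > 0" and "\<tau> > 0"
    and "\<And>m. m \<in> {1..d} \<Longrightarrow> \<sigma> m > 0"
    and "\<And>m n. m \<in> {1..d} \<Longrightarrow> n \<in> {1..d} \<Longrightarrow> \<rho> m n \<in> {-1..1}"
    and "\<And>m. m \<in> {1..d} \<Longrightarrow> \<rho> m m = 1"
    and "\<And>m n. m \<in> {1..d} \<Longrightarrow> n \<in> {1..d} \<Longrightarrow> m \<noteq> n \<Longrightarrow> \<rho> m n = 0"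
    and "\<gamma>1 = 1 / (h\<^sup>2 * Lp)" and "\<gamma>2 = 1 / (2 * h)"
    and "\<And>m. m \<in> {1..d} \<Longrightarrow> c m = max (r - (\<sigma> m)\<^sup>2 / 2) ((\<sigma> m)\<^sup>2 * \<rho> m m / 2)"
  shows "unitary_mat (V_BS d nx np \<gamma>1 \<gamma>2 r \<sigma> \<rho> \<tau>) \<and>
    op_norm (U_BS d nx np \<gamma>1 \<gamma>2 r \<sigma> \<rho> \<tau> - V_BS d nx np \<gamma>1 \<gamma>2 r \<sigma> \<rho> \<tau>)
      \<le> 1 / 4 * \<tau>\<^sup>2 * real nx *
         (real (2 ^ np) * \<gamma>1\<^sup>2 + 2 * \<gamma>2\<^sup>2 + 2 * real (2 ^ np) * \<gamma>1 * \<gamma>2) * (\<Sum>m = 1..d. (c m)\<^sup>2)"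
proof -
  let ?D = "(2::nat) ^ (d * nx)" and ?N = "(2::nat) ^ nx"
  define P where "P = (2::nat) ^ np"
  \<comment> \<open>The largest modulus of k - N_p/2, attained at k = 0; it limits the number of
    factors of \<open>V\<close> in a block.\<close>
  define K where "K = real P / 2"
  define a where "a m = (\<sigma> m)\<^sup>2 * \<rho> m m / 2" for m
  define b where "b m = r - (\<sigma> m)\<^sup>2 / 2" for m
  define z where "z k = int k - int (P div 2)" for k
  have \<gamma>: "0 \<le> \<gamma>1" "0 \<le> \<gamma>2" using assms(5,6,12,13) by simp_all
  \<comment> \<open>Although \<open>c m\<close> is a maximum of signed numbers, it dominates both
    moduli: \<open>\<rho> m m = 1\<close> makes \<open>a m\<close> nonnegative and
    \<open>b m\<close> equal to \<open>r - a m\<close>, which exceeds \<open>- a m\<close> as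
    \<open>r > 0\<close>.\<close>
  have ac: "\<bar>a m\<bar> \<le> c m" and bc: "\<bar>b m\<bar> \<le> c m" if "m \<in> {1..d}" for m
    using assms(4) assms(10) [OF that] assms(14) [OF that] by (auto simp: a_def b_def max_def abs_le_iff)
  \<comment> \<open>At least one auxiliary qubit makes \<open>P\<close> even, so the truncated
    division in the exponent of \<open>V_BS\<close> agrees with the real number P/2 in
    \<open>H_BS\<close>.\<close>
  have "even P" using assms(3) by (simp add: P_def)
  then have half: "real (P div 2) = real P / 2" by (simp add: real_of_nat_div)
  have zr: "of_int (z k) = real k - real P / 2" for k by (simp add: z_def half)
  have zc: "complex_of_real (real k - real P / 2) = of_int (z k)" for k by (simp flip: zr)
  have zK: "\<bar>of_int (z k)\<bar> \<le> K" if "k < P" for k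
    unfolding zr K_def by (rule abs_leI) (use that in simp_all)
  have K0: "0 \<le> K" by (simp add: K_def)

  define A where "A = mat_sum ?D (\<lambda>m. of_real (a m) \<cdot>\<^sub>m on_register d nx (H1 nx \<gamma>1) m) {1..d}"
  define Q where "Q = mat_sum ?D (\<lambda>m. of_real (b m) \<cdot>\<^sub>m on_register d nx (H2 nx \<gamma>2) m) {1..d}"
  define V where "V = V1_tilde d nx \<gamma>1 \<sigma> \<rho> \<tau>"
  define W where "W = V2_tilde d nx \<gamma>2 r \<sigma> \<tau>"
  \<comment> \<open>The total gate error over the registers, with angle \<theta> = \<gamma> f(m)
    \<tau> in n \<theta>^2 / 2.\<close>
  define e where "e \<gamma> f = (\<Sum>m\<in>{1..d}. real nx * (\<gamma> * (f m * \<tau>))\<^sup>2 / 2)" for \<gamma> f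
  have e0: "0 \<le> e \<gamma> f" for \<gamma> f by (auto simp: e_def intro!: sum_nonneg)
  have Vdef: "V = mat_prod ?D (\<lambda>m. on_register d nx (V1 nx \<gamma>1 (a m * \<tau>)) m) [1..<Suc d]"
    and Wdef: "W = mat_prod ?D (\<lambda>m. on_register d nx (V2 nx \<gamma>2 (b m * \<tau>)) m) [1..<Suc d]"
    by (simp_all only: V_def W_def V1_tilde_def V2_tilde_def a_def b_def)
  note V1 = V1_approx [OF assms(2)] and V2 = V2_approx [OF assms(2)]
  have on1: "on_register d nx (H1 nx \<gamma>1) m \<in> carrier_mat ?D ?D"
    and on2: "on_register d nx (H2 nx \<gamma>2) m \<in> carrier_mat ?D ?D" if "m \<in> {1..d}" for m
    by (rule on_register_carrier [OF that H1_carrier] on_register_carrier [OF that H2_carrier])+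
  have herm: "mat_adjoint A = A" "mat_adjoint Q = Q"
    unfolding A_def Q_def using on1 on2
    by (auto intro!: mat_sum_hermitian simp: mat_adjoint_smult on_register_adjoint H1_hermitian H2_hermitian)
  have carr: "A \<in> carrier_mat ?D ?D" "Q \<in> carrier_mat ?D ?D"
    by (simp_all add: A_def Q_def)
  have V: "V \<in> carrier_mat ?D ?D" "unitary_mat V" and W: "W \<in> carrier_mat ?D ?D" "unitary_mat W"
    unfolding Vdef Wdef using V1 V2
    by (auto intro!: mat_prod_carrier unitary_mat_prod on_register_carrier unitary_on_register simp del: upt_Suc)
  have eV: "op_bounded (mat_exp ((\<i> * of_real \<tau>) \<cdot>\<^sub>m A) - V) (e \<gamma>1 a)"
    unfolding A_def Vdef e_def using V1
    by (intro registers_exp_approx H1_carrier H1_hermitian) (auto simp del: of_real_mult)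
  have eW: "op_bounded (mat_exp ((\<i> * of_real \<tau>) \<cdot>\<^sub>m Q) - W) (e \<gamma>2 b)"
    unfolding Q_def Wdef e_def using V2
    by (intro registers_exp_approx H2_carrier H2_hermitian) (auto simp del: of_real_mult)
  define C where "C = (\<Sum>m\<in>{1..d}. \<bar>b m\<bar> * \<bar>a m\<bar> * (2 * \<gamma>1 * \<gamma>2))"
  have C: "op_bounded (Q * A - A * Q) C" "0 \<le> C"
  proof -
    show "0 \<le> C" using \<gamma> by (auto simp: C_def intro!: sum_nonneg)
    show "op_bounded (Q * A - A * Q) C"
      unfolding Q_def A_def C_def
    proof (rule op_bounded_commutator_mat_sum)
      fix m assume m: "m \<in> {1..d}"
      let ?H1 = "on_register d nx (H1 nx \<gamma>1) m" and ?H2 = "on_register d nx (H2 nx \<gamma>2) m"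
      have c: "?H1 \<in> carrier_mat ?D ?D" "?H2 \<in> carrier_mat ?D ?D" using on1 on2 m by auto
      have c': "H2 nx \<gamma>2 * H1 nx \<gamma>1 \<in> carrier_mat ?N ?N" "H1 nx \<gamma>1 * H2 nx \<gamma>2 \<in> carrier_mat ?N ?N"
        by (auto intro!: mult_carrier_mat [where n = ?N])
      have "?H2 * ?H1 - ?H1 * ?H2 = on_register d nx (H2 nx \<gamma>2 * H1 nx \<gamma>1 - H1 nx \<gamma>1 * H2 nx \<gamma>2) m"
        using m c' by (simp add: on_register_mult on_register_diff)
      then have "op_bounded (?H2 * ?H1 - ?H1 * ?H2) (2 * \<gamma>1 * \<gamma>2)"
        using op_bounded_on_register [OF _ H2_H1_commutator [OF \<gamma>]] c' \<gamma> by (simp add: minus_carrier_mat)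
      from op_bounded_smult [OF this, of "of_real (b m * a m)"]
      have "op_bounded (of_real (b m * a m) \<cdot>\<^sub>m (?H2 * ?H1 - ?H1 * ?H2)) (\<bar>b m\<bar> * \<bar>a m\<bar> * (2 * \<gamma>1 * \<gamma>2))"
        by (simp add: norm_mult)
      moreover have "of_real (b m * a m) \<cdot>\<^sub>m (?H2 * ?H1 - ?H1 * ?H2)
          = (of_real (b m) \<cdot>\<^sub>m ?H2) * (of_real (a m) \<cdot>\<^sub>m ?H1) - (of_real (a m) \<cdot>\<^sub>m ?H1) * (of_real (b m) \<cdot>\<^sub>m ?H2)"
        using c by (intro eq_matI)
          (auto simp: mult_smult_distrib [of _ ?D ?D _ ?D] mult_smult_assoc_mat [of _ ?D ?D _ ?D] algebra_simps
            simp del: index_mult_mat(1))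
      ultimately show "op_bounded ((of_real (b m) \<cdot>\<^sub>m ?H2) * (of_real (a m) \<cdot>\<^sub>m ?H1)
          - (of_real (a m) \<cdot>\<^sub>m ?H1) * (of_real (b m) \<cdot>\<^sub>m ?H2)) (\<bar>b m\<bar> * \<bar>a m\<bar> * (2 * \<gamma>1 * \<gamma>2))"
        by simp
    next
      fix m l assume ml: "m \<in> {1..d}" "l \<in> {1..d}" "m \<noteq> l"
      show "(of_real (b m) \<cdot>\<^sub>m on_register d nx (H2 nx \<gamma>2) m) * (of_real (a l) \<cdot>\<^sub>m on_register d nx (H1 nx \<gamma>1) l)
          = (of_real (a l) \<cdot>\<^sub>m on_register d nx (H1 nx \<gamma>1) l) * (of_real (b m) \<cdot>\<^sub>m on_register d nx (H2 nx \<gamma>2) m)"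
        using ml by (simp add: on_register_smult on_register_commute)
    qed (use on1 on2 in auto)
  qed
  have dim: "(2::nat) ^ (d * nx + np) = ?D * P" by (simp add: P_def power_add)
  have VBS: "V_BS d nx np \<gamma>1 \<gamma>2 r \<sigma> \<rho> \<tau>
      = (W \<otimes>\<^sub>k 1\<^sub>m P) * mat_sum (?D * P) (\<lambda>k. mat_powi V (z k) \<otimes>\<^sub>k ket_bra P k k) {0..<P}"
    unfolding V_BS_def dim idq_eq P_def [symmetric] V_def W_def z_def ..
  have HBS: "H_BS d nx np \<gamma>1 \<gamma>2 r \<sigma> \<rho>
      = mat_sum (?D * P) (\<lambda>k. of_int (z k) \<cdot>\<^sub>m (A \<otimes>\<^sub>k ket_bra P k k)) {0..<P} + Q \<otimes>\<^sub>k 1\<^sub>m P"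
  proof -
    have "real (2 ^ np) = real P" by (simp add: P_def)
    then have "H_BS d nx np \<gamma>1 \<gamma>2 r \<sigma> \<rho>
        = mat_sum (?D * P) (\<lambda>k. of_int (z k) \<cdot>\<^sub>m (A \<otimes>\<^sub>k ket_bra P k k)) {0..<P}
        + mat_sum (?D * P) (\<lambda>m. of_real (b m) \<cdot>\<^sub>m (on_register d nx (H2 nx \<gamma>2) m \<otimes>\<^sub>k 1\<^sub>m P)) {1..d}"
      unfolding H_BS_def dim idq_eq P_def [symmetric] A_def a_def b_def zc [symmetric]
      by simp
    \<comment> \<open>Both sides have the same block form, with one copy of \<open>Q\<close> for
      every value of the auxiliary variable.\<close>
    also have "mat_sum (?D * P) (\<lambda>m. of_real (b m) \<cdot>\<^sub>m (on_register d nx (H2 nx \<gamma>2) m \<otimes>\<^sub>k 1\<^sub>m P)) {1..d} = Q \<otimes>\<^sub>k 1\<^sub>m P"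
      by (rule trans [OF mat_sum_kron_one [OF on2]]) (simp_all only: Q_def [symmetric] kron_one_block_mat [OF carr(2)])
    finally show ?thesis .
  qed
  have UBS: "U_BS d nx np \<gamma>1 \<gamma>2 r \<sigma> \<rho> \<tau> = mat_exp ((\<i> * of_real \<tau>) \<cdot>\<^sub>m
      (mat_sum (?D * P) (\<lambda>k. of_int (z k) \<cdot>\<^sub>m (A \<otimes>\<^sub>k ket_bra P k k)) {0..<P} + Q \<otimes>\<^sub>k 1\<^sub>m P))"
    unfolding U_BS_def HBS ..
  note bound = block_trotter_bound [OF carr(1) herm(1) carr(2) herm(2) V W eV eW C e0 e0 zK K0]
  have "\<tau>\<^sup>2 * K * C / 2 + e \<gamma>2 b + K * e \<gamma>1 a
      = (\<Sum>m\<in>{1..d}. \<tau>\<^sup>2 * K * (\<bar>b m\<bar> * \<bar>a m\<bar> * (2 * \<gamma>1 * \<gamma>2)) / 2 + real nx * (\<gamma>2 * (b m * \<tau>))\<^sup>2 / 2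
        + K * (real nx * (\<gamma>1 * (a m * \<tau>))\<^sup>2 / 2))"
    by (simp add: C_def e_def sum.distrib sum_distrib_left sum_divide_distrib)
  also have "\<dots> \<le> (\<Sum>m\<in>{1..d}. 1 / 4 * \<tau>\<^sup>2 * real nx *
      (real (2 ^ np) * \<gamma>1\<^sup>2 + 2 * \<gamma>2\<^sup>2 + 2 * real (2 ^ np) * \<gamma>1 * \<gamma>2) * (c m)\<^sup>2)"
  proof (rule sum_mono)
    fix m assume m: "m \<in> {1..d}"
    have sq: "(a m)\<^sup>2 \<le> (c m)\<^sup>2" "(b m)\<^sup>2 \<le> (c m)\<^sup>2"
      using ac [OF m] bc [OF m] by (simp_all add: power2_le_iff_abs_le abs_le_square_iff)
    have "\<bar>b m\<bar> * \<bar>a m\<bar> \<le> c m * c m"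
      using ac [OF m] bc [OF m] by (intro mult_mono) auto
    then have "\<bar>b m\<bar> * \<bar>a m\<bar> * (2 * \<gamma>1 * \<gamma>2) \<le> (c m)\<^sup>2 * (2 * \<gamma>1 * \<gamma>2)"
      unfolding power2_eq_square using \<gamma> by (intro mult_right_mono) auto
    \<comment> \<open>The mixed error does not grow with the number of qubits;
      \<open>nx \<ge> 1\<close> enlarges it so that it shares the common factor.\<close>
    also have "\<dots> \<le> real nx * ((c m)\<^sup>2 * (2 * \<gamma>1 * \<gamma>2))"
      using assms(2) \<gamma> mult_right_mono [of 1 "real nx" "(c m)\<^sup>2 * (2 * \<gamma>1 * \<gamma>2)"] by simp
    finally have "\<tau>\<^sup>2 * K * (\<bar>b m\<bar> * \<bar>a m\<bar> * (2 * \<gamma>1 * \<gamma>2)) \<le> \<tau>\<^sup>2 * K * (real nx * ((c m)\<^sup>2 * (2 * \<gamma>1 * \<gamma>2)))"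
      using K0 by (intro mult_left_mono) auto
    moreover have "real nx * \<gamma>2\<^sup>2 * \<tau>\<^sup>2 * (b m)\<^sup>2 \<le> real nx * \<gamma>2\<^sup>2 * \<tau>\<^sup>2 * (c m)\<^sup>2"
      using sq by (intro mult_left_mono) auto
    moreover have "K * real nx * \<gamma>1\<^sup>2 * \<tau>\<^sup>2 * (a m)\<^sup>2 \<le> K * real nx * \<gamma>1\<^sup>2 * \<tau>\<^sup>2 * (c m)\<^sup>2"
      using sq K0 by (intro mult_left_mono) auto
    \<comment> \<open>As \<open>K\<close> is N_p/2, the coefficients N_p/4, 2/4 and 2 N_p/4 become
      K/2, 1/2 and K.\<close>
    moreover have "1 / 4 * \<tau>\<^sup>2 * real nx * (real (2 ^ np) * \<gamma>1\<^sup>2 + 2 * \<gamma>2\<^sup>2 + 2 * real (2 ^ np) * \<gamma>1 * \<gamma>2) * (c m)\<^sup>2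
        = \<tau>\<^sup>2 * K * (real nx * ((c m)\<^sup>2 * (2 * \<gamma>1 * \<gamma>2))) / 2 + real nx * \<gamma>2\<^sup>2 * \<tau>\<^sup>2 * (c m)\<^sup>2 / 2
          + K * real nx * \<gamma>1\<^sup>2 * \<tau>\<^sup>2 * (c m)\<^sup>2 / 2"
      by (simp add: K_def P_def field_simps)
    moreover have "\<tau>\<^sup>2 * K * (\<bar>b m\<bar> * \<bar>a m\<bar> * (2 * \<gamma>1 * \<gamma>2)) / 2 + real nx * (\<gamma>2 * (b m * \<tau>))\<^sup>2 / 2
          + K * (real nx * (\<gamma>1 * (a m * \<tau>))\<^sup>2 / 2)
        = \<tau>\<^sup>2 * K * (\<bar>b m\<bar> * \<bar>a m\<bar> * (2 * \<gamma>1 * \<gamma>2)) / 2 + real nx * \<gamma>2\<^sup>2 * \<tau>\<^sup>2 * (b m)\<^sup>2 / 2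
          + K * real nx * \<gamma>1\<^sup>2 * \<tau>\<^sup>2 * (a m)\<^sup>2 / 2"
      by (simp add: power_mult_distrib mult_ac)
    ultimately show "\<tau>\<^sup>2 * K * (\<bar>b m\<bar> * \<bar>a m\<bar> * (2 * \<gamma>1 * \<gamma>2)) / 2 + real nx * (\<gamma>2 * (b m * \<tau>))\<^sup>2 / 2
          + K * (real nx * (\<gamma>1 * (a m * \<tau>))\<^sup>2 / 2)
        \<le> 1 / 4 * \<tau>\<^sup>2 * real nx * (real (2 ^ np) * \<gamma>1\<^sup>2 + 2 * \<gamma>2\<^sup>2 + 2 * real (2 ^ np) * \<gamma>1 * \<gamma>2) * (c m)\<^sup>2"
      by linarith
  qed
  also have "\<dots> = 1 / 4 * \<tau>\<^sup>2 * real nx *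
      (real (2 ^ np) * \<gamma>1\<^sup>2 + 2 * \<gamma>2\<^sup>2 + 2 * real (2 ^ np) * \<gamma>1 * \<gamma>2) * (\<Sum>m = 1..d. (c m)\<^sup>2)"
    by (simp add: sum_distrib_left)
  finally have le: "\<tau>\<^sup>2 * K * C / 2 + e \<gamma>2 b + K * e \<gamma>1 a \<le> \<dots>" .
  have nonneg: "0 \<le> \<tau>\<^sup>2 * K * C / 2 + e \<gamma>2 b + K * e \<gamma>1 a"
    using K0 C(2) e0 by simp
  show ?thesis
    unfolding UBS VBS using bound(1) order_trans [OF op_norm_le [OF bound(2) nonneg] le] by simp
qed

end
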